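(* Let $\Omega$ be a finite set of cardinality $d\ge 3$, let $T_d$ be the $d$-regular tree with a fixed legal coloring $l:E\to\Omega$ and base vertex $b$, and let $p$ be a prime. Let $F\le\mathrm{Sym}(\Omega)$ and let $F(p)\le F$ be a $p$-Sylow subgroup. If $F\backslash\Omega=F(p)\backslash\Omega$ (that is, $F$ and $F(p)$ have the same orbits on $\Omega$) and $N_{\widehat{F}_{\omega}}(F(p)_{\omega})=F(p)_{\omega}$ for all $\omega\in\Omega$, then $$\mathrm{N}(F)_{(p)}=\mathrm{N}(F(p)),$$ where the $p$-localization $\mathrm{N}(F)_{(p)}$ is formed with respect to the local $p$-Sylow subgroup $S=\mathrm{U}(F(p))_b$ of $\mathrm{N}(F)$.
   Context: Graphs are in Serre's sense: $T_d=(V,E)$ has vertex set $V$ and a set $E$ of oriented edges, with origin and terminus maps $o,t:E\to V$ and a fixed-point-free involution $e\mapsto\overline{e}$ on $E$ reversing orientation. For $x\in V$ let $E(x)=\{e\in E\mid o(e)=x\}$. A legal coloring is a map $l:E\to\Omega$ such that $l(e)=l(\overline{e})$ for all $e\in E$ and, for every $x\in V$, the restriction $l_x:=l|_{E(x)}:E(x)\to\Omega$ is a bijection. For $g\in\mathrm{Aut}(T_d)$ and $x\in V$ put $\sigma(g,x):=l_{gx}\circ g\circ l_x^{-1}\in\mathrm{Sym}(\Omega)$. For $F\le\mathrm{Sym}(\Omega)$ let $\mathrm{U}(F):=\{g\in\mathrm{Aut}(T_d)\mid \forall x\in V:\ \sigma(g,x)\in F\}$, with the subspace topology from $\mathrm{Aut}(T_d)$,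 which carries the permutation topology for its action on $V$. Let $\widehat{F}:=\prod_{i\in I}\mathrm{Sym}(\Omega_i)\le\mathrm{Sym}(\Omega)$, where $\Omega=\bigsqcup_{i\in I}\Omega_i$ is the partition $F\backslash\Omega$ of $\Omega$ into $F$-orbits. Subscripts $b$ and $\omega$ denote point stabilizers. Lederle's coloured Neretin group $\mathrm{N}(F)$: a finite subtree $T\subseteq T_d$ is complete if it contains $b$ and all its non-leaf vertices have valency $d$ in $T$. Let $L(T)$ be its set of leaves. For $v\in L(T)$ let $T_v$ be the subtree of $T_d$ spanned by $v$ and those vertices outside $T$ whose closest vertex in $T$ is $v$; set $T_d\backslash T:=\bigsqcup_{v\in L(T)}T_v$, a forest. Given finite complete subtrees $T,T'$ with $|L(T)|=|L(T')|$ and $H\le\mathrm{Aut}(T_d)$, an $H$-honest almost automorphism is a forest isomorphism $\varphi:T_d\backslash T\to T_d\backslash T'$ such that for every $v\in L(T)$ there is $h_v\in H$ with $\varphi|_{T_v}=h_v|_{T_v}$. Two such, $\varphi:T_d\backslash T_1\to T_d\backslash T_1'$ and $\psi:T_d\backslash T_2\to T_d\backslash T_2'$, are equivalent if there is a finite complete subtree $T\supseteq T_1\cup T_2$ with $\varphi|_{T_d\backslash T}=\psi|_{T_d\backslash T}$. For every finite complete $T\supseteq T_1$ there is a unique finite complete $T'\supseteq T_1'$ and a representative $T_d\backslash T\to T_d\backslash T'$ of the class of $\varphi$ (and analogously for enlargements of $T_1'$), so equivalence classes are composed by choosing representatives with matching codomain and domain. Then $\mathrm{N}(F)$ is the group of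 equivalence classes $[\varphi]$ of $\mathrm{U}(F)$-honest almost automorphisms of $T_d$. The group $\mathrm{U}(F)$ embeds in $\mathrm{N}(F)$ by restricting automorphisms to complements of sufficiently large finite complete subtrees, and $\mathrm{N}(F)$ carries the unique group topology making $\mathrm{U}(F)\to\mathrm{N}(F)$ continuous and open. Since every $\mathrm{U}(F(p))$-honest almost automorphism is $\mathrm{U}(F)$-honest, $\mathrm{N}(F(p))$ is regarded as a subgroup of $\mathrm{N}(F)$. A local $p$-Sylow subgroup of a totally disconnected locally compact group $G$ is a maximal pro-$p$ subgroup of a compact open subgroup of $G$. For groups $H\le G$, the commensurator is $\mathrm{Comm}_G(H):=\{g\in G\mid [H:H\cap gHg^{-1}]<\infty\text{ and }[gHg^{-1}:gHg^{-1}\cap H]<\infty\}$. The $p$-localization $G_{(p)}$ of $G$ is $\mathrm{Comm}_G(S)$ for a local $p$-Sylow subgroup $S$ of $G$, equipped with the unique group topology making the inclusion $S\to\mathrm{Comm}_G(S)$ continuous and open. *)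

theory Defs
  imports
    "HOL-Analysis.Analysis"
    "HOL-Computational_Algebra.Primes"
    "HOL-Algebra.Bij"
    "HOL-Algebra.Group_Action"
begin

section \<open>Topological groups\<close>

definition topological_group :: "('g, 'm) monoid_scheme \<Rightarrow> 'g topology \<Rightarrow> bool" where
  "topological_group G \<tau> \<longleftrightarrow>
     group G \<and> topspace \<tau> = carrier G \<and>
     continuous_map (prod_topology \<tau> \<tau>) \<tau> (\<lambda>(x, y). x \<otimes>\<^bsub>G\<^esub> y) \<and>
     continuous_map \<tau> \<tau> (\<lambda>x. inv\<^bsub>G\<^esub> x)"

definition profinite_group :: "('g, 'm) monoid_scheme \<Rightarrow> 'g topology \<Rightarrow> bool" where
  "profinite_group G \<tau> \<longleftrightarrow>
     topological_group G \<tau> \<and> compact_space \<tau> \<and> Hausdorff_space \<tau> \<and>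
     (\<forall>U. openin \<tau> U \<and> \<one>\<^bsub>G\<^esub> \<in> U \<longrightarrow> (\<exists>H. subgroup H G \<and> openin \<tau> H \<and> H \<subseteq> U))"

definition pro_p_group :: "nat \<Rightarrow> ('g, 'm) monoid_scheme \<Rightarrow> 'g topology \<Rightarrow> bool" where
  "pro_p_group p G \<tau> \<longleftrightarrow>
     profinite_group G \<tau> \<and>
     (\<forall>N. N \<lhd> G \<and> openin \<tau> N \<longrightarrow> (\<exists>n. order (G Mod N) = p ^ n))"

definition pro_p_subgroup :: "nat \<Rightarrow> ('g, 'm) monoid_scheme \<Rightarrow> 'g topology \<Rightarrow> 'g set \<Rightarrow> bool" where
  "pro_p_subgroup p G \<tau> H \<longleftrightarrow>
     subgroup H G \<and> pro_p_group p (G\<lparr>carrier := H\<rparr>) (subtopology \<tau> H)"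

definition local_sylow_subgroup ::
    "nat \<Rightarrow> ('g, 'm) monoid_scheme \<Rightarrow> 'g topology \<Rightarrow> 'g set \<Rightarrow> bool" where
  "local_sylow_subgroup p G \<tau> S \<longleftrightarrow>
     (\<exists>K. subgroup K G \<and> openin \<tau> K \<and> compactin \<tau> K \<and>
        S \<subseteq> K \<and> pro_p_subgroup p G \<tau> S \<and>
        (\<forall>Q. Q \<subseteq> K \<and> pro_p_subgroup p G \<tau> Q \<and> S \<subseteq> Q \<longrightarrow> Q = S))"

definition finite_index :: "('g, 'm) monoid_scheme \<Rightarrow> 'g set \<Rightarrow> 'g set \<Rightarrow> bool" where
  "finite_index G H K \<longleftrightarrow> finite (rcosets\<^bsub>G\<lparr>carrier := H\<rparr>\<^esub> K)"

definition commensurator :: "('g, 'm) monoid_scheme \<Rightarrow> 'g set \<Rightarrow> 'g set" where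
  "commensurator G H =
     {g \<in> carrier G.
        let H' = g <#\<^bsub>G\<^esub> H #>\<^bsub>G\<^esub> inv\<^bsub>G\<^esub> g
        in finite_index G H (H \<inter> H') \<and> finite_index G H' (H' \<inter> H)}"

text \<open>The group topology on \<open>G\<close> for which the homomorphism \<open>i\<close> from a topological group with
  topology \<open>\<sigma>\<close> is continuous and open. There is at most one such topology.\<close>

definition group_topology_via ::
    "('g, 'm) monoid_scheme \<Rightarrow> 'h topology \<Rightarrow> ('h \<Rightarrow> 'g) \<Rightarrow> 'g topology" where
  "group_topology_via G \<sigma> i =
     (THE \<tau>. topological_group G \<tau> \<and> continuous_map \<sigma> \<tau> i \<and> open_map \<sigma> \<tau> i)"

definition localization ::
    "'g monoid \<Rightarrow> 'g topology \<Rightarrow> 'g set \<Rightarrow> 'g monoid \<times> 'g topology" where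
  "localization G \<tau> S =
     (G\<lparr>carrier := commensurator G S\<rparr>,
      group_topology_via (G\<lparr>carrier := commensurator G S\<rparr>) (subtopology \<tau> S) (\<lambda>s. s))"

section \<open>Permutation groups on the set of colors\<close>

text \<open>The set of colors is the universe of a finite type. A subgroup \<open>F\<close> of the symmetric group
  is represented by its set of elements.\<close>

abbreviation Sym :: "('c \<Rightarrow> 'c) monoid" where
  "Sym \<equiv> BijGroup UNIV"

definition perm_group :: "('c \<Rightarrow> 'c) set \<Rightarrow> ('c \<Rightarrow> 'c) monoid" where
  "perm_group F = Sym\<lparr>carrier := F\<rparr>"

definition perm_orbits :: "('c \<Rightarrow> 'c) set \<Rightarrow> 'c set set" where
  "perm_orbits F = orbits (perm_group F) UNIV (\<lambda>f. f)"

definition point_stabilizer :: "('c \<Rightarrow> 'c) set \<Rightarrow> 'c \<Rightarrow> ('c \<Rightarrow> 'c) set" where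
  "point_stabilizer F \<omega> = stabilizer (perm_group F) (\<lambda>f. f) \<omega>"

text \<open>The product of the symmetric groups of the orbits of \<open>F\<close>, as a subgroup of \<open>Sym\<close>.\<close>

definition orbit_sym :: "('c \<Rightarrow> 'c) set \<Rightarrow> ('c \<Rightarrow> 'c) set" where
  "orbit_sym F = {\<pi> \<in> carrier Sym. \<forall>A\<in>perm_orbits F. \<pi> ` A = A}"

definition sylow_subgroup :: "nat \<Rightarrow> ('g, 'm) monoid_scheme \<Rightarrow> 'g set \<Rightarrow> bool" where
  "sylow_subgroup p G P \<longleftrightarrow> subgroup P G \<and> card P = p ^ multiplicity p (order G)"

section \<open>Trees in the sense of Serre\<close>

text \<open>The vertex set and the set of oriented edges are the universes of \<open>'v\<close> and \<open>'e\<close>;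
  \<open>col\<close> is the edge coloring and \<open>base\<close> the base vertex.\<close>

record ('v, 'e, 'c) colored_graph =
  org :: "'e \<Rightarrow> 'v"
  ter :: "'e \<Rightarrow> 'v"
  opp :: "'e \<Rightarrow> 'e"
  col :: "'e \<Rightarrow> 'c"
  base :: 'v

definition serre_graph :: "('v, 'e, 'c) colored_graph \<Rightarrow> bool" where
  "serre_graph \<Gamma> \<longleftrightarrow>
     (\<forall>e. opp \<Gamma> (opp \<Gamma> e) = e \<and> opp \<Gamma> e \<noteq> e \<and>
          org \<Gamma> (opp \<Gamma> e) = ter \<Gamma> e \<and> ter \<Gamma> (opp \<Gamma> e) = org \<Gamma> e)"

fun walk :: "('v, 'e, 'c) colored_graph \<Rightarrow> 'v \<Rightarrow> 'e list \<Rightarrow> 'v \<Rightarrow> bool" where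
  "walk \<Gamma> x [] y \<longleftrightarrow> x = y"
| "walk \<Gamma> x (e # es) y \<longleftrightarrow> org \<Gamma> e = x \<and> walk \<Gamma> (ter \<Gamma> e) es y"

definition circuit :: "('v, 'e, 'c) colored_graph \<Rightarrow> 'e list \<Rightarrow> bool" where
  "circuit \<Gamma> es \<longleftrightarrow>
     es \<noteq> [] \<and> walk \<Gamma> (org \<Gamma> (hd es)) es (org \<Gamma> (hd es)) \<and> distinct (map (org \<Gamma>) es) \<and>
     (\<forall>i. Suc i < length es \<longrightarrow> es ! Suc i \<noteq> opp \<Gamma> (es ! i))"

definition tree :: "('v, 'e, 'c) colored_graph \<Rightarrow> bool" where
  "tree \<Gamma> \<longleftrightarrow>
     serre_graph \<Gamma> \<and> (\<forall>x y. \<exists>es. walk \<Gamma> x es y) \<and> (\<nexists>es. circuit \<Gamma> es)"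

definition edges_at :: "('v, 'e, 'c) colored_graph \<Rightarrow> 'v \<Rightarrow> 'e set" where
  "edges_at \<Gamma> x = {e. org \<Gamma> e = x}"

definition regular_tree :: "('v, 'e, 'c) colored_graph \<Rightarrow> nat \<Rightarrow> bool" where
  "regular_tree \<Gamma> d \<longleftrightarrow> tree \<Gamma> \<and> (\<forall>x. finite (edges_at \<Gamma> x) \<and> card (edges_at \<Gamma> x) = d)"

definition legal_coloring :: "('v, 'e, 'c) colored_graph \<Rightarrow> bool" where
  "legal_coloring \<Gamma> \<longleftrightarrow>
     (\<forall>e. col \<Gamma> e = col \<Gamma> (opp \<Gamma> e)) \<and> (\<forall>x. bij_betw (col \<Gamma>) (edges_at \<Gamma> x) UNIV)"

section \<open>Universal groups\<close>

text \<open>A graph morphism is a pair consisting of its vertex map and its edge map.\<close>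

definition automorphisms ::
    "('v, 'e, 'c) colored_graph \<Rightarrow> (('v \<Rightarrow> 'v) \<times> ('e \<Rightarrow> 'e)) set" where
  "automorphisms \<Gamma> =
     {(gv, ge). bij gv \<and> bij ge \<and>
        (\<forall>e. org \<Gamma> (ge e) = gv (org \<Gamma> e) \<and> ter \<Gamma> (ge e) = gv (ter \<Gamma> e) \<and>
             opp \<Gamma> (ge e) = ge (opp \<Gamma> e))}"

definition automorphism_topology ::
    "('v, 'e, 'c) colored_graph \<Rightarrow> (('v \<Rightarrow> 'v) \<times> ('e \<Rightarrow> 'e)) topology" where
  "automorphism_topology \<Gamma> =
     pullback_topology (automorphisms \<Gamma>) fst (product_topology (\<lambda>_. discrete_topology UNIV) UNIV)"

definition local_action ::
    "('v, 'e, 'c) colored_graph \<Rightarrow> ('v \<Rightarrow> 'v) \<times> ('e \<Rightarrow> 'e) \<Rightarrow> 'v \<Rightarrow> 'c \<Rightarrow> 'c" where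
  "local_action \<Gamma> g x = col \<Gamma> \<circ> snd g \<circ> inv_into (edges_at \<Gamma> x) (col \<Gamma>)"

definition universal_group ::
    "('v, 'e, 'c) colored_graph \<Rightarrow> ('c \<Rightarrow> 'c) set \<Rightarrow> (('v \<Rightarrow> 'v) \<times> ('e \<Rightarrow> 'e)) set" where
  "universal_group \<Gamma> F = {g \<in> automorphisms \<Gamma>. \<forall>x. local_action \<Gamma> g x \<in> F}"

definition universal_group_topology ::
    "('v, 'e, 'c) colored_graph \<Rightarrow> ('c \<Rightarrow> 'c) set \<Rightarrow> (('v \<Rightarrow> 'v) \<times> ('e \<Rightarrow> 'e)) topology" where
  "universal_group_topology \<Gamma> F = subtopology (automorphism_topology \<Gamma>) (universal_group \<Gamma> F)"

definition base_stabilizer ::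
    "('v, 'e, 'c) colored_graph \<Rightarrow> (('v \<Rightarrow> 'v) \<times> ('e \<Rightarrow> 'e)) set \<Rightarrow> (('v \<Rightarrow> 'v) \<times> ('e \<Rightarrow> 'e)) set" where
  "base_stabilizer \<Gamma> H = {h \<in> H. fst h (base \<Gamma>) = base \<Gamma>}"

section \<open>Complete subtrees and their complements\<close>

text \<open>A subtree of a tree is determined by its vertex set: it contains every edge both of whose
  endpoints belong to it.\<close>

definition spanned_edges :: "('v, 'e, 'c) colored_graph \<Rightarrow> 'v set \<Rightarrow> 'e set" where
  "spanned_edges \<Gamma> A = {e. org \<Gamma> e \<in> A \<and> ter \<Gamma> e \<in> A}"

definition subtree :: "('v, 'e, 'c) colored_graph \<Rightarrow> 'v set \<Rightarrow> bool" where
  "subtree \<Gamma> T \<longleftrightarrow>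
     T \<noteq> {} \<and> (\<forall>x\<in>T. \<forall>y\<in>T. \<exists>es. walk \<Gamma> x es y \<and> set es \<subseteq> spanned_edges \<Gamma> T)"

definition valency_in :: "('v, 'e, 'c) colored_graph \<Rightarrow> 'v set \<Rightarrow> 'v \<Rightarrow> nat" where
  "valency_in \<Gamma> T x = card (edges_at \<Gamma> x \<inter> spanned_edges \<Gamma> T)"

definition leaves :: "('v, 'e, 'c) colored_graph \<Rightarrow> 'v set \<Rightarrow> 'v set" where
  "leaves \<Gamma> T = {x \<in> T. valency_in \<Gamma> T x = 1}"

text \<open>The degree of the tree is the number of colors.\<close>

definition complete_subtree :: "('v, 'e, 'c) colored_graph \<Rightarrow> 'v set \<Rightarrow> bool" where
  "complete_subtree \<Gamma> T \<longleftrightarrow>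
     finite T \<and> subtree \<Gamma> T \<and> base \<Gamma> \<in> T \<and>
     (\<forall>x \<in> T - leaves \<Gamma> T. valency_in \<Gamma> T x = CARD('c))"

definition vertex_dist :: "('v, 'e, 'c) colored_graph \<Rightarrow> 'v \<Rightarrow> 'v \<Rightarrow> nat" where
  "vertex_dist \<Gamma> x y = (LEAST n. \<exists>es. walk \<Gamma> x es y \<and> length es = n)"

text \<open>The vertex set of the subtree \<open>T\<^sub>v\<close>.\<close>

definition branch :: "('v, 'e, 'c) colored_graph \<Rightarrow> 'v set \<Rightarrow> 'v \<Rightarrow> 'v set" where
  "branch \<Gamma> T v =
     insert v {w. w \<notin> T \<and> (\<forall>u \<in> T - {v}. vertex_dist \<Gamma> w v < vertex_dist \<Gamma> w u)}"

definition forest_verts :: "('v, 'e, 'c) colored_graph \<Rightarrow> 'v set \<Rightarrow> 'v set" where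
  "forest_verts \<Gamma> T = (\<Union>v\<in>leaves \<Gamma> T. branch \<Gamma> T v)"

definition forest_edges :: "('v, 'e, 'c) colored_graph \<Rightarrow> 'v set \<Rightarrow> 'e set" where
  "forest_edges \<Gamma> T = (\<Union>v\<in>leaves \<Gamma> T. spanned_edges \<Gamma> (branch \<Gamma> T v))"

section \<open>Almost automorphisms\<close>

text \<open>A map between the complements of \<open>dom_tree\<close> and \<open>cod_tree\<close>.\<close>

record ('v, 'e) forest_map =
  dom_tree :: "'v set"
  cod_tree :: "'v set"
  vmap :: "'v \<Rightarrow> 'v"
  emap :: "'e \<Rightarrow> 'e"

definition forest_isomorphism ::
    "('v, 'e, 'c) colored_graph \<Rightarrow> ('v, 'e) forest_map \<Rightarrow> bool" where
  "forest_isomorphism \<Gamma> \<phi> \<longleftrightarrow>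
     vmap \<phi> \<in> extensional (forest_verts \<Gamma> (dom_tree \<phi>)) \<and>
     emap \<phi> \<in> extensional (forest_edges \<Gamma> (dom_tree \<phi>)) \<and>
     bij_betw (vmap \<phi>) (forest_verts \<Gamma> (dom_tree \<phi>)) (forest_verts \<Gamma> (cod_tree \<phi>)) \<and>
     bij_betw (emap \<phi>) (forest_edges \<Gamma> (dom_tree \<phi>)) (forest_edges \<Gamma> (cod_tree \<phi>)) \<and>
     (\<forall>e \<in> forest_edges \<Gamma> (dom_tree \<phi>).
        org \<Gamma> (emap \<phi> e) = vmap \<phi> (org \<Gamma> e) \<and> ter \<Gamma> (emap \<phi> e) = vmap \<phi> (ter \<Gamma> e) \<and>
        opp \<Gamma> (emap \<phi> e) = emap \<phi> (opp \<Gamma> e))"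

definition honest_almost_automorphisms ::
    "('v, 'e, 'c) colored_graph \<Rightarrow> (('v \<Rightarrow> 'v) \<times> ('e \<Rightarrow> 'e)) set \<Rightarrow> ('v, 'e) forest_map set" where
  "honest_almost_automorphisms \<Gamma> H =
     {\<phi>. complete_subtree \<Gamma> (dom_tree \<phi>) \<and> complete_subtree \<Gamma> (cod_tree \<phi>) \<and>
         card (leaves \<Gamma> (dom_tree \<phi>)) = card (leaves \<Gamma> (cod_tree \<phi>)) \<and>
         forest_isomorphism \<Gamma> \<phi> \<and>
         (\<forall>v \<in> leaves \<Gamma> (dom_tree \<phi>). \<exists>h\<in>H.
            (\<forall>x \<in> branch \<Gamma> (dom_tree \<phi>) v. vmap \<phi> x = fst h x) \<and>
            (\<forall>e \<in> spanned_edges \<Gamma> (branch \<Gamma> (dom_tree \<phi>) v). emap \<phi> e = snd h e))}"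

abbreviation almost_automorphisms ::
    "('v, 'e, 'c) colored_graph \<Rightarrow> ('v, 'e) forest_map set" where
  "almost_automorphisms \<Gamma> \<equiv> honest_almost_automorphisms \<Gamma> (automorphisms \<Gamma>)"

definition almost_equivalent ::
    "('v, 'e, 'c) colored_graph \<Rightarrow> ('v, 'e) forest_map \<Rightarrow> ('v, 'e) forest_map \<Rightarrow> bool" where
  "almost_equivalent \<Gamma> \<phi> \<psi> \<longleftrightarrow>
     (\<exists>T. complete_subtree \<Gamma> T \<and> dom_tree \<phi> \<union> dom_tree \<psi> \<subseteq> T \<and>
        (\<forall>x \<in> forest_verts \<Gamma> T. vmap \<phi> x = vmap \<psi> x) \<and>
        (\<forall>e \<in> forest_edges \<Gamma> T. emap \<phi> e = emap \<psi> e))"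

text \<open>Classes are formed among all almost automorphisms, honest or not with respect to a given
  subgroup of the automorphism group. In this way the groups for different local actions are
  literally subsets of each other.\<close>

definition almost_class ::
    "('v, 'e, 'c) colored_graph \<Rightarrow> ('v, 'e) forest_map \<Rightarrow> ('v, 'e) forest_map set" where
  "almost_class \<Gamma> \<phi> = {\<psi> \<in> almost_automorphisms \<Gamma>. almost_equivalent \<Gamma> \<phi> \<psi>}"

definition forest_comp ::
    "('v, 'e, 'c) colored_graph \<Rightarrow> ('v, 'e) forest_map \<Rightarrow> ('v, 'e) forest_map \<Rightarrow> ('v, 'e) forest_map" where
  "forest_comp \<Gamma> \<phi> \<psi> =
     \<lparr>dom_tree = dom_tree \<psi>, cod_tree = cod_tree \<phi>,
      vmap = compose (forest_verts \<Gamma> (dom_tree \<psi>)) (vmap \<phi>) (vmap \<psi>),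
      emap = compose (forest_edges \<Gamma> (dom_tree \<psi>)) (emap \<phi>) (emap \<psi>)\<rparr>"

text \<open>The union ranges over all composable representatives. They all yield the same class.\<close>

definition class_mult ::
    "('v, 'e, 'c) colored_graph \<Rightarrow>
     ('v, 'e) forest_map set \<Rightarrow> ('v, 'e) forest_map set \<Rightarrow> ('v, 'e) forest_map set" where
  "class_mult \<Gamma> A B =
     \<Union>{almost_class \<Gamma> (forest_comp \<Gamma> \<phi> \<psi>) | \<phi> \<psi>. \<phi> \<in> A \<and> \<psi> \<in> B \<and> cod_tree \<psi> = dom_tree \<phi>}"

definition forest_restriction ::
    "('v, 'e, 'c) colored_graph \<Rightarrow> ('v \<Rightarrow> 'v) \<times> ('e \<Rightarrow> 'e) \<Rightarrow> 'v set \<Rightarrow> ('v, 'e) forest_map" where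
  "forest_restriction \<Gamma> g T =
     \<lparr>dom_tree = T, cod_tree = fst g ` T,
      vmap = restrict (fst g) (forest_verts \<Gamma> T),
      emap = restrict (snd g) (forest_edges \<Gamma> T)\<rparr>"

text \<open>The class of an automorphism. Again all admissible subtrees \<open>T\<close> yield the same class.\<close>

definition class_of_automorphism ::
    "('v, 'e, 'c) colored_graph \<Rightarrow> ('v \<Rightarrow> 'v) \<times> ('e \<Rightarrow> 'e) \<Rightarrow> ('v, 'e) forest_map set" where
  "class_of_automorphism \<Gamma> g =
     \<Union>{almost_class \<Gamma> (forest_restriction \<Gamma> g T) | T.
          complete_subtree \<Gamma> T \<and> complete_subtree \<Gamma> (fst g ` T)}"

section \<open>Colored Neretin groups\<close>

definition neretin_group ::
    "('v, 'e, 'c) colored_graph \<Rightarrow> ('c \<Rightarrow> 'c) set \<Rightarrow> ('v, 'e) forest_map set monoid" where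
  "neretin_group \<Gamma> F =
     \<lparr>carrier = almost_class \<Gamma> ` honest_almost_automorphisms \<Gamma> (universal_group \<Gamma> F),
      mult = class_mult \<Gamma>,
      one = class_of_automorphism \<Gamma> (id, id)\<rparr>"

definition neretin_topology ::
    "('v, 'e, 'c) colored_graph \<Rightarrow> ('c \<Rightarrow> 'c) set \<Rightarrow> ('v, 'e) forest_map set topology" where
  "neretin_topology \<Gamma> F =
     group_topology_via (neretin_group \<Gamma> F) (universal_group_topology \<Gamma> F) (class_of_automorphism \<Gamma>)"

end

theory Submission
  imports Defs "HOL-Algebra.Multiplicative_Group" "HOL-Algebra.Sylow"
begin

text \<open>An almost automorphism is determined by its germ: its vertex map up to finite sets. On germs the
  product of classes is composition, and the fixators of large balls in \<open>U F\<close> form a basis of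
  identity neighbourhoods for the topology of the Neretin group.

  If \<open>Q\<close> is pro-\<open>p\<close> with \<open>U(P)\<^sub>b \<le> Q \<le> U(F)\<^sub>b\<close>, the local actions at a vertex of its stabilizer in \<open>Q\<close>
  form a \<open>p\<close>-group containing \<open>P\<close> or a point stabilizer of \<open>P\<close>. As \<open>F\<close> and \<open>P\<close> have the same orbits,
  both are Sylow subgroups, so the local actions lie in \<open>P\<close>; approximating on larger and larger balls
  gives \<open>Q = U(P)\<^sub>b\<close>.

  If a germ commensurates \<open>S = U(P)\<^sub>b\<close>, then its inverse conjugates a ball fixator of \<open>U P\<close> into \<open>S\<close>.
  Testing this on elements that rotate a single half-tree by \<open>t\<close>, with \<open>t\<close> in the stabilizer of the
  colour \<open>\<omega>\<close> in \<open>P\<close>, shows that a local action \<open>\<sigma>\<close> of the germ satisfies \<open>\<sigma> t \<sigma>\<inverse> \<in> P\<close>. After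
  correction by an element of \<open>P\<close> it fixes \<open>\<omega>\<close> and normalizes the stabilizer, hence lies in \<open>P\<close> by
  hypothesis. Conversely, \<open>S\<close> is compact and open in the Neretin group of \<open>P\<close>, hence commensurated.\<close>

text \<open>The legal coloring makes the tree a Cayley graph of a free product of involutions, one
  for each colour: paths become words and geodesics become reduced words. An automorphism is then
  the image of one vertex together with a portrait, a family of local actions that agree on the
  colour of each edge seen from its two ends. Elements of \<open>U F\<close> are produced by writing
  down portraits.

  The obstacle is that a germ forgets finite sets, while the hypothesis on normalizers speaks about
  the local action at a single vertex. Rigidity bridges this: with three colours every vertex of a
  half-tree has at least two neighbours further out, whose images have only one common neighbour.
  Hence automorphisms that agree on a half-tree up to a finite set agree on all of it.

  The inverse of the germ \<open>x\<close> appears because finite index puts a ball fixator inside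
  the conjugate of \<open>S\<close> by \<open>x\<close>, and the inverse carries it back into
  \<open>S\<close>. Equality of orbits also supplies the correcting element of \<open>P\<close>: a
  local action in \<open>F\<close> moves \<omega> within its \<open>P\<close>-orbit.\<close>

lemma distinct_adj_snoc:
  "distinct_adj (xs @ [x]) \<longleftrightarrow> distinct_adj xs \<and> (xs = [] \<or> last xs \<noteq> x)"
  by (auto simp: distinct_adj_append_iff)

section \<open>Colours, words and geodesics\<close>

locale colored_tree =
  fixes \<Gamma> :: "('v, 'e, 'c :: finite) colored_graph"
  assumes regular: "regular_tree \<Gamma> CARD('c)"
    and three: "CARD('c) \<ge> 3"
    and legal: "legal_coloring \<Gamma>"
begin

definition edge :: "'v \<Rightarrow> 'c \<Rightarrow> 'e" where
  "edge x = inv_into (edges_at \<Gamma> x) (col \<Gamma>)"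

definition nbr :: "'v \<Rightarrow> 'c \<Rightarrow> 'v" where
  "nbr x c = ter \<Gamma> (edge x c)"

text \<open>Each colour acts as an involution (\<open>nbr_nbr\<close>), so this is a right action of
  the free product of copies of Z/2 indexed by the colours; \<open>distinct_adj\<close> singles out
  the reduced words. The action turns out to be simply transitive: see
  \<open>reduced_word_exists\<close> and \<open>act_reduced_inject\<close>.\<close>

definition act :: "'v \<Rightarrow> 'c list \<Rightarrow> 'v" where
  "act = foldl nbr"

lemma act_simps [simp]:
  "act x [] = x" "act x (c # cs) = act (nbr x c) cs" "act x (us @ ws) = act (act x us) ws"
  by (simp_all add: act_def)

lemma col_bij: "bij_betw (col \<Gamma>) (edges_at \<Gamma> x) UNIV"
  using legal by (auto simp: legal_coloring_def)

lemma is_serre_graph: "serre_graph \<Gamma>" and connected: "\<exists>es. walk \<Gamma> x es y"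
  and no_circuit: "\<not> circuit \<Gamma> es"
  using regular by (auto simp: regular_tree_def tree_def)

lemma opp_simps [simp]:
  "opp \<Gamma> (opp \<Gamma> e) = e" "opp \<Gamma> e \<noteq> e" "org \<Gamma> (opp \<Gamma> e) = ter \<Gamma> e"
  "ter \<Gamma> (opp \<Gamma> e) = org \<Gamma> e"
  using is_serre_graph by (auto simp: serre_graph_def)

lemma col_opp [simp]: "col \<Gamma> (opp \<Gamma> e) = col \<Gamma> e"
  using legal by (auto simp: legal_coloring_def)

lemma edge_simps [simp]: "org \<Gamma> (edge x c) = x" "col \<Gamma> (edge x c) = c" "ter \<Gamma> (edge x c) = nbr x c"
proof -
  have "edge x c \<in> edges_at \<Gamma> x"
    unfolding edge_def using col_bij[of x] by (intro inv_into_into) (auto simp: bij_betw_def)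
  then show "org \<Gamma> (edge x c) = x" by (simp add: edges_at_def)
  show "col \<Gamma> (edge x c) = c"
    unfolding edge_def using col_bij[of x] by (intro f_inv_into_f) (auto simp: bij_betw_def)
qed (simp add: nbr_def)

lemma edge_eqI: "org \<Gamma> e = x \<Longrightarrow> col \<Gamma> e = c \<Longrightarrow> e = edge x c"
  using col_bij[of x] by (auto simp: bij_betw_def inj_on_def edges_at_def)

lemma edge_org_col [simp]: "edge (org \<Gamma> e) (col \<Gamma> e) = e"
  by (rule edge_eqI[symmetric]) auto

lemma edge_cases: obtains x c where "e = edge x c"
  by (metis edge_org_col)

lemma opp_edge [simp]: "opp \<Gamma> (edge x c) = edge (nbr x c) c"
  by (rule edge_eqI) auto

lemma nbr_nbr [simp]: "nbr (nbr x c) c = x"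
  by (metis edge_simps(3) opp_edge opp_simps(4) edge_simps(1))

lemma ter_eq_nbr: "ter \<Gamma> e = nbr (org \<Gamma> e) (col \<Gamma> e)"
  by (metis edge_org_col edge_simps(3))

lemma edge_inject [simp]: "edge x c = edge y c' \<longleftrightarrow> x = y \<and> c = c'"
  by (metis edge_simps(1,2))

lemma edges_at_eq: "edges_at \<Gamma> x = range (edge x)"
  by (auto simp: edges_at_def) (metis edge_org_col rangeI)

lemma inj_edge: "inj (edge x)"
  by (auto simp: inj_def)

lemma walk_act: "walk \<Gamma> x es y \<Longrightarrow> act x (map (col \<Gamma>) es) = y"
  by (induction es arbitrary: x) (auto simp: ter_eq_nbr)

fun wedges :: "'v \<Rightarrow> 'c list \<Rightarrow> 'e list" where
  "wedges x [] = []"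
| "wedges x (c # cs) = edge x c # wedges (nbr x c) cs"

lemma length_wedges [simp]: "length (wedges x ws) = length ws"
  by (induction ws arbitrary: x) auto

lemma walk_wedges: "walk \<Gamma> x (wedges x ws) (act x ws)"
  by (induction ws arbitrary: x) auto

lemma nth_wedges: "i < length ws \<Longrightarrow> wedges x ws ! i = edge (act x (take i ws)) (ws ! i)"
  by (induction ws arbitrary: x i) (auto simp: nth_Cons split: nat.split)

lemma walk_iff_act: "(\<exists>es. walk \<Gamma> x es y \<and> length es = n) \<longleftrightarrow> (\<exists>ws. act x ws = y \<and> length ws = n)"
  using walk_act walk_wedges by (metis length_map length_wedges)

lemma act_rev: "act (act x ws) (rev ws) = x"
  by (induction ws arbitrary: x rule: rev_induct) auto

text \<open>A shortest closed reduced word (over all base points) would trace a circuit.\<close>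

lemma reduced_closed_Nil:
  assumes "distinct_adj ws" "act x ws = x"
  shows "ws = []"
proof (rule ccontr)
  assume "ws \<noteq> []"
  define P where "P n \<longleftrightarrow> (\<exists>ws x. ws \<noteq> [] \<and> distinct_adj ws \<and> act x ws = x \<and> length ws = n)" for n
  have "P (length ws)" using assms \<open>ws \<noteq> []\<close> by (auto simp: P_def)
  then have "P (LEAST n. P n)" by (rule LeastI)
  then obtain us y where us: "us \<noteq> []" "distinct_adj us" "act y us = y" "length us = (LEAST n. P n)"
    unfolding P_def by blast
  have least: "\<not> P n" if "n < length us" for n
    using that us(4) not_less_Least by metis
  \<comment> \<open>A repeated vertex would cut out a shorter closed reduced word, based at that
    vertex instead of \<open>y\<close>; this is why the minimum runs over all base points.\<close>
  have no_sub: "act y (take i us) \<noteq> act y (take j us)" if "i < j" "j < length us" for i j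
  proof
    assume eq: "act y (take i us) = act y (take j us)"
    define vs where "vs = drop i (take j us)"
    have split: "take j us = take i us @ vs"
      unfolding vs_def using that by (metis append_take_drop_id min.absorb1 take_take less_imp_le)
    have "act (act y (take i us)) vs = act y (take i us)"
      using eq by (simp add: split)
    moreover have "distinct_adj vs"
      unfolding vs_def using us(2)
      by (metis append_take_drop_id distinct_adj_append_iff)
    moreover have "vs \<noteq> []" "length vs < length us"
      using that by (auto simp: vs_def)
    ultimately have "P (length vs)" by (auto simp: P_def)
    with least \<open>length vs < length us\<close> show False by blast
  qed
  have "circuit \<Gamma> (wedges y us)"
    unfolding circuit_def
  proof (intro conjI allI impI)
    show "wedges y us \<noteq> []" using us(1) by (cases us) auto
    have "org \<Gamma> (hd (wedges y us)) = y" using us(1) by (cases us) auto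
    then show "walk \<Gamma> (org \<Gamma> (hd (wedges y us))) (wedges y us) (org \<Gamma> (hd (wedges y us)))"
      using walk_wedges[of y us] us(3) by simp
    have "inj_on (\<lambda>i. act y (take i us)) {0..<length us}"
      using no_sub by (intro linorder_inj_onI) auto
    moreover have "map (org \<Gamma>) (wedges y us) = map (\<lambda>i. act y (take i us)) [0..<length us]"
      by (rule nth_equalityI) (auto simp: nth_wedges)
    ultimately show "distinct (map (org \<Gamma>) (wedges y us))"
      by (simp add: distinct_map)
  next
    fix i assume i: "Suc i < length (wedges y us)"
    then have "us ! Suc i \<noteq> us ! i" using us(2) distinct_adj_nth[of us i] by auto
    then show "wedges y us ! Suc i \<noteq> opp \<Gamma> (wedges y us ! i)"
      using i by (simp add: nth_wedges del: edge_inject) (metis edge_simps(2))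
  qed
  with no_circuit show False by blast
qed

text \<open>Equal last letters cancel. If the last letters differ, \<open>ws\<close> followed by the
  reverse of the other word is a reduced closed word, hence empty.\<close>

lemma act_reduced_inject:
  assumes "distinct_adj us" "distinct_adj ws" "act x us = act x ws"
  shows "us = ws"
  using assms
proof (induction us arbitrary: ws rule: rev_induct)
  case Nil
  then show ?case using reduced_closed_Nil by (metis act_simps(1))
next
  case (snoc c us)
  show ?case
  proof (cases "ws = [] \<or> last ws \<noteq> c")
    case True
    have "distinct_adj (ws @ [c] @ rev us)"
      using snoc.prems True by (auto simp: distinct_adj_append_iff hd_rev distinct_adj_Cons)
    moreover have "act (act x ws) ([c] @ rev us) = x"
      using snoc.prems(3) act_rev[of x "us @ [c]"] by simp
    ultimately have "ws @ [c] @ rev us = []"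
      using reduced_closed_Nil[of "ws @ [c] @ rev us" x] by simp
    then show ?thesis by simp
  next
    case False
    then obtain ws' where ws: "ws = ws' @ [c]" by (metis append_butlast_last_id)
    have "nbr (act x us) c = nbr (act x ws') c" using snoc.prems(3) ws by simp
    then have "act x us = act x ws'" by (metis nbr_nbr)
    with snoc ws show ?thesis by (auto simp: distinct_adj_append_iff)
  qed
qed

lemma reduced_word_exists: "\<exists>ws. distinct_adj ws \<and> act x ws = y"
proof -
  obtain us where us: "act x us = y"
    using connected[of x y] walk_act by blast
  have "\<exists>ws. distinct_adj ws \<and> act x ws = act x us"
  proof (induction us rule: rev_induct)
    case Nil
    then show ?case by (auto intro: exI[of _ "[]"])
  next
    case (snoc c us)
    then obtain ws where ws: "distinct_adj ws" "act x ws = act x us" by blast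
    show ?case
    proof (cases "ws = [] \<or> last ws \<noteq> c")
      case True
      then show ?thesis using ws by (intro exI[of _ "ws @ [c]"]) (auto simp: distinct_adj_snoc)
    next
      case False
      then obtain ws' where ws': "ws = ws' @ [c]" by (metis append_butlast_last_id)
      then have "act x ws' = nbr (act x us) c" using ws(2) nbr_nbr[of "act x ws'" c] by simp
      then show ?thesis using ws ws' by (intro exI[of _ ws']) (auto simp: distinct_adj_snoc)
    qed
  qed
  with us show ?thesis by simp
qed

text \<open>The colours along the geodesic from \<open>x\<close> to \<open>y\<close>; its length is
  the distance (\<open>vertex_dist_eq\<close>).\<close>

definition word :: "'v \<Rightarrow> 'v \<Rightarrow> 'c list" where
  "word x y = (THE ws. distinct_adj ws \<and> act x ws = y)"

lemma word_props: "distinct_adj (word x y)" "act x (word x y) = y"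
proof -
  have "\<exists>!ws. distinct_adj ws \<and> act x ws = y"
    using reduced_word_exists[of x y] act_reduced_inject by blast
  from theI'[OF this] show "distinct_adj (word x y)" "act x (word x y) = y"
    by (auto simp: word_def)
qed

lemma word_eqI: "distinct_adj ws \<Longrightarrow> act x ws = y \<Longrightarrow> word x y = ws"
  using act_reduced_inject word_props by metis

lemma word_act [simp]: "distinct_adj ws \<Longrightarrow> word x (act x ws) = ws"
  by (simp add: word_eqI)

lemma word_self [simp]: "word x x = []"
  by (simp add: word_eqI)

lemma word_eq_Nil [simp]: "word x y = [] \<longleftrightarrow> x = y"
  using word_props(2)[of x y] by auto

lemma word_nbr:
  "word x (nbr y c) = (if x \<noteq> y \<and> last (word x y) = c then butlast (word x y) else word x y @ [c])"
proof (cases "x \<noteq> y \<and> last (word x y) = c")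
  case True
  then have split: "word x y = butlast (word x y) @ [c]" by (metis append_butlast_last_id word_eq_Nil)
  then have "distinct_adj (butlast (word x y))" using word_props(1)[of x y] by (metis distinct_adj_appendD1)
  moreover have "act x (butlast (word x y)) = nbr y c"
    using word_props(2)[of x y] split by (metis act_simps(1,2,3) nbr_nbr)
  ultimately show ?thesis using True by (simp add: word_eqI)
next
  case False
  then have "distinct_adj (word x y @ [c])"
    using word_props(1)[of x y] by (auto simp: distinct_adj_snoc)
  moreover have "act x (word x y @ [c]) = nbr y c" by (simp add: word_props)
  ultimately have "word x (nbr y c) = word x y @ [c]" by (rule word_eqI)
  then show ?thesis using False by presburger
qed

lemma nbr_neq [simp]: "nbr x c \<noteq> x" "x \<noteq> nbr x c"
  using reduced_closed_Nil[of "[c]" x] by auto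

lemma nbr_inject [simp]: "nbr x c = nbr x c' \<longleftrightarrow> c = c'"
  using act_reduced_inject[of "[c]" "[c']" x] by auto

lemma nbr_eq_iff: "nbr x c = y \<longleftrightarrow> x = nbr y c"
  by (metis nbr_nbr)

lemma ter_neq_org [simp]: "ter \<Gamma> e \<noteq> org \<Gamma> e" "org \<Gamma> e \<noteq> ter \<Gamma> e"
  by (cases e rule: edge_cases; simp)+

lemma edge_endpoints_eq: "org \<Gamma> e = org \<Gamma> e' \<Longrightarrow> ter \<Gamma> e = ter \<Gamma> e' \<Longrightarrow> e = e'"
  by (cases e rule: edge_cases; cases e' rule: edge_cases) auto

text \<open>A common neighbour is the midpoint of a reduced word of length two from \<open>y\<close>
  to \<open>z\<close>, and that word is unique. The rigidity of automorphisms on half-trees rests on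
  this.\<close>

lemma common_neighbour_unique:
  assumes "nbr x a = y" "nbr x b = z" "nbr x' a' = y" "nbr x' b' = z" "y \<noteq> z"
  shows "x = x'"
proof -
  have "word y z = [a, b]" "word y z = [a', b']"
    using assms by (auto intro!: word_eqI simp: nbr_eq_iff[symmetric]) 
  then show ?thesis using assms by (metis list.inject nbr_nbr)
qed

lemma length_word_le: "length (word x (act x us)) \<le> length us"
proof (induction us rule: rev_induct)
  case (snoc c us)
  then show ?case by (auto simp: word_nbr)
qed simp

lemma vertex_dist_eq: "vertex_dist \<Gamma> x y = length (word x y)"
  unfolding vertex_dist_def walk_iff_act
  by (rule Least_equality) (use word_props length_word_le in \<open>auto intro!: exI[of _ "word x y"]\<close>)

lemma word_rev: "word y x = rev (word x y)"
  by (rule word_eqI) (use word_props act_rev in \<open>auto, metis\<close>)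

lemma word_append:
  assumes "distinct_adj (word x y @ word y z)"
  shows "word x z = word x y @ word y z"
  using assms by (intro word_eqI) (auto simp: word_props)

lemma tree_induct:
  assumes "Q x0" "\<And>x c. Q x \<Longrightarrow> Q (nbr x c)"
  shows "Q x"
proof -
  have "Q (act x0 ws)" for ws
    by (induction ws rule: rev_induct) (use assms in auto)
  then show ?thesis by (metis word_props(2))
qed

section \<open>Half-trees\<close>

text \<open>The component of \<open>v\<close> after the edge of colour \<open>k\<close> at \<open>v\<close> has been removed.\<close>

definition half :: "'v \<Rightarrow> 'c \<Rightarrow> 'v set" where
  "half v k = act v ` {ws. distinct_adj (k # ws)}"

lemma half_iff: "x \<in> half v k \<longleftrightarrow> distinct_adj (k # word v x)"
proof
  assume "x \<in> half v k"
  then obtain ws where "x = act v ws" "distinct_adj (k # ws)" by (auto simp: half_def)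
  then show "distinct_adj (k # word v x)" using distinct_adj_ConsD word_act by metis
next
  assume "distinct_adj (k # word v x)"
  then show "x \<in> half v k" unfolding half_def
    by (intro image_eqI[of _ _ "word v x"]) (auto simp: word_props)
qed

lemma half_iff': "x \<in> half v k \<longleftrightarrow> x = v \<or> hd (word v x) \<noteq> k"
  using word_props(1)[of v x] by (auto simp: half_iff distinct_adj_Cons)

lemma half_self [simp]: "v \<in> half v k"
  by (simp add: half_iff)

lemma half_nbr: "x \<in> half v k \<Longrightarrow> \<not> (x = v \<and> c = k) \<Longrightarrow> nbr x c \<in> half v k"
proof -
  assume x: "x \<in> half v k" and nc: "\<not> (x = v \<and> c = k)"
  have d: "distinct_adj (k # word v x)" using x by (simp add: half_iff)
  show ?thesis
  proof (cases "v \<noteq> x \<and> last (word v x) = c")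
    case True
    then have "k # word v x = (k # butlast (word v x)) @ [c]"
      by (metis append_Cons append_butlast_last_id word_eq_Nil)
    then have "distinct_adj (k # butlast (word v x))" using d by (metis distinct_adj_appendD1)
    then show ?thesis using True by (simp add: half_iff word_nbr)
  next
    case False
    then have "distinct_adj ((k # word v x) @ [c])"
      using d nc by (subst distinct_adj_snoc) auto
    then show ?thesis using False by (auto simp: half_iff word_nbr)
  qed
qed

lemma half_back [simp]: "nbr v k \<notin> half v k"
  by (simp add: half_iff word_nbr)

lemma half_back_iff: "x \<in> half v k \<Longrightarrow> nbr x c \<in> half v k \<longleftrightarrow> \<not> (x = v \<and> c = k)"
  using half_nbr by auto

lemma half_induct [consumes 1, case_names root step]:
  assumes "x \<in> half v k" "Q v"
    and "\<And>x c. x \<in> half v k \<Longrightarrow> Q x \<Longrightarrow> nbr x c \<in> half v k \<Longrightarrow> Q (nbr x c)"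
  shows "Q x"
proof -
  have "distinct_adj (k # ws) \<Longrightarrow> Q (act v ws)" for ws
  proof (induction ws rule: rev_induct)
    case (snoc c ws)
    then have "distinct_adj (k # ws)" "distinct_adj (k # ws @ [c])"
      by (metis append_Cons distinct_adj_appendD1, simp)
    then have "act v ws \<in> half v k" "nbr (act v ws) c \<in> half v k" "Q (act v ws)"
      using snoc unfolding half_def by (auto intro: image_eqI[of _ _ "ws @ [c]"])
    then show ?case using assms(3) by simp
  qed (simp add: assms)
  then show ?thesis using assms(1) by (auto simp: half_def)
qed

text \<open>A path can change sides only across the edge of colour \<open>k\<close> at
  \<open>v\<close>, by \<open>half_nbr\<close> applied from either end of that edge.\<close>

lemma half_compl: "- half v k = half (nbr v k) k"
proof (rule sym, intro equalityI subsetI)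
  fix x assume "x \<in> half (nbr v k) k"
  then show "x \<in> - half v k"
  proof (induction rule: half_induct)
    case (step x c)
    show ?case
    proof
      assume a: "nbr x c \<in> half v k"
      then have "nbr x c = v \<and> c = k" using half_nbr[of "nbr x c" v k c] step by auto
      then have "v \<in> half (nbr v k) k" using step by metis
      moreover have "v \<notin> half (nbr v k) k" using half_back[of "nbr v k" k] by simp
      ultimately show False by blast
    qed
  qed simp
next
  fix x
  have "x \<in> half v k \<or> x \<in> half (nbr v k) k"
  proof (induction x rule: tree_induct[of _ v])
    case (2 x c)
    then show ?case using half_nbr[of x v k c] half_nbr[of x "nbr v k" k c]
      by (cases "x = v \<and> c = k"; cases "x = nbr v k \<and> c = k") auto
  qed simp
  then show "x \<in> - half v k \<Longrightarrow> x \<in> half (nbr v k) k" by simp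
qed

text \<open>The colour of the first edge on the path from \<open>x\<close> to the removed edge.\<close>

definition toward :: "'v \<Rightarrow> 'c \<Rightarrow> 'v \<Rightarrow> 'c" where
  "toward v k x = last (k # word v x)"

lemma toward_self [simp]: "toward v k v = k"
  by (simp add: toward_def)

lemma word_nbr_half:
  assumes "x \<in> half v k" "c \<noteq> toward v k x"
  shows "word v (nbr x c) = word v x @ [c]" "nbr x c \<in> half v k"
  using assms half_nbr[of x v k c] by (auto simp: word_nbr toward_def split: if_splits)

lemma toward_nbr: "x \<in> half v k \<Longrightarrow> c \<noteq> toward v k x \<Longrightarrow> toward v k (nbr x c) = c"
  by (simp add: toward_def word_nbr_half)

text \<open>The only exit from \<open>half v k\<close> is at \<open>v\<close>. For
  \<open>x \<noteq> v\<close> the geodesic from \<open>x\<close> to \<open>v\<close> begins with the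
  colour \<open>toward v k x\<close>, so \<open>half x (toward v k x)\<close> does not even contain
  \<open>v\<close>. These smaller half-trees carry the test rotations used for commensurating
  germs.\<close>

lemma half_subset_half: 
  assumes "x \<in> half v k"
  shows "half x (toward v k x) \<subseteq> half v k"
proof
  fix y assume "y \<in> half x (toward v k x)"
  then show "y \<in> half v k"
  proof (induction rule: half_induct)
    case (step y c)
    show ?case
    proof (rule ccontr)
      assume n: "nbr y c \<notin> half v k"
      then have "y = v" "c = k" using half_nbr step.IH by blast+
      then have *: "nbr v k \<in> half x (toward v k x)" "v \<in> half x (toward v k x)" using step by auto
      show False
      proof (cases "x = v")
        case True then show False using * by simp
      next
        case False
        then have "hd (word x v) \<noteq> toward v k x" using *(2) by (simp add: half_iff')
        moreover have "hd (word x v) = last (word v x)"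
          by (simp add: word_rev[of x v] hd_rev)
        ultimately show False using False by (simp add: toward_def)
      qed
    qed
  qed (use assms in simp)
qed

section \<open>Balls\<close>

definition level :: "'v \<Rightarrow> nat" where
  "level x = length (word (base \<Gamma>) x)"

definition tree_ball :: "nat \<Rightarrow> 'v set" where
  "tree_ball n = {x. level x \<le> n}"

lemma level_base [simp]: "level (base \<Gamma>) = 0"
  by (simp add: level_def)

lemma level_eq_0 [simp]: "level x = 0 \<longleftrightarrow> x = base \<Gamma>"
  by (auto simp: level_def)

lemma level_nbr_le: "level (nbr x c) \<le> Suc (level x)"
  by (auto simp: level_def word_nbr)

lemma finite_tree_ball: "finite (tree_ball n)"
proof -
  have "tree_ball n \<subseteq> act (base \<Gamma>) ` {ws. set ws \<subseteq> UNIV \<and> length ws \<le> n}"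
  proof
    fix x assume "x \<in> tree_ball n"
    then show "x \<in> act (base \<Gamma>) ` {ws. set ws \<subseteq> UNIV \<and> length ws \<le> n}"
      using word_props(2)[of "base \<Gamma>" x]
      by (intro image_eqI[of _ _ "word (base \<Gamma>) x"]) (auto simp: tree_ball_def level_def)
  qed
  then show ?thesis using finite_lists_length_le[OF finite[of UNIV]] by (rule finite_surj[rotated])
qed

lemma finite_subset_tree_ball: "finite A \<Longrightarrow> \<exists>n. A \<subseteq> tree_ball n"
proof -
  assume "finite A"
  then have "A \<subseteq> tree_ball (Max (insert 0 (level ` A)))"
    by (auto simp: tree_ball_def intro!: Max_ge)
  then show ?thesis by blast
qed

lemma tree_ball_mono: "m \<le> n \<Longrightarrow> tree_ball m \<subseteq> tree_ball n"
  by (auto simp: tree_ball_def)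

end

section \<open>Permutations and automorphisms as pairs of maps\<close>

abbreviation finv :: "('a \<Rightarrow> 'b) \<Rightarrow> 'b \<Rightarrow> 'a" where
  "finv \<equiv> inv_into UNIV"

lemma Sym_subgroupD:
  assumes "subgroup F Sym"
  shows "id \<in> F" "\<And>f g. f \<in> F \<Longrightarrow> g \<in> F \<Longrightarrow> f \<circ> g \<in> F" "\<And>f. f \<in> F \<Longrightarrow> finv f \<in> F"
    "\<And>f. f \<in> F \<Longrightarrow> bij f"
proof -
  interpret subgroup F Sym by fact
  show bij: "bij f" if "f \<in> F" for f
    using subset that by (auto simp: BijGroup_def Bij_def)
  have BijI: "f \<in> Bij UNIV" if "f \<in> F" for f
    using bij[OF that] by (simp add: Bij_def)
  show "id \<in> F" using one_closed by (simp add: BijGroup_def id_def restrict_def)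
  show "f \<circ> g \<in> F" if "f \<in> F" "g \<in> F" for f g
    using m_closed[OF that] BijI that by (simp add: BijGroup_def compose_def o_def restrict_def)
  show "finv f \<in> F" if "f \<in> F" for f
    using m_inv_closed[OF that] inv_BijGroup[OF BijI[OF that]] by (simp add: restrict_def)
qed

definition pair_comp :: "('a \<Rightarrow> 'a) \<times> ('b \<Rightarrow> 'b) \<Rightarrow> ('a \<Rightarrow> 'a) \<times> ('b \<Rightarrow> 'b) \<Rightarrow> ('a \<Rightarrow> 'a) \<times> ('b \<Rightarrow> 'b)" where
  "pair_comp g h = (fst g \<circ> fst h, snd g \<circ> snd h)"

definition pair_inv :: "('a \<Rightarrow> 'a) \<times> ('b \<Rightarrow> 'b) \<Rightarrow> ('a \<Rightarrow> 'a) \<times> ('b \<Rightarrow> 'b)" where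
  "pair_inv g = (finv (fst g), finv (snd g))"

lemma pair_apply [simp]:
  "fst (pair_comp g h) x = fst g (fst h x)" "snd (pair_comp g h) e = snd g (snd h e)"
  "fst (pair_inv g) = finv (fst g)" "snd (pair_inv g) = finv (snd g)"
  by (simp_all add: pair_comp_def pair_inv_def)

text \<open>The subgroup property, stated directly for sets of pairs, since automorphisms are given
  without a monoid structure. It is instantiated with all automorphisms and with
  \<open>U F\<close>.\<close>

definition aut_closed :: "('v, 'e, 'c) colored_graph \<Rightarrow> (('v \<Rightarrow> 'v) \<times> ('e \<Rightarrow> 'e)) set \<Rightarrow> bool" where
  "aut_closed \<Gamma> H \<longleftrightarrow> H \<subseteq> automorphisms \<Gamma> \<and> (id, id) \<in> H \<and>
     (\<forall>g\<in>H. \<forall>h\<in>H. pair_comp g h \<in> H) \<and> (\<forall>g\<in>H. pair_inv g \<in> H)"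

lemma automorphismsD:
  assumes "g \<in> automorphisms \<Gamma>"
  shows "bij (fst g)" "bij (snd g)" "org \<Gamma> (snd g e) = fst g (org \<Gamma> e)"
    "ter \<Gamma> (snd g e) = fst g (ter \<Gamma> e)" "opp \<Gamma> (snd g e) = snd g (opp \<Gamma> e)"
  using assms by (auto simp: automorphisms_def)

lemma aut_inv_apply:
  assumes "g \<in> automorphisms \<Gamma>"
  shows "fst g (finv (fst g) x) = x" "finv (fst g) (fst g x) = x"
    "snd g (finv (snd g) e) = e" "finv (snd g) (snd g e) = e"
    "fst g x = fst g y \<longleftrightarrow> x = y" "snd g e = snd g e' \<longleftrightarrow> e = e'"
  using automorphismsD(1,2)[OF assms, THEN bij_is_inj] automorphismsD(1,2)[OF assms, THEN bij_is_surj]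
  by (simp_all add: surj_f_inv_f inj_eq)

lemma aut_closed_automorphisms: "aut_closed \<Gamma> (automorphisms \<Gamma>)"
  unfolding aut_closed_def
proof (intro conjI ballI)
  show "(id, id) \<in> automorphisms \<Gamma>" by (auto simp: automorphisms_def)
next
  fix g h assume "g \<in> automorphisms \<Gamma>" "h \<in> automorphisms \<Gamma>"
  then show "pair_comp g h \<in> automorphisms \<Gamma>"
    by (auto simp: automorphisms_def pair_comp_def bij_comp)
next
  fix g assume g: "g \<in> automorphisms \<Gamma>"
  have "org \<Gamma> (finv (snd g) e) = finv (fst g) (org \<Gamma> e) \<and> ter \<Gamma> (finv (snd g) e) = finv (fst g) (ter \<Gamma> e)
        \<and> opp \<Gamma> (finv (snd g) e) = finv (snd g) (opp \<Gamma> e)" for e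
    using automorphismsD(3-5)[OF g, of "finv (snd g) e"] aut_inv_apply[OF g] by metis
  then show "pair_inv g \<in> automorphisms \<Gamma>"
    using automorphismsD(1,2)[OF g] by (auto simp: automorphisms_def pair_inv_def bij_imp_bij_inv)
qed auto

lemmas aut_comp = aut_closed_automorphisms[unfolded aut_closed_def, THEN conjunct2, THEN conjunct2,
    THEN conjunct1, rule_format]
lemmas aut_inv = aut_closed_automorphisms[unfolded aut_closed_def, THEN conjunct2, THEN conjunct2,
    THEN conjunct2, rule_format]

section \<open>Local actions and universal groups\<close>

context colored_tree
begin

abbreviation "Aut \<equiv> automorphisms \<Gamma>"
abbreviation "loc \<equiv> local_action \<Gamma>"
abbreviation "U \<equiv> universal_group \<Gamma>"

lemma loc_eq: "loc g x c = col \<Gamma> (snd g (edge x c))"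
  by (simp add: local_action_def edge_def)

lemma aut_edge: "g \<in> Aut \<Longrightarrow> snd g (edge x c) = edge (fst g x) (loc g x c)"
  by (rule edge_eqI) (simp_all add: automorphismsD loc_eq)

lemma aut_nbr: "g \<in> Aut \<Longrightarrow> fst g (nbr x c) = nbr (fst g x) (loc g x c)"
  using automorphismsD(4)[of g \<Gamma> "edge x c"] by (simp add: aut_edge)

lemma loc_nbr: "g \<in> Aut \<Longrightarrow> loc g (nbr x c) c = loc g x c"
  using automorphismsD(5)[of g \<Gamma> "edge x c"] by (simp add: aut_edge)

lemma loc_bij: assumes "g \<in> Aut" shows "bij (loc g x)"
proof -
  have "inj (loc g x)"
    by (rule injI) (metis assms aut_edge aut_inv_apply(6) edge_inject)
  then show ?thesis by (simp add: bij_def finite_UNIV_inj_surj)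
qed

lemma loc_inject: "g \<in> Aut \<Longrightarrow> loc g x c = loc g x c' \<longleftrightarrow> c = c'"
  using loc_bij[of g x] by (simp add: bij_is_inj inj_eq)

lemma loc_comp: "h \<in> Aut \<Longrightarrow> loc (pair_comp g h) x = loc g (fst h x) \<circ> loc h x"
  by (simp add: fun_eq_iff loc_eq[of "pair_comp g h"] loc_eq[of g] aut_edge[of h])

lemma loc_id [simp]: "loc (id, id) x = id"
  by (auto simp: loc_eq)

lemma pair_inv_comp: "g \<in> Aut \<Longrightarrow> pair_comp (pair_inv g) g = (id, id)"
  "g \<in> Aut \<Longrightarrow> pair_comp g (pair_inv g) = (id, id)"
  by (auto simp: pair_comp_def pair_inv_def fun_eq_iff aut_inv_apply)

lemma loc_inv: assumes g: "g \<in> Aut" shows "loc (pair_inv g) x = finv (loc g (finv (fst g) x))"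
proof -
  have "loc (pair_inv g) x \<circ> loc g (finv (fst g) x) = id"
    using loc_comp[OF g, of "pair_inv g" "finv (fst g) x"] g by (simp add: pair_inv_comp aut_inv_apply)
  then have *: "loc (pair_inv g) x (loc g (finv (fst g) x) c) = c" for c
    by (metis comp_apply id_apply)
  show ?thesis
  proof
    fix c
    obtain c' where "c = loc g (finv (fst g) x) c'" using loc_bij[OF g] by (metis bij_pointE)
    then show "loc (pair_inv g) x c = finv (loc g (finv (fst g) x)) c"
      using loc_bij[OF g, of "finv (fst g) x"] by (simp add: * inv_f_f bij_is_inj)
  qed
qed

lemma loc_determined:
  assumes "g \<in> Aut" "h \<in> Aut" "fst g x = fst h x" "fst g (nbr x c) = fst h (nbr x c)"
  shows "loc g x c = loc h x c"
  using assms by (simp add: aut_nbr)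

lemma aut_eqI: assumes "g \<in> Aut" "h \<in> Aut" "\<And>x. fst g x = fst h x" shows "g = h"
proof (rule prod_eqI)
  show "fst g = fst h" using assms(3) by auto
  show "snd g = snd h"
    by (rule ext, rule edge_endpoints_eq) (simp_all add: assms automorphismsD)
qed

lemma aut_closed_universal:
  assumes "subgroup F Sym" shows "aut_closed \<Gamma> (U F)"
  unfolding aut_closed_def
proof (intro conjI ballI)
  note F = Sym_subgroupD[OF assms]
  show "U F \<subseteq> Aut" by (auto simp: universal_group_def)
  show "(id, id) \<in> U F"
    using F(1) aut_closed_automorphisms[of \<Gamma>] by (auto simp: universal_group_def aut_closed_def)
  show "pair_comp g h \<in> U F" if "g \<in> U F" "h \<in> U F" for g h
    using that F(2) by (auto simp: universal_group_def loc_comp aut_comp)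
  show "pair_inv g \<in> U F" if "g \<in> U F" for g
    using that F(3) by (auto simp: universal_group_def loc_inv aut_inv)
qed

lemma universal_groupD: "g \<in> U F \<Longrightarrow> g \<in> Aut" "g \<in> U F \<Longrightarrow> loc g x \<in> F"
  by (auto simp: universal_group_def)

section \<open>Automorphisms with prescribed local actions\<close>

text \<open>The colours of the image of a path: an automorphism with portrait \<open>\<pi>\<close>
  carries the path \<open>ws\<close> from \<open>x\<close> to the path
  \<open>twist \<pi> x ws\<close> from the image of \<open>x\<close>.\<close>

fun twist :: "('v \<Rightarrow> 'c \<Rightarrow> 'c) \<Rightarrow> 'v \<Rightarrow> 'c list \<Rightarrow> 'c list" where
  "twist \<pi> x [] = []"
| "twist \<pi> x (c # cs) = \<pi> x c # twist \<pi> (nbr x c) cs"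

lemma twist_snoc: "twist \<pi> x (ws @ [c]) = twist \<pi> x ws @ [\<pi> (act x ws) c]"
  by (induction ws arbitrary: x) auto

lemma twist_inject:
  assumes "\<And>x. inj (\<pi> x)" shows "twist \<pi> x us = twist \<pi> x ws \<Longrightarrow> us = ws"
proof (induction us arbitrary: ws x)
  case Nil
  then show ?case by (cases ws) auto
next
  case (Cons c us)
  then show ?case using assms by (cases ws) (auto simp: inj_eq)
qed

text \<open>Consecutive letters \<open>c \<noteq> c'\<close> become \<open>\<pi> x c\<close>, which
  equals \<open>\<pi> (nbr x c) c\<close>, and \<open>\<pi> (nbr x c) c'\<close>: two values of the
  same injective map.\<close>

lemma twist_reduced:
  assumes "\<And>x. inj (\<pi> x)" "\<And>x c. \<pi> (nbr x c) c = \<pi> x c"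
  shows "distinct_adj ws \<Longrightarrow> distinct_adj (twist \<pi> x ws)"
proof (induction ws arbitrary: x)
  case (Cons c ws)
  show ?case
  proof (cases ws)
    case (Cons c' ws')
    then have "\<pi> (nbr x c) c \<noteq> \<pi> (nbr x c) c'"
      using Cons.prems assms(1) by (auto simp: inj_eq)
    then show ?thesis
      using Cons Cons.IH[of "nbr x c"] Cons.prems by (simp add: assms(2))
  qed simp
qed simp

text \<open>Agreement of the permutations at the two ends of each edge is the only condition on a
  portrait. The image of \<open>x\<close> is found by twisting the geodesic from \<open>v\<close> to
  \<open>x\<close>; reduced words stay reduced, which gives injectivity. All automorphisms that are
  built from scratch below come from here.\<close>

lemma portrait_extension:
  assumes bij: "\<And>x. bij (\<pi> x)" and compat: "\<And>x c. \<pi> (nbr x c) c = \<pi> x c"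
  shows "\<exists>g\<in>Aut. fst g v = w \<and> (\<forall>x. loc g x = \<pi> x)"
proof -
  have inj: "inj (\<pi> x)" for x using bij by (rule bij_is_inj)
  define gv where "gv x = act w (twist \<pi> v (word v x))" for x
  define ge where "ge e = edge (gv (org \<Gamma> e)) (\<pi> (org \<Gamma> e) (col \<Gamma> e))" for e
  have gv_nbr: "gv (nbr x c) = nbr (gv x) (\<pi> x c)" for x c
  proof (cases "v \<noteq> x \<and> last (word v x) = c")
    case True
    then have w: "word v x = word v (nbr x c) @ [c]"
      by (simp add: word_nbr) (metis append_butlast_last_id word_eq_Nil)
    have "gv x = nbr (gv (nbr x c)) (\<pi> (nbr x c) c)"
      unfolding gv_def by (subst w) (simp add: twist_snoc word_props)
    then show ?thesis using compat by (metis nbr_nbr)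
  next
    case False
    then have "word v (nbr x c) = word v x @ [c]" by (auto simp: word_nbr)
    then show ?thesis by (simp add: gv_def twist_snoc word_props)
  qed
  have injgv: "inj gv"
  proof (rule injI)
    fix x y assume "gv x = gv y"
    then have "twist \<pi> v (word v x) = twist \<pi> v (word v y)"
      unfolding gv_def using act_reduced_inject twist_reduced[OF inj compat] word_props(1) by metis
    then have "word v x = word v y" by (rule twist_inject[OF inj])
    then show "x = y" by (metis word_props(2))
  qed
  have "y \<in> range gv" for y
  proof (induction y rule: tree_induct[of _ w])
    case 1
    have "gv v = w" by (simp add: gv_def)
    then show ?case by blast
  next
    case (2 x c)
    then obtain x' where x': "x = gv x'" by auto
    have "\<pi> x' (finv (\<pi> x') c) = c" using bij by (simp add: bij_is_surj surj_f_inv_f)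
    then have "nbr x c = gv (nbr x' (finv (\<pi> x') c))" by (simp add: gv_nbr x')
    then show ?case by (rule range_eqI)
  qed
  then have bijgv: "bij gv" using injgv by (auto simp: bij_def)
  have ge_edge: "ge (edge x c) = edge (gv x) (\<pi> x c)" for x c by (simp add: ge_def)
  have "bij ge"
  proof (rule bijI)
    show "inj ge"
    proof (rule injI)
      fix e e' assume "ge e = ge e'"
      then show "e = e'"
        using injgv inj by (cases e rule: edge_cases; cases e' rule: edge_cases) (auto simp: ge_edge inj_eq)
    qed
    show "surj ge"
    proof (rule surjI)
      fix e
      show "ge (edge (finv gv (org \<Gamma> e)) (finv (\<pi> (finv gv (org \<Gamma> e))) (col \<Gamma> e))) = e"
        using bijgv bij by (simp add: ge_edge bij_is_surj surj_f_inv_f)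
    qed
  qed
  moreover have "org \<Gamma> (ge e) = gv (org \<Gamma> e) \<and> ter \<Gamma> (ge e) = gv (ter \<Gamma> e) \<and> opp \<Gamma> (ge e) = ge (opp \<Gamma> e)" for e
    by (cases e rule: edge_cases) (simp add: ge_edge gv_nbr compat)
  ultimately have g: "(gv, ge) \<in> Aut"
    using bijgv by (auto simp: automorphisms_def)
  have "loc (gv, ge) x = \<pi> x" for x by (auto simp: loc_eq ge_edge)
  then show ?thesis using g by (intro bexI[of _ "(gv, ge)"]) (auto simp: gv_def)
qed

lemma portrait_universal:
  assumes "subgroup F Sym" "\<And>x. \<pi> x \<in> F" "\<And>x c. \<pi> (nbr x c) c = \<pi> x c"
  shows "\<exists>g\<in>U F. fst g v = w \<and> (\<forall>x. loc g x = \<pi> x)"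
proof -
  obtain g where "g \<in> Aut" "fst g v = w" "\<forall>x. loc g x = \<pi> x"
    using portrait_extension[of \<pi> v w] assms(2,3) Sym_subgroupD(4)[OF assms(1)] by blast
  then show ?thesis using assms(2) by (intro bexI[of _ g]) (simp_all add: universal_group_def)
qed

section \<open>Automorphisms and half-trees\<close>

lemma aut_half_into:
  assumes "g \<in> Aut" "x \<in> half v k" shows "fst g x \<in> half (fst g v) (loc g v k)"
  using assms(2)
proof (induction rule: half_induct)
  case (step x c)
  then have "\<not> (x = v \<and> c = k)" using half_back by blast
  then have "\<not> (fst g x = fst g v \<and> loc g x c = loc g v k)"
    using assms(1) by (auto simp: aut_inv_apply loc_inject)
  then show ?case using half_nbr[OF step.IH] assms(1) by (simp add: aut_nbr)
qed simp

lemma aut_half: assumes g: "g \<in> Aut" shows "fst g ` half v k = half (fst g v) (loc g v k)"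
proof
  show "fst g ` half v k \<subseteq> half (fst g v) (loc g v k)" using aut_half_into[OF g] by blast
  show "half (fst g v) (loc g v k) \<subseteq> fst g ` half v k"
  proof
    fix y assume "y \<in> half (fst g v) (loc g v k)"
    from aut_half_into[OF aut_inv[OF g] this]
    have "finv (fst g) y \<in> half v k"
      using g by (simp add: loc_inv aut_inv_apply inv_f_f[OF bij_is_inj[OF loc_bij]])
    then show "y \<in> fst g ` half v k" using aut_inv_apply(1)[OF g] by (metis imageI)
  qed
qed

text \<open>At a vertex of disagreement farthest from \<open>v\<close> all outward neighbours agree
  already. There are at least two of them, and the common neighbour of their images is unique, so
  the vertex itself agrees too. This recovers exact equations from equations between germs.\<close>

lemma half_agree_cofinite:
  assumes g: "g \<in> Aut" and h: "h \<in> Aut" and fin: "finite {x \<in> half v k. fst g x \<noteq> fst h x}"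
    and x: "x \<in> half v k"
  shows "fst g x = fst h x"
proof (rule ccontr)
  assume "fst g x \<noteq> fst h x"
  let ?D = "{x \<in> half v k. fst g x \<noteq> fst h x}"
  have "Max ((\<lambda>z. length (word v z)) ` ?D) \<in> (\<lambda>z. length (word v z)) ` ?D"
    using fin x \<open>fst g x \<noteq> fst h x\<close> by (intro Max_in) auto
  then obtain y where y: "y \<in> ?D" "length (word v y) = Max ((\<lambda>z. length (word v z)) ` ?D)"
    by auto
  have max: "length (word v z) \<le> length (word v y)" if "z \<in> ?D" for z
    unfolding y(2) using fin that by (intro Max_ge) auto
  have agree: "fst g (nbr y c) = fst h (nbr y c)" if "c \<noteq> toward v k y" for c
    using max[of "nbr y c"] y(1) word_nbr_half[OF _ that] by auto
  \<comment> \<open>Three colours leave two outward neighbours after the colour leading back to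
    \<open>v\<close> is removed.\<close>
  have "card (UNIV - {toward v k y}) \<ge> 2" using three by (simp add: card_Diff_singleton)
  then obtain a b where ab: "a \<noteq> b" "a \<noteq> toward v k y" "b \<noteq> toward v k y"
    using card_le_Suc0_iff_eq[of "UNIV - {toward v k y}"] by fastforce
  have "fst g (nbr y a) \<noteq> fst g (nbr y b)" using ab g by (simp add: aut_inv_apply)
  moreover have "nbr (fst g y) (loc g y a) = fst g (nbr y a)" "nbr (fst g y) (loc g y b) = fst g (nbr y b)"
    "nbr (fst h y) (loc h y a) = fst g (nbr y a)" "nbr (fst h y) (loc h y b) = fst g (nbr y b)"
    using agree ab g h by (simp_all add: aut_nbr[symmetric])
  ultimately have "fst g y = fst h y" using common_neighbour_unique by blast
  then show False using y by simp
qed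

text \<open>Makes the map from automorphisms to germs injective, so that elements of the Neretin
  group coming from \<open>U F\<close> can be lifted uniquely.\<close>

lemma aut_agree_cofinite:
  assumes "g \<in> Aut" "h \<in> Aut" "finite {x. fst g x \<noteq> fst h x}"
  shows "g = h"
proof (rule aut_eqI)
  fix x
  \<comment> \<open>Any colour will do: its edge at the base vertex splits the tree into two
    half-trees.\<close>
  obtain k :: 'c where True by blast
  define v where "v = base \<Gamma>"
  have "x \<in> half v k \<or> x \<in> half (nbr v k) k" using half_compl by blast
  moreover have "finite {x \<in> half w k. fst g x \<noteq> fst h x}" for w
    by (rule finite_subset[OF _ assms(3)]) auto
  ultimately show "fst g x = fst h x"
    using half_agree_cofinite[OF assms(1,2)] by blast
qed (use assms in auto)

text \<open>At \<open>v\<close> the edge of colour \<open>k\<close> leaves the half-tree, so its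
  image is not compared directly; but two permutations that agree off one point agree there as
  well.\<close>

lemma loc_agree_half:
  assumes g: "g \<in> Aut" and h: "h \<in> Aut" and ag: "\<And>x. x \<in> half v k \<Longrightarrow> fst g x = fst h x"
    and x: "x \<in> half v k"
  shows "loc g x = loc h x"
proof -
  have *: "loc g x c = loc h x c" if "\<not> (x = v \<and> c = k)" for c
    using loc_determined[OF g h] ag x half_nbr[OF x that] by blast
  show ?thesis
  proof (cases "x = v")
    case True
    have "loc g v k = loc h v k"
    proof (rule ccontr)
      assume "loc g v k \<noteq> loc h v k"
      obtain c where c: "loc h v c = loc g v k" using loc_bij[OF h] by (metis bij_pointE)
      then have "c \<noteq> k" using \<open>loc g v k \<noteq> loc h v k\<close> by auto
      then have "loc g v c = loc g v k" using * True c by auto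
      then show False using \<open>c \<noteq> k\<close> loc_inject[OF g] by simp
    qed
    then have "loc g x c = loc h x c" for c using * True by (cases "c = k") auto
    then show ?thesis by auto
  qed (use * in auto)
qed

lemma agree_on_halfI:
  assumes g: "g \<in> Aut" and h: "h \<in> Aut" and "fst g v = fst h v"
    and "\<And>x. x \<in> half v k \<Longrightarrow> loc g x = loc h x" and x: "x \<in> half v k"
  shows "fst g x = fst h x"
  using x by (induction rule: half_induct) (use assms in \<open>auto simp: aut_nbr\<close>)

text \<open>The portrait is \<open>\<tau>\<close> on the half-tree and the identity outside. The two
  regions meet in one edge, of colour \<open>k\<close>, and \<open>\<tau>\<close> fixes
  \<open>k\<close>, so the portrait is compatible. With \<open>\<tau>\<close> in a point stabilizer
  of \<open>P\<close> these are the test elements for commensurating germs.\<close>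

lemma half_rotation:
  assumes F: "subgroup F Sym" and \<tau>: "\<tau> \<in> F" "\<tau> k = k"
  obtains \<rho> where "\<rho> \<in> U F" "\<And>y. y \<notin> half x k \<Longrightarrow> fst \<rho> y = y" "fst \<rho> x = x"
    "\<And>y. y \<in> half x k \<Longrightarrow> loc \<rho> y = \<tau>"
proof -
  define \<pi> where "\<pi> y = (if y \<in> half x k then \<tau> else id)" for y
  have "\<pi> (nbr y c) c = \<pi> y c" for y c
  proof (cases "y \<in> half x k")
    case True
    then show ?thesis using half_back_iff[OF True, of c] \<tau> by (auto simp: \<pi>_def)
  next
    case False
    then show ?thesis using half_back_iff[of "nbr y c" x k c] \<tau> by (auto simp: \<pi>_def)
  qed
  then obtain \<rho> where \<rho>: "\<rho> \<in> U F" "fst \<rho> x = x" "\<And>y. loc \<rho> y = \<pi> y"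
    using portrait_universal[OF F, of \<pi> x x] \<tau>(1) Sym_subgroupD(1)[OF F] unfolding \<pi>_def by fastforce
  have "fst \<rho> y = y" if "y \<in> half (nbr x k) k" for y
  proof (rule agree_on_halfI[of \<rho> "(id, id)" "nbr x k" k y, simplified])
    show "\<rho> \<in> Aut" using \<rho> universal_groupD by blast
    show "(id, id) \<in> Aut" using aut_closed_automorphisms[of \<Gamma>] by (auto simp: aut_closed_def)
    show "fst \<rho> (nbr x k) = nbr x k" using aut_nbr[OF \<open>\<rho> \<in> Aut\<close>] \<rho> \<tau> by (simp add: \<pi>_def)
    show "loc \<rho> z = id" if "z \<in> half (nbr x k) k" for z
      using that \<rho>(3) half_compl[of x k] by (auto simp: \<pi>_def)
  qed (use that in auto)
  then show thesis using that[of \<rho>] \<rho> half_compl[of x k] by (auto simp: \<pi>_def)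
qed

end

section \<open>Complete subtrees, their leaves and branches\<close>

lemma bij_ex1_iff: "bij f \<Longrightarrow> (\<exists>!x. P x) \<longleftrightarrow> (\<exists>!x. P (f x))"
proof
  assume f: "bij f" and P: "\<exists>!x. P x"
  then obtain x where x: "P x" "\<And>y. P y \<Longrightarrow> y = x" by blast
  obtain z where z: "x = f z" using f by (metis bij_is_surj surjD)
  show "\<exists>!x. P (f x)"
  proof (rule ex1I[of _ z])
    show "y = z" if "P (f y)" for y
      using x(2)[OF that] z bij_is_inj[OF f] by (simp add: inj_eq)
  qed (use x(1) z in simp)
next
  assume f: "bij f" and P: "\<exists>!x. P (f x)"
  then obtain z where z: "P (f z)" "\<And>y. P (f y) \<Longrightarrow> y = z" by blast
  show "\<exists>!x. P x"
  proof (rule ex1I[of _ "f z"])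
    fix y assume "P y"
    moreover obtain w where "y = f w" using f by (metis bij_is_surj surjD)
    ultimately show "y = f z" using z(2) by blast
  qed (use z(1) in simp)
qed

context colored_tree
begin

text \<open>Connectedness is expressed by the reflexive transitive closure instead of walks, so that
  statements about a subtree can be proved by moving to neighbours inside it
  (\<open>subtree_induct\<close>).\<close>

definition adj :: "'v set \<Rightarrow> ('v \<times> 'v) set" where
  "adj A = {(x, nbr x c) | x c. x \<in> A \<and> nbr x c \<in> A}"

lemma adjI: "x \<in> A \<Longrightarrow> nbr x c \<in> A \<Longrightarrow> (x, nbr x c) \<in> adj A"
  by (auto simp: adj_def)

lemma adj_sym: "sym (adj A)"
proof (rule symI)
  fix x y assume "(x, y) \<in> adj A"
  then obtain c where "y = nbr x c" "x \<in> A" "y \<in> A" by (auto simp: adj_def)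
  then show "(y, x) \<in> adj A" using adjI[of y A c] by simp
qed

lemma adj_mono: "A \<subseteq> B \<Longrightarrow> adj A \<subseteq> adj B"
  by (auto simp: adj_def)

lemma walk_adj:
  "walk \<Gamma> x es y \<Longrightarrow> set es \<subseteq> spanned_edges \<Gamma> A \<Longrightarrow> (x, y) \<in> (adj A)\<^sup>*"
proof (induction es arbitrary: x)
  case (Cons e es)
  then have "(x, ter \<Gamma> e) \<in> adj A"
    using adjI[of x A "col \<Gamma> e"] by (auto simp: spanned_edges_def ter_eq_nbr)
  moreover have "(ter \<Gamma> e, y) \<in> (adj A)\<^sup>*" using Cons by auto
  ultimately show ?case by (rule converse_rtrancl_into_rtrancl)
qed simp

lemma adj_walk: "(x, y) \<in> (adj A)\<^sup>* \<Longrightarrow> \<exists>es. walk \<Gamma> x es y \<and> set es \<subseteq> spanned_edges \<Gamma> A"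
proof (induction rule: converse_rtrancl_induct)
  case base
  then show ?case by (intro exI[of _ "[]"]) auto
next
  case (step x z)
  then obtain c es where "z = nbr x c" "x \<in> A" "z \<in> A" "walk \<Gamma> z es y" "set es \<subseteq> spanned_edges \<Gamma> A"
    by (auto simp: adj_def)
  then show ?case by (intro exI[of _ "edge x c # es"]) (auto simp: spanned_edges_def)
qed

lemma subtree_iff: "subtree \<Gamma> T \<longleftrightarrow> T \<noteq> {} \<and> (\<forall>x\<in>T. \<forall>y\<in>T. (x, y) \<in> (adj T)\<^sup>*)"
  unfolding subtree_def using walk_adj adj_walk by meson

lemma subtreeI:
  assumes "t \<in> T" "\<And>x. x \<in> T \<Longrightarrow> (t, x) \<in> (adj T)\<^sup>*" shows "subtree \<Gamma> T"
  unfolding subtree_iff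
  using assms sym_rtrancl[OF adj_sym[of T]] by (meson empty_iff rtrancl_trans symD)

lemma subtree_induct [consumes 3, case_names root step]:
  assumes "subtree \<Gamma> T" "t \<in> T" "y \<in> T" "Q t"
    and step: "\<And>x c. x \<in> T \<Longrightarrow> nbr x c \<in> T \<Longrightarrow> Q x \<Longrightarrow> Q (nbr x c)"
  shows "Q y"
proof -
  have "(t, y) \<in> (adj T)\<^sup>*" using assms by (auto simp: subtree_iff)
  then show ?thesis
    by (induction rule: rtrancl_induct) (use assms(4) step in \<open>auto simp: adj_def\<close>)
qed

lemma valency_in_eq:
  assumes "x \<in> T" shows "valency_in \<Gamma> T x = card {c. nbr x c \<in> T}"
proof -
  have "edges_at \<Gamma> x \<inter> spanned_edges \<Gamma> T = edge x ` {c. nbr x c \<in> T}"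
    using assms by (auto simp: edges_at_eq spanned_edges_def)
  then show ?thesis using inj_on_subset[OF inj_edge] by (simp add: valency_in_def card_image)
qed

text \<open>For a leaf, the colour of its only edge inside \<open>T\<close>; the branch at the leaf
  is then the half-tree \<open>half v (stem T v)\<close>.\<close>

definition stem :: "'v set \<Rightarrow> 'v \<Rightarrow> 'c" where
  "stem T v = (THE c. nbr v c \<in> T)"

lemma leaves_iff: "v \<in> leaves \<Gamma> T \<longleftrightarrow> v \<in> T \<and> (\<exists>!c. nbr v c \<in> T)"
proof (cases "v \<in> T")
  case True
  have "card {c. nbr v c \<in> T} = 1 \<longleftrightarrow> (\<exists>!c. nbr v c \<in> T)"
  proof
    assume "card {c. nbr v c \<in> T} = 1"
    then obtain k where "{c. nbr v c \<in> T} = {k}" by (auto simp: card_1_singleton_iff)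
    then have "nbr v c \<in> T \<longleftrightarrow> c = k" for c by (auto simp: set_eq_iff)
    then show "\<exists>!c. nbr v c \<in> T" by simp
  next
    assume "\<exists>!c. nbr v c \<in> T"
    then obtain k where "nbr v k \<in> T" "\<And>c. nbr v c \<in> T \<Longrightarrow> c = k" by blast
    then have "{c. nbr v c \<in> T} = {k}" by blast
    then show "card {c. nbr v c \<in> T} = 1" by simp
  qed
  then show ?thesis using True by (simp add: leaves_def valency_in_eq)
qed (simp add: leaves_def)

lemma leaf_in: "v \<in> leaves \<Gamma> T \<Longrightarrow> v \<in> T"
  by (simp add: leaves_iff)

lemma leaf_nbr_iff: "v \<in> leaves \<Gamma> T \<Longrightarrow> nbr v c \<in> T \<longleftrightarrow> c = stem T v"
  unfolding leaves_iff stem_def by (metis theI)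

lemma leafI: "v \<in> T \<Longrightarrow> (\<And>c. nbr v c \<in> T \<longleftrightarrow> c = k) \<Longrightarrow> v \<in> leaves \<Gamma> T"
  by (auto simp: leaves_iff)

lemma stem_eqI: "(\<And>c. nbr v c \<in> T \<longleftrightarrow> c = k) \<Longrightarrow> stem T v = k"
  unfolding stem_def by blast

lemma two_colors: "\<exists>c::'c. c \<noteq> k"
proof (rule ccontr)
  assume "\<not> ?thesis"
  then have "(UNIV :: 'c set) = {k}" by auto
  then have "CARD('c) = card {k}" by (rule arg_cong)
  then show False using three by simp
qed

lemma complete_iff:
  "complete_subtree \<Gamma> T \<longleftrightarrow> finite T \<and> subtree \<Gamma> T \<and> base \<Gamma> \<in> T \<and>
     (\<forall>x\<in>T. x \<in> leaves \<Gamma> T \<or> (\<forall>c. nbr x c \<in> T))"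
proof -
  have "valency_in \<Gamma> T x = CARD('c) \<longleftrightarrow> (\<forall>c. nbr x c \<in> T)" if "x \<in> T" for x
    using that card_eq_UNIV_imp_eq_UNIV[of "{c. nbr x c \<in> T}"] by (auto simp: valency_in_eq)
  then show ?thesis unfolding complete_subtree_def by (metis DiffI DiffD1 DiffD2)
qed

lemma completeD:
  assumes "complete_subtree \<Gamma> T"
  shows "finite T" "subtree \<Gamma> T" "base \<Gamma> \<in> T" "\<And>x c. x \<in> T \<Longrightarrow> x \<notin> leaves \<Gamma> T \<Longrightarrow> nbr x c \<in> T"
  using assms by (auto simp: complete_iff)

text \<open>\<open>T\<close> is connected, the half-tree can be entered only through
  \<open>v\<close>, and the only step inside \<open>T\<close> from \<open>v\<close> leads across the
  stem, out of the half-tree.\<close>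

lemma leaf_half_disjoint:
  assumes T: "subtree \<Gamma> T" and v: "v \<in> leaves \<Gamma> T" and y: "y \<in> T" "y \<in> half v (stem T v)"
  shows "y = v"
proof -
  have "y = v \<or> y \<notin> half v (stem T v)"
    using T leaf_in[OF v] y(1)
  proof (induction rule: subtree_induct)
    case (step x c)
    show ?case
    proof (cases "x = v")
      case True
      then show ?thesis using step leaf_nbr_iff[OF v] by auto
    next
      case False
      then have "x \<notin> half v (stem T v)" using step by simp
      then show ?thesis using half_nbr[of "nbr x c" v "stem T v" c] by auto
    qed
  qed simp
  then show ?thesis using y by simp
qed

text \<open>A path starting at the base leaves \<open>T\<close> only at a leaf and by an edge other
  than the stem, that is, into the half-tree of that leaf; the half-tree is left again only through
  the leaf.\<close>

lemma halves_cover: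
  assumes "complete_subtree \<Gamma> T"
  shows "x \<in> T \<or> (\<exists>v\<in>leaves \<Gamma> T. x \<in> half v (stem T v))"
proof (induction x rule: tree_induct[of _ "base \<Gamma>"])
  case 1
  then show ?case using completeD(3)[OF assms] by simp
next
  case (2 x c)
  show ?case
  proof (cases "x \<in> T")
    case True
    show ?thesis
    proof (cases "nbr x c \<in> T")
      case False
      then have "x \<in> leaves \<Gamma> T" using completeD(4)[OF assms True] by blast
      moreover have "c \<noteq> stem T x" using False leaf_nbr_iff[OF \<open>x \<in> leaves \<Gamma> T\<close>] by blast
      ultimately show ?thesis using half_nbr[of x x "stem T x" c] by auto
    qed simp
  next
    case False
    then obtain v where v: "v \<in> leaves \<Gamma> T" "x \<in> half v (stem T v)" using 2 by blast
    moreover have "x \<noteq> v" using False leaf_in[OF v(1)] by blast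
    ultimately show ?thesis using half_nbr[of x v "stem T v" c] by blast
  qed
qed

lemma half_disjoint:
  assumes "v' \<notin> half v k" "v \<notin> half v' k'" shows "half v k \<inter> half v' k' = {}"
proof -
  have "x \<notin> half v k" if "x \<in> half v' k'" for x
    using that
  proof (induction rule: half_induct)
    case (step x c)
    then show ?case using half_nbr[of "nbr x c" v k c] assms(2) by auto
  qed (use assms in simp)
  then show ?thesis by blast
qed

lemma leaf_halves_disjoint:
  assumes "subtree \<Gamma> T" "v \<in> leaves \<Gamma> T" "v' \<in> leaves \<Gamma> T" "v \<noteq> v'"
  shows "half v (stem T v) \<inter> half v' (stem T v') = {}"
  using half_disjoint leaf_half_disjoint[OF assms(1)] assms(2-4) leaf_in by metis

lemma length_word_sym: "length (word x y) = length (word y x)"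
  by (metis length_rev word_rev)

text \<open>Translates the definition by distances into words. The geodesic from a vertex behind
  \<open>v\<close> to another vertex of \<open>T\<close> passes through \<open>v\<close>, because
  the two reduced words do not cancel at \<open>v\<close>. A vertex on the other side is nearer to
  the neighbour of \<open>v\<close> across the stem, which lies in \<open>T\<close>.\<close>

lemma branch_eq_half:
  assumes T: "subtree \<Gamma> T" and v: "v \<in> leaves \<Gamma> T"
  shows "branch \<Gamma> T v = half v (stem T v)"
proof (rule equalityI; rule subsetI)
  let ?k = "stem T v"
  fix w assume w: "w \<in> half v ?k"
  show "w \<in> branch \<Gamma> T v"
  proof (cases "w = v")
    case False
    have "vertex_dist \<Gamma> w v < vertex_dist \<Gamma> w u" if "u \<in> T - {v}" for u
    proof -
      have "u \<notin> half v ?k" using that leaf_half_disjoint[OF T v] by blast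
      then have u: "hd (word v u) = ?k" by (simp add: half_iff')
      have "hd (word v w) \<noteq> ?k" using w False by (simp add: half_iff')
      then have "last (word w v) \<noteq> hd (word v u)" using u by (simp add: word_rev[of w v] last_rev hd_rev)
      then have "word w u = word w v @ word v u"
        by (intro word_append) (simp add: distinct_adj_append_iff word_props)
      then show ?thesis using that by (auto simp: vertex_dist_eq)
    qed
    moreover have "w \<notin> T" using False leaf_half_disjoint[OF T v _ w] by blast
    ultimately show ?thesis by (auto simp: branch_def)
  qed (simp add: branch_def)
next
  let ?k = "stem T v"
  fix w assume w: "w \<in> branch \<Gamma> T v"
  show "w \<in> half v ?k"
  proof (rule ccontr)
    assume "w \<notin> half v ?k"
    then have "w \<noteq> v" "hd (word v w) = ?k" by (auto simp: half_iff')
    then obtain ws where ws: "word v w = ?k # ws" by (metis list.collapse word_eq_Nil)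
    then have "word (nbr v ?k) w = ws"
      using word_props[of v w] by (intro word_eqI) (auto dest: distinct_adj_ConsD)
    then have "vertex_dist \<Gamma> w (nbr v ?k) < vertex_dist \<Gamma> w v"
      using ws by (simp add: vertex_dist_eq length_word_sym[of w])
    moreover have "nbr v ?k \<in> T - {v}" using leaf_nbr_iff[OF v] by simp
    ultimately show False using w \<open>w \<noteq> v\<close> unfolding branch_def by (auto dest: less_asym)
  qed
qed

lemma forest_verts_eq: "complete_subtree \<Gamma> T \<Longrightarrow> forest_verts \<Gamma> T = - T \<union> leaves \<Gamma> T"
proof (intro equalityI subsetI)
  assume T: "complete_subtree \<Gamma> T"
  note br = branch_eq_half[OF completeD(2)[OF T]]
  show "x \<in> - T \<union> leaves \<Gamma> T" if "x \<in> forest_verts \<Gamma> T" for x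
    using that leaf_half_disjoint[OF completeD(2)[OF T]] by (auto simp: forest_verts_def br)
  show "x \<in> forest_verts \<Gamma> T" if "x \<in> - T \<union> leaves \<Gamma> T" for x
    using that halves_cover[OF T, of x] br half_self unfolding forest_verts_def by blast
qed

lemma spanned_half: "edge x c \<in> spanned_edges \<Gamma> (half v k) \<longleftrightarrow> x \<in> half v k \<and> \<not> (x = v \<and> c = k)"
  using half_back_iff[of x v k c] by (auto simp: spanned_edges_def)

lemma forest_edges_eq:
  assumes T: "complete_subtree \<Gamma> T" shows "forest_edges \<Gamma> T = - spanned_edges \<Gamma> T"
proof (intro equalityI subsetI)
  note br = branch_eq_half[OF completeD(2)[OF T]]
  note ld = leaf_half_disjoint[OF completeD(2)[OF T]]
  show "e \<in> - spanned_edges \<Gamma> T" if f: "e \<in> forest_edges \<Gamma> T" for e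
  proof
    assume e: "e \<in> spanned_edges \<Gamma> T"
    obtain v where "v \<in> leaves \<Gamma> T" "e \<in> spanned_edges \<Gamma> (half v (stem T v))"
      using f br unfolding forest_edges_def by fastforce
    then have "org \<Gamma> e = v" "ter \<Gamma> e = v" using ld e by (auto simp: spanned_edges_def)
    then show False using ter_neq_org(1)[of e] by simp
  qed
  have *: "edge x c \<in> forest_edges \<Gamma> T" "edge (nbr x c) c \<in> forest_edges \<Gamma> T" if x: "x \<notin> T" for x c
  proof -
    obtain v where v: "v \<in> leaves \<Gamma> T" "x \<in> half v (stem T v)" using halves_cover[OF T, of x] x by blast
    have "x \<noteq> v" using x leaf_in[OF v(1)] by blast
    then have "nbr x c \<in> half v (stem T v)" using half_nbr[OF v(2)] by blast
    then have "edge x c \<in> spanned_edges \<Gamma> (half v (stem T v))"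
        "edge (nbr x c) c \<in> spanned_edges \<Gamma> (half v (stem T v))"
      using v(2) by (auto simp: spanned_edges_def)
    then show "edge x c \<in> forest_edges \<Gamma> T" "edge (nbr x c) c \<in> forest_edges \<Gamma> T"
      using v(1) by (auto simp: forest_edges_def br)
  qed
  show "e \<in> forest_edges \<Gamma> T" if "e \<in> - spanned_edges \<Gamma> T" for e
  proof (cases e rule: edge_cases)
    case (1 x c)
    then have "x \<notin> T \<or> nbr x c \<notin> T" using that by (auto simp: spanned_edges_def)
    then show ?thesis using *(1)[of x c] *(2)[of "nbr x c" c] 1 by auto
  qed
qed

section \<open>Enlarging complete subtrees\<close>

text \<open>For a leaf \<open>v\<close> this is the elementary expansion known from tree pair
  diagrams of Thompson groups: the leaf is replaced by its outward neighbours.\<close>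

definition caret :: "'v set \<Rightarrow> 'v \<Rightarrow> 'v set" where
  "caret T v = T \<union> range (nbr v)"

context
  fixes T v
  assumes T: "complete_subtree \<Gamma> T" and v: "v \<in> leaves \<Gamma> T"
begin

lemma caret_new: "c \<noteq> stem T v \<Longrightarrow> nbr v c \<in> half v (stem T v) - T"
  using half_nbr[of v v "stem T v" c] leaf_half_disjoint[OF completeD(2)[OF T] v, of "nbr v c"] by auto

lemma caret_nbr_new:
  assumes c: "c \<noteq> stem T v" shows "nbr (nbr v c) c' \<in> caret T v \<longleftrightarrow> c' = c"
proof
  assume a: "nbr (nbr v c) c' \<in> caret T v"
  show "c' = c"
  proof (rule ccontr)
    assume n: "c' \<noteq> c"
    have "word v (nbr (nbr v c) c') = [c, c']" using n by (intro word_eqI) auto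
    moreover have "word v (nbr v c'') = [c'']" for c'' by (intro word_eqI) auto
    ultimately have "nbr (nbr v c) c' \<notin> range (nbr v)" by auto
    then have "nbr (nbr v c) c' \<in> T" using a by (auto simp: caret_def)
    moreover have "nbr (nbr v c) c' \<in> half v (stem T v)"
      using caret_new[OF c] by (intro half_nbr) auto
    ultimately have "nbr (nbr v c) c' = v" using leaf_half_disjoint[OF completeD(2)[OF T] v] by blast
    then show False using n by (metis nbr_inject nbr_nbr)
  qed
next
  assume "c' = c"
  then show "nbr (nbr v c) c' \<in> caret T v" using leaf_in[OF v] by (simp add: caret_def)
qed

lemma caret_nbr_old:
  assumes "u \<in> T" "u \<noteq> v" shows "nbr u c \<in> caret T v \<longleftrightarrow> nbr u c \<in> T"
proof
  assume a: "nbr u c \<in> caret T v"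
  show "nbr u c \<in> T"
  proof (rule ccontr)
    assume n: "nbr u c \<notin> T"
    then obtain c' where c': "nbr u c = nbr v c'" using a by (auto simp: caret_def)
    then have "c' \<noteq> stem T v" using n leaf_nbr_iff[OF v] by auto
    then have "u = v \<or> nbr (nbr v c') c \<notin> caret T v \<or> c = c'" using caret_nbr_new by blast
    moreover have "nbr (nbr v c') c = u" by (metis c' nbr_nbr)
    ultimately have "c = c'" using assms by (auto simp: caret_def)
    then show False using c' assms by (metis nbr_nbr)
  qed
qed (simp add: caret_def)

lemma caret_leaves: "leaves \<Gamma> (caret T v) = leaves \<Gamma> T - {v} \<union> {nbr v c | c. c \<noteq> stem T v}"
proof (intro equalityI subsetI)
  fix u assume u: "u \<in> leaves \<Gamma> (caret T v)"
  have "u \<noteq> v"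
  proof
    assume "u = v"
    then have "\<And>c. c = stem (caret T v) u" using leaf_nbr_iff[OF u] by (auto simp: caret_def)
    then show False using two_colors by metis
  qed
  show "u \<in> leaves \<Gamma> T - {v} \<union> {nbr v c | c. c \<noteq> stem T v}"
  proof (cases "u \<in> T")
    case True
    then have "u \<in> leaves \<Gamma> T"
      using leaf_nbr_iff[OF u] caret_nbr_old[OF True \<open>u \<noteq> v\<close>] by (intro leafI[of _ _ "stem (caret T v) u"]) auto
    then show ?thesis using \<open>u \<noteq> v\<close> by simp
  next
    case False
    then obtain c where "u = nbr v c" using leaf_in[OF u] by (auto simp: caret_def)
    then show ?thesis using False leaf_nbr_iff[OF v] by auto
  qed
next
  fix u assume "u \<in> leaves \<Gamma> T - {v} \<union> {nbr v c | c. c \<noteq> stem T v}"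
  then consider "u \<in> leaves \<Gamma> T" "u \<noteq> v" | c where "u = nbr v c" "c \<noteq> stem T v" by blast
  then show "u \<in> leaves \<Gamma> (caret T v)"
  proof cases
    case 1
    then show ?thesis using caret_nbr_old leaf_nbr_iff[OF 1(1)] leaf_in[OF 1(1)]
      by (intro leafI[of _ _ "stem T u"]) (auto simp: caret_def)
  next
    case 2
    then show ?thesis using caret_nbr_new by (intro leafI[of _ _ c]) (auto simp: caret_def)
  qed
qed

lemma caret_stem:
  "u \<in> leaves \<Gamma> T \<Longrightarrow> u \<noteq> v \<Longrightarrow> stem (caret T v) u = stem T u"
  "c \<noteq> stem T v \<Longrightarrow> stem (caret T v) (nbr v c) = c"
  by (rule stem_eqI; simp add: caret_nbr_old leaf_nbr_iff leaf_in caret_nbr_new)+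

lemma caret_complete: "complete_subtree \<Gamma> (caret T v)"
  unfolding complete_iff
proof (intro conjI ballI)
  show "finite (caret T v)" using completeD(1)[OF T] by (simp add: caret_def)
  show "base \<Gamma> \<in> caret T v" using completeD(3)[OF T] by (simp add: caret_def)
  show "subtree \<Gamma> (caret T v)"
  proof (rule subtreeI[OF leaf_in[OF v, THEN UnI1, of "range (nbr v)", folded caret_def]])
    fix x assume "x \<in> caret T v"
    then consider "x \<in> T" | c where "x = nbr v c" by (auto simp: caret_def)
    then show "(v, x) \<in> (adj (caret T v))\<^sup>*"
    proof cases
      case 1
      then have "(v, x) \<in> (adj T)\<^sup>*" using completeD(2)[OF T] leaf_in[OF v] by (simp add: subtree_iff)
      then show ?thesis using rtrancl_mono[OF adj_mono[of T "caret T v"]] by (auto simp: caret_def)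
    next
      case 2
      then show ?thesis using adjI[of v "caret T v" c] leaf_in[OF v] by (auto simp: caret_def)
    qed
  qed
  fix x assume x: "x \<in> caret T v"
  show "x \<in> leaves \<Gamma> (caret T v) \<or> (\<forall>c. nbr x c \<in> caret T v)"
  proof (cases "x = v")
    case False
    show ?thesis
    proof (cases "x \<in> T")
      case True
      then show ?thesis using completeD(4)[OF T True] False
        by (cases "x \<in> leaves \<Gamma> T") (simp_all add: caret_leaves, simp add: caret_def)
    next
      case nT: False
      then obtain c where "x = nbr v c" using x by (auto simp: caret_def)
      then show ?thesis using nT leaf_nbr_iff[OF v] by (auto simp: caret_leaves)
    qed
  qed (simp add: caret_def)
qed

end

text \<open>By connectedness \<open>T\<close> continues beyond \<open>T0\<close> at some leaf of
  \<open>T0\<close>. In \<open>T\<close> this vertex has the stem neighbour and a further one, so it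
  is no leaf of \<open>T\<close> and all its neighbours belong to \<open>T\<close>.\<close>

lemma caret_step_exists:
  assumes T0: "complete_subtree \<Gamma> T0" and T: "complete_subtree \<Gamma> T" and sub: "T0 \<subseteq> T" "T0 \<noteq> T"
  shows "\<exists>v\<in>leaves \<Gamma> T0. caret T0 v \<subseteq> T \<and> \<not> caret T0 v \<subseteq> T0"
proof -
  have "\<exists>x c. x \<in> T0 \<and> nbr x c \<in> T - T0"
  proof (rule ccontr)
    assume n: "\<not> ?thesis"
    have "y \<in> T0" if "y \<in> T" for y
      using completeD(2,3)[OF T] that
      by (induction rule: subtree_induct) (use n completeD(3)[OF T0] in auto)
    then show False using sub by blast
  qed
  then obtain x c where x: "x \<in> T0" "nbr x c \<in> T" "nbr x c \<notin> T0" by blast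
  then have l: "x \<in> leaves \<Gamma> T0" using completeD(4)[OF T0] by blast
  have "nbr x (stem T0 x) \<in> T" using leaf_nbr_iff[OF l, of "stem T0 x"] sub by auto
  moreover have "c \<noteq> stem T0 x" using x leaf_nbr_iff[OF l] by auto
  ultimately have "x \<notin> leaves \<Gamma> T" using x(2) by (auto simp: leaves_iff)
  then have "caret T0 x \<subseteq> T" using completeD(4)[OF T, of x] x(1) sub by (auto simp: caret_def)
  moreover have "nbr x c \<in> caret T0 x" by (simp add: caret_def)
  ultimately show ?thesis using l x(3) by blast
qed

text \<open>Reduces every enlargement of a complete subtree to expansions of a single leaf.\<close>

lemma caret_induct [consumes 3, case_names root step]:
  assumes "complete_subtree \<Gamma> T0" "complete_subtree \<Gamma> T" "T0 \<subseteq> T" "Q T0"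
    and step: "\<And>T' v. complete_subtree \<Gamma> T' \<Longrightarrow> v \<in> leaves \<Gamma> T' \<Longrightarrow> Q T' \<Longrightarrow> Q (caret T' v)"
  shows "Q T"
  using assms(1,3,4)
proof (induction "card (T - T0)" arbitrary: T0 rule: less_induct)
  case less
  show ?case
  proof (cases "T0 = T")
    case False
    then obtain v where v: "v \<in> leaves \<Gamma> T0" "caret T0 v \<subseteq> T" "\<not> caret T0 v \<subseteq> T0"
      using caret_step_exists[OF less.prems(1) assms(2)] less.prems by blast
    have "T0 \<subseteq> caret T0 v" by (auto simp: caret_def)
    then have "T - caret T0 v \<subset> T - T0" using v by blast
    then have "card (T - caret T0 v) < card (T - T0)"
      using completeD(1)[OF assms(2)] by (intro psubset_card_mono) auto
    then show ?thesis using less.hyps caret_complete v step less.prems by blast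
  qed (use less in simp)
qed

lemma level_nbr:
  "level (nbr x c) = (if x \<noteq> base \<Gamma> \<and> last (word (base \<Gamma>) x) = c then level x - 1 else Suc (level x))"
  by (auto simp: level_def word_nbr)

lemma tree_ball_leaves:
  assumes "n \<ge> 1" shows "leaves \<Gamma> (tree_ball n) = {x. level x = n}"
proof (intro equalityI subsetI)
  fix x assume x: "x \<in> leaves \<Gamma> (tree_ball n)"
  obtain c where c: "c \<noteq> stem (tree_ball n) x" using two_colors by blast
  then have "nbr x c \<notin> tree_ball n" using leaf_nbr_iff[OF x] by blast
  then show "x \<in> {x. level x = n}"
    using leaf_in[OF x] level_nbr_le[of x c] by (simp add: tree_ball_def)
next
  fix x assume x: "x \<in> {x. level x = n}"
  then have "x \<noteq> base \<Gamma>" using assms by auto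
  then show "x \<in> leaves \<Gamma> (tree_ball n)"
    using x assms by (intro leafI[of _ _ "last (word (base \<Gamma>) x)"]) (auto simp: tree_ball_def level_nbr)
qed

lemma tree_ball_connected: "x \<in> tree_ball n \<Longrightarrow> (base \<Gamma>, x) \<in> (adj (tree_ball n))\<^sup>*"
proof (induction "level x" arbitrary: x)
  case 0
  then show ?case by simp
next
  case (Suc m)
  define y where "y = nbr x (last (word (base \<Gamma>) x))"
  have "x \<noteq> base \<Gamma>" using Suc(2) by auto
  then have "level y = m" using Suc(2) by (simp add: y_def level_nbr)
  then have "y \<in> tree_ball n" "(base \<Gamma>, y) \<in> (adj (tree_ball n))\<^sup>*"
    using Suc by (auto simp: tree_ball_def)
  moreover have "x = nbr y (last (word (base \<Gamma>) x))" by (simp add: y_def)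
  ultimately show ?case using adjI[of y "tree_ball n"] Suc.prems by (metis rtrancl.rtrancl_into_rtrancl)
qed

text \<open>Radius 0 is excluded: a single vertex has valency 0, so it is neither a leaf nor of full
  valency. Balls are cofinal among the finite vertex sets and serve as standard domain
  trees.\<close>

lemma tree_ball_complete:
  assumes "n \<ge> 1" shows "complete_subtree \<Gamma> (tree_ball n)"
  unfolding complete_iff
proof (intro conjI ballI)
  show "finite (tree_ball n)" by (rule finite_tree_ball)
  show b: "base \<Gamma> \<in> tree_ball n" by (simp add: tree_ball_def)
  show "subtree \<Gamma> (tree_ball n)" using b tree_ball_connected by (rule subtreeI)
  fix x assume "x \<in> tree_ball n"
  then show "x \<in> leaves \<Gamma> (tree_ball n) \<or> (\<forall>c. nbr x c \<in> tree_ball n)"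
  proof (cases "level x = n")
    case False
    then have "Suc (level x) \<le> n" using \<open>x \<in> tree_ball n\<close> by (simp add: tree_ball_def)
    then have "nbr x c \<in> tree_ball n" for c
      using level_nbr_le[of x c] by (simp add: tree_ball_def)
    then show ?thesis by simp
  qed (simp add: tree_ball_leaves[OF assms])
qed

lemma finite_subset_large_ball: "finite A \<Longrightarrow> \<exists>n\<ge>m. n \<ge> 1 \<and> A \<subseteq> tree_ball n"
proof -
  assume "finite A"
  then obtain n where "A \<subseteq> tree_ball n" using finite_subset_tree_ball by blast
  moreover have "tree_ball n \<subseteq> tree_ball (max 1 (max m n))" by (rule tree_ball_mono) simp
  ultimately have "A \<subseteq> tree_ball (max 1 (max m n))" by blast
  then show ?thesis by (intro exI[of _ "max 1 (max m n)"]) auto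
qed

lemma aut_image_nbr:
  assumes "g \<in> Aut" shows "nbr (fst g x) (loc g x c) \<in> fst g ` T \<longleftrightarrow> nbr x c \<in> T"
  using assms by (auto simp: aut_nbr[symmetric] aut_inv_apply)

lemma aut_image_leaves:
  assumes g: "g \<in> Aut"
  shows "leaves \<Gamma> (fst g ` T) = fst g ` leaves \<Gamma> T"
    and "v \<in> leaves \<Gamma> T \<Longrightarrow> stem (fst g ` T) (fst g v) = loc g v (stem T v)"
proof -
  have *: "nbr (fst g x) c \<in> fst g ` T \<longleftrightarrow> nbr x (finv (loc g x) c) \<in> T" for x c
    using aut_image_nbr[OF g, of x "finv (loc g x) c" T] loc_bij[OF g, of x]
    by (simp add: bij_is_surj surj_f_inv_f)
  have ex: "(\<exists>!c. nbr (fst g x) c \<in> fst g ` T) \<longleftrightarrow> (\<exists>!c. nbr x c \<in> T)" for x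
    unfolding * by (rule bij_ex1_iff[OF bij_imp_bij_inv[OF loc_bij[OF g]], symmetric])
  show "leaves \<Gamma> (fst g ` T) = fst g ` leaves \<Gamma> T"
  proof (intro equalityI subsetI)
    fix y assume y: "y \<in> leaves \<Gamma> (fst g ` T)"
    then obtain x where x: "y = fst g x" "x \<in> T" using leaf_in by blast
    then have "x \<in> leaves \<Gamma> T" using y ex[of x] by (simp add: leaves_iff)
    then show "y \<in> fst g ` leaves \<Gamma> T" using x by blast
  next
    fix y assume "y \<in> fst g ` leaves \<Gamma> T"
    then obtain x where x: "y = fst g x" "x \<in> leaves \<Gamma> T" by blast
    then show "y \<in> leaves \<Gamma> (fst g ` T)" using ex[of x] by (simp add: leaves_iff)
  qed
  show "stem (fst g ` T) (fst g v) = loc g v (stem T v)" if v: "v \<in> leaves \<Gamma> T"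
  proof (rule stem_eqI)
    fix c
    have "stem T v = finv (loc g v) c \<longleftrightarrow> loc g v (stem T v) = c"
      by (rule bij_inv_eq_iff[OF loc_bij[OF g]])
    then show "nbr (fst g v) c \<in> fst g ` T \<longleftrightarrow> c = loc g v (stem T v)"
      unfolding * leaf_nbr_iff[OF v] by metis
  qed
qed

lemma aut_image_complete:
  assumes g: "g \<in> Aut" and T: "complete_subtree \<Gamma> T" and b: "base \<Gamma> \<in> fst g ` T"
  shows "complete_subtree \<Gamma> (fst g ` T)"
  unfolding complete_iff
proof (intro conjI ballI)
  show "finite (fst g ` T)" using completeD(1)[OF T] by simp
  show "subtree \<Gamma> (fst g ` T)"
  proof (rule subtreeI)
    show "fst g (base \<Gamma>) \<in> fst g ` T" using completeD(3)[OF T] by simp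
    fix y assume "y \<in> fst g ` T"
    then obtain x where x: "y = fst g x" "x \<in> T" by blast
    have "(fst g (base \<Gamma>), fst g x) \<in> (adj (fst g ` T))\<^sup>*"
      using completeD(2,3)[OF T] x(2)
    proof (induction rule: subtree_induct)
      case (step x c)
      then have "(fst g x, fst g (nbr x c)) \<in> adj (fst g ` T)"
        using adjI[of "fst g x" "fst g ` T" "loc g x c"] g by (simp add: aut_nbr[symmetric])
      then show ?case using step.IH by (meson rtrancl.rtrancl_into_rtrancl)
    qed simp
    then show "(fst g (base \<Gamma>), y) \<in> (adj (fst g ` T))\<^sup>*" using x by simp
  qed
  show "base \<Gamma> \<in> fst g ` T" by fact
  fix y assume "y \<in> fst g ` T"
  then obtain x where x: "y = fst g x" "x \<in> T" by blast
  show "y \<in> leaves \<Gamma> (fst g ` T) \<or> (\<forall>c. nbr y c \<in> fst g ` T)"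
  proof (cases "x \<in> leaves \<Gamma> T")
    case False
    then have "nbr x c \<in> T" for c using completeD(4)[OF T x(2)] by blast
    then have "nbr (fst g x) (loc g x c) \<in> fst g ` T" for c using aut_image_nbr[OF g] by blast
    then have "nbr (fst g x) c \<in> fst g ` T" for c
      using loc_bij[OF g, of x] by (metis bij_is_surj surjD)
    then show ?thesis using x by simp
  qed (use x aut_image_leaves[OF g] in auto)
qed

end

section \<open>Germs of maps modulo finite sets\<close>

definition germ_eq :: "('a \<Rightarrow> 'b) \<Rightarrow> ('a \<Rightarrow> 'b) \<Rightarrow> bool" where
  "germ_eq f g \<longleftrightarrow> finite {x. f x \<noteq> g x}"

lemma germ_eq_refl [simp]: "germ_eq f f"
  by (simp add: germ_eq_def)

lemma germ_eq_sym: "germ_eq f g \<Longrightarrow> germ_eq g f"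
  by (simp add: germ_eq_def eq_commute)

lemma germ_eq_trans [trans]: "germ_eq f g \<Longrightarrow> germ_eq g h \<Longrightarrow> germ_eq f h"
  unfolding germ_eq_def by (erule finite_subset[rotated, OF finite_UnI]) auto

lemma germ_eqI: "finite A \<Longrightarrow> (\<And>x. x \<notin> A \<Longrightarrow> f x = g x) \<Longrightarrow> germ_eq f g"
  unfolding germ_eq_def by (erule finite_subset[rotated]) auto

text \<open>The condition under which precomposition respects germs: the finite exceptional set of
  the outer map must have a finite preimage (\<open>germ_eq_comp\<close>).\<close>

definition finite_fibres :: "('a \<Rightarrow> 'b) \<Rightarrow> bool" where
  "finite_fibres f \<longleftrightarrow> (\<forall>A. finite A \<longrightarrow> finite (f -` A))"

lemma finite_fibres_germ_eq: "finite_fibres f \<Longrightarrow> germ_eq f g \<Longrightarrow> finite_fibres g"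
  unfolding finite_fibres_def germ_eq_def
proof (intro allI impI)
  fix A :: "'b set"
  assume "\<forall>A. finite A \<longrightarrow> finite (f -` A)" "finite {x. f x \<noteq> g x}" "finite A"
  then have "finite (f -` A \<union> {x. f x \<noteq> g x})" by blast
  then show "finite (g -` A)" by (rule finite_subset[rotated]) auto
qed

lemma germ_eq_comp:
  assumes "germ_eq f f'" "germ_eq g g'" "finite_fibres g"
  shows "germ_eq (f \<circ> g) (f' \<circ> g')"
proof (rule germ_eqI)
  show "finite (g -` {x. f x \<noteq> f' x} \<union> {x. g x \<noteq> g' x})"
    using assms by (auto simp: germ_eq_def finite_fibres_def)
qed auto

section \<open>Almost automorphisms and their leaves\<close>

context colored_tree
begin

abbreviation "AA \<equiv> honest_almost_automorphisms \<Gamma>"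
abbreviation "FV \<equiv> forest_verts \<Gamma>"
abbreviation "FE \<equiv> forest_edges \<Gamma>"

lemma AA_D:
  assumes "\<phi> \<in> AA H"
  shows "complete_subtree \<Gamma> (dom_tree \<phi>)" "complete_subtree \<Gamma> (cod_tree \<phi>)"
    "card (leaves \<Gamma> (dom_tree \<phi>)) = card (leaves \<Gamma> (cod_tree \<phi>))"
    "bij_betw (vmap \<phi>) (FV (dom_tree \<phi>)) (FV (cod_tree \<phi>))"
    "bij_betw (emap \<phi>) (FE (dom_tree \<phi>)) (FE (cod_tree \<phi>))"
    "\<And>e. e \<in> FE (dom_tree \<phi>) \<Longrightarrow> org \<Gamma> (emap \<phi> e) = vmap \<phi> (org \<Gamma> e)"
    "\<And>e. e \<in> FE (dom_tree \<phi>) \<Longrightarrow> ter \<Gamma> (emap \<phi> e) = vmap \<phi> (ter \<Gamma> e)"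
    "\<And>e. e \<in> FE (dom_tree \<phi>) \<Longrightarrow> opp \<Gamma> (emap \<phi> e) = emap \<phi> (opp \<Gamma> e)"
  using assms by (auto simp: honest_almost_automorphisms_def forest_isomorphism_def)

lemma AA_mono: "H \<subseteq> H' \<Longrightarrow> AA H \<subseteq> AA H'"
  unfolding honest_almost_automorphisms_def by blast

lemma FE_endpoints: "e \<in> FE T \<Longrightarrow> org \<Gamma> e \<in> FV T \<and> ter \<Gamma> e \<in> FV T \<and> opp \<Gamma> e \<in> FE T"
  by (auto simp: forest_edges_def forest_verts_def spanned_edges_def)

lemma finite_leaves: "complete_subtree \<Gamma> T \<Longrightarrow> finite (leaves \<Gamma> T)"
  by (meson completeD(1) finite_subset leaf_in subsetI)

definition honest_at :: "('v, 'e) forest_map \<Rightarrow> ('v \<Rightarrow> 'v) \<times> ('e \<Rightarrow> 'e) \<Rightarrow> 'v \<Rightarrow> 'c \<Rightarrow> bool" where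
  "honest_at \<phi> h v k \<longleftrightarrow> (\<forall>x\<in>half v k. vmap \<phi> x = fst h x) \<and>
     (\<forall>e\<in>spanned_edges \<Gamma> (half v k). emap \<phi> e = snd h e)"

lemma AA_honest_at:
  assumes "\<phi> \<in> AA H" "v \<in> leaves \<Gamma> (dom_tree \<phi>)"
  shows "\<exists>h\<in>H. honest_at \<phi> h v (stem (dom_tree \<phi>) v)"
  using assms branch_eq_half[OF completeD(2)[OF AA_D(1)[OF assms(1)]] assms(2)]
  unfolding honest_almost_automorphisms_def honest_at_def by simp metis

lemma AA_I:
  assumes "complete_subtree \<Gamma> (dom_tree \<phi>)" "complete_subtree \<Gamma> (cod_tree \<phi>)"
    "card (leaves \<Gamma> (dom_tree \<phi>)) = card (leaves \<Gamma> (cod_tree \<phi>))"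
    "forest_isomorphism \<Gamma> \<phi>"
    "\<And>v. v \<in> leaves \<Gamma> (dom_tree \<phi>) \<Longrightarrow> \<exists>h\<in>H. honest_at \<phi> h v (stem (dom_tree \<phi>) v)"
  shows "\<phi> \<in> AA H"
  using assms branch_eq_half[OF completeD(2)[OF assms(1)]]
  by (simp add: honest_almost_automorphisms_def honest_at_def)

lemma leaf_in_FV: "v \<in> leaves \<Gamma> T \<Longrightarrow> v \<in> FV T"
  by (auto simp: forest_verts_def branch_def)

lemma half_subset_FV: "complete_subtree \<Gamma> T \<Longrightarrow> v \<in> leaves \<Gamma> T \<Longrightarrow> half v (stem T v) \<subseteq> FV T"
  using branch_eq_half[OF completeD(2)] by (auto simp: forest_verts_def)

lemma half_subset_FE:
  "complete_subtree \<Gamma> T \<Longrightarrow> v \<in> leaves \<Gamma> T \<Longrightarrow> spanned_edges \<Gamma> (half v (stem T v)) \<subseteq> FE T"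
  using branch_eq_half[OF completeD(2)] by (auto simp: forest_edges_def)

text \<open>The leaf is recognised by its edges. The forest contains all edges at \<open>v\<close>
  except the stem, so by bijectivity the forest of the codomain contains all edges at the image
  except one, the image of the stem under \<open>h\<close>. That missing edge is spanned by the
  codomain tree, which makes the image a leaf with this stem.\<close>

lemma AA_leaf_image:
  assumes \<phi>: "\<phi> \<in> AA H" and v: "v \<in> leaves \<Gamma> (dom_tree \<phi>)" and h: "h \<in> Aut"
    and hon: "honest_at \<phi> h v (stem (dom_tree \<phi>) v)"
  shows "fst h v \<in> leaves \<Gamma> (cod_tree \<phi>)"
    "stem (cod_tree \<phi>) (fst h v) = loc h v (stem (dom_tree \<phi>) v)"
proof -
  let ?T = "dom_tree \<phi>" and ?T' = "cod_tree \<phi>"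
  let ?k = "stem ?T v"
  note D = AA_D[OF \<phi>]
  have hv: "vmap \<phi> v = fst h v" using hon by (simp add: honest_at_def)
  have vF: "v \<in> FV ?T" using v by (rule leaf_in_FV)
  then have hF: "fst h v \<in> FV ?T'" using bij_betwE[OF D(4)] hv by metis
  have iff: "edge (fst h v) c \<in> FE ?T' \<longleftrightarrow> c \<noteq> loc h v ?k" for c
  proof
    assume "edge (fst h v) c \<in> FE ?T'"
    then obtain e where e: "e \<in> FE ?T" "edge (fst h v) c = emap \<phi> e"
      using D(5) by (auto simp: bij_betw_def)
    then have "vmap \<phi> (org \<Gamma> e) = vmap \<phi> v" using D(6) hv by (metis edge_simps(1))
    then have "org \<Gamma> e = v" using D(4) vF FE_endpoints[OF e(1)] by (auto simp: bij_betw_def inj_on_def)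
    then obtain c' where c': "e = edge v c'" by (metis edge_org_col)
    then have "c' \<noteq> ?k"
      using e(1) leaf_nbr_iff[OF v] leaf_in[OF v] by (auto simp: forest_edges_eq[OF D(1)] spanned_edges_def)
    then have "emap \<phi> e = snd h e" using hon c' by (simp add: honest_at_def spanned_half)
    then have "c = loc h v c'" using e c' by (simp add: aut_edge[OF h])
    then show "c \<noteq> loc h v ?k" using \<open>c' \<noteq> ?k\<close> by (simp add: loc_inject[OF h])
  next
    assume c: "c \<noteq> loc h v ?k"
    obtain c' where c': "c = loc h v c'" using loc_bij[OF h] by (metis bij_is_surj surjD)
    then have e: "edge v c' \<in> spanned_edges \<Gamma> (half v ?k)" using c by (auto simp: spanned_half)
    then have "emap \<phi> (edge v c') = edge (fst h v) c" using hon c' by (simp add: honest_at_def aut_edge[OF h])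
    moreover have "edge v c' \<in> FE ?T" using half_subset_FE[OF D(1) v] e by blast
    ultimately show "edge (fst h v) c \<in> FE ?T'" using D(5) by (metis bij_betwE)
  qed
  then have "edge (fst h v) (loc h v ?k) \<notin> FE ?T'" by blast
  then have "fst h v \<in> ?T'" by (simp add: forest_edges_eq[OF D(2)] spanned_edges_def)
  then show l: "fst h v \<in> leaves \<Gamma> ?T'" using hF by (simp add: forest_verts_eq[OF D(2)])
  show "stem ?T' (fst h v) = loc h v ?k"
    using iff[of "stem ?T' (fst h v)"] leaf_nbr_iff[OF l] \<open>fst h v \<in> ?T'\<close>
    by (simp add: forest_edges_eq[OF D(2)] spanned_edges_def)
qed

lemma AA_leaves_onto:
  assumes \<phi>: "\<phi> \<in> AA H" and H: "H \<subseteq> Aut"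
  shows "vmap \<phi> ` leaves \<Gamma> (dom_tree \<phi>) = leaves \<Gamma> (cod_tree \<phi>)"
proof (rule card_subset_eq)
  note D = AA_D[OF \<phi>]
  show "finite (leaves \<Gamma> (cod_tree \<phi>))" using D(2) by (rule finite_leaves)
  show "vmap \<phi> ` leaves \<Gamma> (dom_tree \<phi>) \<subseteq> leaves \<Gamma> (cod_tree \<phi>)"
  proof
    fix y assume "y \<in> vmap \<phi> ` leaves \<Gamma> (dom_tree \<phi>)"
    then obtain v where v: "v \<in> leaves \<Gamma> (dom_tree \<phi>)" "y = vmap \<phi> v" by blast
    obtain h where h: "h \<in> H" "honest_at \<phi> h v (stem (dom_tree \<phi>) v)" using AA_honest_at[OF \<phi> v(1)] by blast
    then have "fst h v \<in> leaves \<Gamma> (cod_tree \<phi>)" using AA_leaf_image(1)[OF \<phi> v(1)] H by blast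
    then show "y \<in> leaves \<Gamma> (cod_tree \<phi>)" using v h by (simp add: honest_at_def)
  qed
  have "inj_on (vmap \<phi>) (leaves \<Gamma> (dom_tree \<phi>))"
    using D(4) leaf_in_FV by (auto simp: bij_betw_def intro: inj_on_subset)
  then show "card (vmap \<phi> ` leaves \<Gamma> (dom_tree \<phi>)) = card (leaves \<Gamma> (cod_tree \<phi>))"
    using D(3) by (simp add: card_image)
qed

lemma AA_finite_fibres:
  assumes \<phi>: "\<phi> \<in> AA H" shows "finite_fibres (vmap \<phi>)"
  unfolding finite_fibres_def
proof (intro allI impI)
  note D = AA_D[OF \<phi>]
  fix A :: "'v set" assume "finite A"
  then have "finite (vmap \<phi> -` A \<inter> FV (dom_tree \<phi>))"
    using D(4) by (intro finite_vimage_IntI) (auto simp: bij_betw_def)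
  \<comment> \<open>Outside the forest the vertex map is \<open>undefined\<close>, so a fibre may
    also contain vertices of the finite domain tree.\<close>
  then have "finite ((vmap \<phi> -` A \<inter> FV (dom_tree \<phi>)) \<union> dom_tree \<phi>)" using completeD(1)[OF D(1)] by simp
  then show "finite (vmap \<phi> -` A)"
    by (rule finite_subset[rotated]) (auto simp: forest_verts_eq[OF D(1)])
qed

section \<open>Equivalence of almost automorphisms\<close>

lemma FV_tree_ball: "x \<in> FV (tree_ball (Suc n)) \<Longrightarrow> x \<notin> tree_ball n"
  using forest_verts_eq[OF tree_ball_complete[of "Suc n"]] tree_ball_leaves[of "Suc n"]
  by (auto simp: tree_ball_def)

text \<open>An edge is determined by its endpoints, so the edge map follows from the vertex map; and
  every finite exceptional set is swallowed by a ball. From here on only vertex maps matter.\<close>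

lemma almost_equivalent_iff:
  assumes \<phi>: "\<phi> \<in> AA H" and \<psi>: "\<psi> \<in> AA H'"
  shows "almost_equivalent \<Gamma> \<phi> \<psi> \<longleftrightarrow> germ_eq (vmap \<phi>) (vmap \<psi>)"
proof
  assume "almost_equivalent \<Gamma> \<phi> \<psi>"
  then obtain T where T: "complete_subtree \<Gamma> T" "\<forall>x\<in>FV T. vmap \<phi> x = vmap \<psi> x"
    by (auto simp: almost_equivalent_def)
  show "germ_eq (vmap \<phi>) (vmap \<psi>)"
    by (rule germ_eqI[OF completeD(1)[OF T(1)]]) (use T in \<open>simp add: forest_verts_eq\<close>)
next
  assume g: "germ_eq (vmap \<phi>) (vmap \<psi>)"
  note D = AA_D[OF \<phi>] and E = AA_D[OF \<psi>]
  obtain n where n: "{x. vmap \<phi> x \<noteq> vmap \<psi> x} \<union> dom_tree \<phi> \<union> dom_tree \<psi> \<subseteq> tree_ball n"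
    using finite_subset_tree_ball[of "{x. vmap \<phi> x \<noteq> vmap \<psi> x} \<union> dom_tree \<phi> \<union> dom_tree \<psi>"]
      g completeD(1)[OF D(1)] completeD(1)[OF E(1)] by (auto simp: germ_eq_def)
  \<comment> \<open>The leaves of a ball belong to its forest; one more layer keeps them outside
    \<open>tree_ball n\<close>. It also makes the radius positive, as completeness requires.\<close>
  let ?T = "tree_ball (Suc n)"
  have T: "complete_subtree \<Gamma> ?T" by (rule tree_ball_complete) simp
  have sub: "dom_tree \<phi> \<union> dom_tree \<psi> \<subseteq> ?T" using n tree_ball_mono[of n "Suc n"] by auto
  have v: "vmap \<phi> x = vmap \<psi> x" if "x \<in> FV ?T" for x
    using FV_tree_ball[OF that] n by blast
  have "emap \<phi> e = emap \<psi> e" if e: "e \<in> FE ?T" for e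
  proof (rule edge_endpoints_eq)
    have "e \<in> FE (dom_tree \<phi>)" "e \<in> FE (dom_tree \<psi>)"
      using e sub by (auto simp: forest_edges_eq[OF T] forest_edges_eq[OF D(1)] forest_edges_eq[OF E(1)] spanned_edges_def)
    then show "org \<Gamma> (emap \<phi> e) = org \<Gamma> (emap \<psi> e)" "ter \<Gamma> (emap \<phi> e) = ter \<Gamma> (emap \<psi> e)"
      using v FE_endpoints[OF e] D(6,7) E(6,7) by simp_all
  qed
  then show "almost_equivalent \<Gamma> \<phi> \<psi>" unfolding almost_equivalent_def using T sub v by blast
qed

text \<open>Classes are indexed by arbitrary maps on vertices, so the group law becomes composition
  of functions. The set is nonempty exactly for germs of almost automorphisms, and it does not
  depend on the local action \<open>F\<close>.\<close>

definition cls :: "('v \<Rightarrow> 'v) \<Rightarrow> ('v, 'e) forest_map set" where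
  "cls f = {\<xi> \<in> AA Aut. germ_eq (vmap \<xi>) f}"

lemma almost_class_eq: 
  assumes "\<phi> \<in> AA Aut" shows "almost_class \<Gamma> \<phi> = cls (vmap \<phi>)"
  using almost_equivalent_iff[OF assms] germ_eq_sym by (auto simp: almost_class_def cls_def)

lemma cls_cong: "germ_eq f g \<Longrightarrow> cls f = cls g"
  unfolding cls_def using germ_eq_sym germ_eq_trans by blast

section \<open>Operations on almost automorphisms\<close>

lemma forest_comp_AA:
  assumes H: "aut_closed \<Gamma> H" and \<phi>: "\<phi> \<in> AA H" and \<psi>: "\<psi> \<in> AA H" and comp: "cod_tree \<psi> = dom_tree \<phi>"
  shows "forest_comp \<Gamma> \<phi> \<psi> \<in> AA H" "germ_eq (vmap (forest_comp \<Gamma> \<phi> \<psi>)) (vmap \<phi> \<circ> vmap \<psi>)"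
proof -
  note D = AA_D[OF \<phi>] and E = AA_D[OF \<psi>]
  have HA: "H \<subseteq> Aut" using H by (simp add: aut_closed_def)
  show "forest_comp \<Gamma> \<phi> \<psi> \<in> AA H"
  proof (rule AA_I)
    show "forest_isomorphism \<Gamma> (forest_comp \<Gamma> \<phi> \<psi>)"
      unfolding forest_isomorphism_def
    proof (intro conjI ballI)
      show "bij_betw (vmap (forest_comp \<Gamma> \<phi> \<psi>)) (FV (dom_tree (forest_comp \<Gamma> \<phi> \<psi>))) (FV (cod_tree (forest_comp \<Gamma> \<phi> \<psi>)))"
        using bij_betw_compose[OF E(4)] D(4) comp by (simp add: forest_comp_def)
      show "bij_betw (emap (forest_comp \<Gamma> \<phi> \<psi>)) (FE (dom_tree (forest_comp \<Gamma> \<phi> \<psi>))) (FE (cod_tree (forest_comp \<Gamma> \<phi> \<psi>)))"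
        using bij_betw_compose[OF E(5)] D(5) comp by (simp add: forest_comp_def)
      fix e assume "e \<in> FE (dom_tree (forest_comp \<Gamma> \<phi> \<psi>))"
      then have e: "e \<in> FE (dom_tree \<psi>)" by (simp add: forest_comp_def)
      then have e': "emap \<psi> e \<in> FE (dom_tree \<phi>)" using E(5) comp by (metis bij_betwE)
      show "org \<Gamma> (emap (forest_comp \<Gamma> \<phi> \<psi>) e) = vmap (forest_comp \<Gamma> \<phi> \<psi>) (org \<Gamma> e)"
        "ter \<Gamma> (emap (forest_comp \<Gamma> \<phi> \<psi>) e) = vmap (forest_comp \<Gamma> \<phi> \<psi>) (ter \<Gamma> e)"
        "opp \<Gamma> (emap (forest_comp \<Gamma> \<phi> \<psi>) e) = emap (forest_comp \<Gamma> \<phi> \<psi>) (opp \<Gamma> e)"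
        using FE_endpoints[OF e] D(6-8)[OF e'] E(6-8)[OF e] e by (simp_all add: forest_comp_def compose_eq)
    qed (simp_all add: forest_comp_def)
    fix v assume "v \<in> leaves \<Gamma> (dom_tree (forest_comp \<Gamma> \<phi> \<psi>))"
    then have v: "v \<in> leaves \<Gamma> (dom_tree \<psi>)" by (simp add: forest_comp_def)
    obtain h where h: "h \<in> H" "honest_at \<psi> h v (stem (dom_tree \<psi>) v)" using AA_honest_at[OF \<psi> v] by blast
    have hA: "h \<in> Aut" using h HA by blast
    note im = AA_leaf_image[OF \<psi> v hA h(2)]
    have v': "fst h v \<in> leaves \<Gamma> (dom_tree \<phi>)" using im comp by simp
    obtain h' where h': "h' \<in> H" "honest_at \<phi> h' (fst h v) (stem (dom_tree \<phi>) (fst h v))"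
      using AA_honest_at[OF \<phi> v'] by blast
    \<comment> \<open>\<open>h\<close> carries the branch at \<open>v\<close> onto the branch at the
      leaf \<open>fst h v\<close>, where the witness \<open>h'\<close> of the second map takes
      over.\<close>
    have half: "fst h ` half v (stem (dom_tree \<psi>) v) = half (fst h v) (stem (dom_tree \<phi>) (fst h v))"
      using aut_half[OF hA] im comp by simp
    then have sp: "snd h e \<in> spanned_edges \<Gamma> (half (fst h v) (stem (dom_tree \<phi>) (fst h v)))"
      if "e \<in> spanned_edges \<Gamma> (half v (stem (dom_tree \<psi>) v))" for e
      using that hA by (auto simp: spanned_edges_def automorphismsD)
    have "honest_at (forest_comp \<Gamma> \<phi> \<psi>) (pair_comp h' h) v (stem (dom_tree \<psi>) v)"
      unfolding honest_at_def
    proof (intro conjI ballI)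
      fix x assume x: "x \<in> half v (stem (dom_tree \<psi>) v)"
      then have "fst h x \<in> half (fst h v) (stem (dom_tree \<phi>) (fst h v))" using half by blast
      then show "vmap (forest_comp \<Gamma> \<phi> \<psi>) x = fst (pair_comp h' h) x"
        using h h' x half_subset_FV[OF E(1) v] by (auto simp: forest_comp_def compose_def honest_at_def)
    next
      fix e assume e: "e \<in> spanned_edges \<Gamma> (half v (stem (dom_tree \<psi>) v))"
      then show "emap (forest_comp \<Gamma> \<phi> \<psi>) e = snd (pair_comp h' h) e"
        using h h' sp[OF e] half_subset_FE[OF E(1) v] by (auto simp: forest_comp_def compose_def honest_at_def)
    qed
    moreover have "pair_comp h' h \<in> H" using H h h' by (simp add: aut_closed_def)
    ultimately show "\<exists>h\<in>H. honest_at (forest_comp \<Gamma> \<phi> \<psi>) h v (stem (dom_tree (forest_comp \<Gamma> \<phi> \<psi>)) v)"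
      by (auto simp: forest_comp_def)
  qed (use D E comp in \<open>simp_all add: forest_comp_def\<close>)
  show "germ_eq (vmap (forest_comp \<Gamma> \<phi> \<psi>)) (vmap \<phi> \<circ> vmap \<psi>)"
    by (rule germ_eqI[OF completeD(1)[OF E(1)]]) (simp add: forest_comp_def compose_def forest_verts_eq[OF E(1)])
qed

definition forest_inverse :: "('v, 'e) forest_map \<Rightarrow> ('v, 'e) forest_map" where
  "forest_inverse \<phi> =
     \<lparr>dom_tree = cod_tree \<phi>, cod_tree = dom_tree \<phi>,
      vmap = restrict (inv_into (FV (dom_tree \<phi>)) (vmap \<phi>)) (FV (cod_tree \<phi>)),
      emap = restrict (inv_into (FE (dom_tree \<phi>)) (emap \<phi>)) (FE (cod_tree \<phi>))\<rparr>"

lemma forest_inverse_AA: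
  assumes H: "aut_closed \<Gamma> H" and \<phi>: "\<phi> \<in> AA H"
  shows "forest_inverse \<phi> \<in> AA H"
    "germ_eq (vmap (forest_inverse \<phi>) \<circ> vmap \<phi>) id" "germ_eq (vmap \<phi> \<circ> vmap (forest_inverse \<phi>)) id"
proof -
  note D = AA_D[OF \<phi>]
  have HA: "H \<subseteq> Aut" using H by (simp add: aut_closed_def)
  let ?\<psi> = "forest_inverse \<phi>"
  have v1: "vmap ?\<psi> (vmap \<phi> x) = x" if "x \<in> FV (dom_tree \<phi>)" for x
    using that D(4) by (auto simp: forest_inverse_def bij_betw_def)
  have v2: "vmap \<phi> (vmap ?\<psi> y) = y" "vmap ?\<psi> y \<in> FV (dom_tree \<phi>)" if "y \<in> FV (cod_tree \<phi>)" for y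
    using that D(4) by (auto simp: forest_inverse_def bij_betw_def f_inv_into_f inv_into_into)
  have e1: "emap ?\<psi> (emap \<phi> x) = x" if "x \<in> FE (dom_tree \<phi>)" for x
    using that D(5) by (auto simp: forest_inverse_def bij_betw_def)
  have e2: "emap \<phi> (emap ?\<psi> y) = y" "emap ?\<psi> y \<in> FE (dom_tree \<phi>)" if "y \<in> FE (cod_tree \<phi>)" for y
    using that D(5) by (auto simp: forest_inverse_def bij_betw_def f_inv_into_f inv_into_into)
  show "?\<psi> \<in> AA H"
  proof (rule AA_I)
    show "forest_isomorphism \<Gamma> ?\<psi>"
      unfolding forest_isomorphism_def
    proof (intro conjI ballI)
      show "bij_betw (vmap ?\<psi>) (FV (dom_tree ?\<psi>)) (FV (cod_tree ?\<psi>))"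
        using bij_betw_inv_into[OF D(4)] by (simp add: forest_inverse_def)
      show "bij_betw (emap ?\<psi>) (FE (dom_tree ?\<psi>)) (FE (cod_tree ?\<psi>))"
        using bij_betw_inv_into[OF D(5)] by (simp add: forest_inverse_def)
      fix e assume "e \<in> FE (dom_tree ?\<psi>)"
      then have e: "e \<in> FE (cod_tree \<phi>)" by (simp add: forest_inverse_def)
      note e' = e2[OF e]
      note F = FE_endpoints[OF e'(2)]
      show "org \<Gamma> (emap ?\<psi> e) = vmap ?\<psi> (org \<Gamma> e)" using D(6)[OF e'(2)] v1 F e'(1) by metis
      show "ter \<Gamma> (emap ?\<psi> e) = vmap ?\<psi> (ter \<Gamma> e)" using D(7)[OF e'(2)] v1 F e'(1) by metis
      show "opp \<Gamma> (emap ?\<psi> e) = emap ?\<psi> (opp \<Gamma> e)" using D(8)[OF e'(2)] e1 F e'(1) by metis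
    qed (simp_all add: forest_inverse_def)
    fix w assume "w \<in> leaves \<Gamma> (dom_tree ?\<psi>)"
    then have w: "w \<in> leaves \<Gamma> (cod_tree \<phi>)" by (simp add: forest_inverse_def)
    then obtain v where v: "v \<in> leaves \<Gamma> (dom_tree \<phi>)" "w = vmap \<phi> v"
      using AA_leaves_onto[OF \<phi> HA] by blast
    obtain h where h: "h \<in> H" "honest_at \<phi> h v (stem (dom_tree \<phi>) v)" using AA_honest_at[OF \<phi> v(1)] by blast
    have hA: "h \<in> Aut" using h HA by blast
    note im = AA_leaf_image[OF \<phi> v(1) hA h(2)]
    have wh: "w = fst h v" using h v by (simp add: honest_at_def)
    let ?A = "half v (stem (dom_tree \<phi>) v)" and ?B = "half w (stem (cod_tree \<phi>) w)"
    have half: "fst h ` ?A = ?B" using aut_half[OF hA] im wh by simp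
    have "honest_at ?\<psi> (pair_inv h) w (stem (cod_tree \<phi>) w)"
      unfolding honest_at_def
    proof (intro conjI ballI)
      fix y assume "y \<in> ?B"
      then obtain x where x: "x \<in> ?A" "y = fst h x" using half by blast
      then have "y = vmap \<phi> x" using h by (simp add: honest_at_def)
      then show "vmap ?\<psi> y = fst (pair_inv h) y"
        using x(1) v1[of x] half_subset_FV[OF D(1) v(1)] aut_inv_apply(2)[OF hA, of x] x(2) by auto
    next
      fix e' assume e': "e' \<in> spanned_edges \<Gamma> ?B"
      define e where "e = finv (snd h) e'"
      have ee: "e' = snd h e" by (simp add: e_def aut_inv_apply[OF hA])
      have "e \<in> spanned_edges \<Gamma> ?A"
        using e' unfolding ee half[symmetric] by (auto simp: spanned_edges_def automorphismsD[OF hA] aut_inv_apply[OF hA])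
      then have "e' = emap \<phi> e" "e \<in> FE (dom_tree \<phi>)"
        using h ee half_subset_FE[OF D(1) v(1)] by (auto simp: honest_at_def)
      then have "emap ?\<psi> e' = e" using e1 by metis
      then show "emap ?\<psi> e' = snd (pair_inv h) e'" by (simp add: e_def)
    qed
    moreover have "pair_inv h \<in> H" using H h by (simp add: aut_closed_def)
    ultimately show "\<exists>h\<in>H. honest_at ?\<psi> h w (stem (dom_tree ?\<psi>) w)"
      by (auto simp: forest_inverse_def)
  qed (use D in \<open>simp_all add: forest_inverse_def\<close>)
  show "germ_eq (vmap ?\<psi> \<circ> vmap \<phi>) id"
    by (rule germ_eqI[OF completeD(1)[OF D(1)]]) (simp add: v1 forest_verts_eq[OF D(1)])
  show "germ_eq (vmap \<phi> \<circ> vmap ?\<psi>) id"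
    by (rule germ_eqI[OF completeD(1)[OF D(2)]]) (simp add: v2 forest_verts_eq[OF D(2)])
qed

text \<open>The same map on a smaller forest: the corresponding leaves of domain and codomain are
  expanded together.\<close>

definition forest_caret :: "('v, 'e) forest_map \<Rightarrow> 'v \<Rightarrow> ('v, 'e) forest_map" where
  "forest_caret \<phi> v =
     \<lparr>dom_tree = caret (dom_tree \<phi>) v, cod_tree = caret (cod_tree \<phi>) (vmap \<phi> v),
      vmap = restrict (vmap \<phi>) (FV (caret (dom_tree \<phi>) v)),
      emap = restrict (emap \<phi>) (FE (caret (dom_tree \<phi>) v))\<rparr>"

lemma FV_caret:
  assumes T: "complete_subtree \<Gamma> T" and v: "v \<in> leaves \<Gamma> T"
  shows "FV (caret T v) = FV T - {v}"
proof -
  have set_eq: "- (T \<union> R) \<union> (L - {v} \<union> N) = (- T \<union> L) - {v}"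
    if "R - N \<subseteq> T" "N \<inter> T = {}" "N \<subseteq> R" "L \<subseteq> T" "v \<in> L" for R N L
    using that by auto
  have "- (T \<union> range (nbr v)) \<union> (leaves \<Gamma> T - {v} \<union> {nbr v c | c. c \<noteq> stem T v}) =
      (- T \<union> leaves \<Gamma> T) - {v}"
    by (rule set_eq) (use leaf_nbr_iff[OF v] leaf_in v in blast)+
  then show ?thesis
    unfolding forest_verts_eq[OF T] forest_verts_eq[OF caret_complete[OF T v]] caret_leaves[OF T v]
    unfolding caret_def .
qed

lemma FE_caret:
  assumes T: "complete_subtree \<Gamma> T" and v: "v \<in> leaves \<Gamma> T"
  shows "FE (caret T v) = FE T - {e. org \<Gamma> e = v \<or> ter \<Gamma> e = v}"
proof -
  have "edge x c \<in> spanned_edges \<Gamma> (caret T v) \<longleftrightarrow>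
      edge x c \<in> spanned_edges \<Gamma> T \<or> x = v \<or> nbr x c = v" for x c
  proof -
    consider "x = v" | "x \<noteq> v" "x \<in> T" | "x \<notin> T" "x \<in> range (nbr v)" | "x \<notin> T" "x \<notin> range (nbr v)" by blast
    then show ?thesis
    proof cases
      case 2
      then show ?thesis using caret_nbr_old[OF T v 2(2) 2(1), of c] leaf_in[OF v]
        by (auto simp: spanned_edges_def caret_def)
    next
      case 3
      then obtain c' where c': "x = nbr v c'" by blast
      then have "c' \<noteq> stem T v" using 3 leaf_nbr_iff[OF v] by blast
      then have "nbr x c \<in> caret T v \<longleftrightarrow> c = c'" using caret_nbr_new[OF T v] c' by blast
      moreover have "nbr x c = v \<longleftrightarrow> c = c'" using c' by (metis nbr_inject nbr_nbr)
      moreover have "x \<noteq> v" using 3 leaf_in[OF v] by blast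
      ultimately show ?thesis using 3 by (auto simp: spanned_edges_def caret_def)
    next
      case 4
      then have "x \<noteq> v" "nbr x c \<noteq> v" using leaf_in[OF v] by (auto simp: nbr_eq_iff)
      then show ?thesis using 4 by (auto simp: spanned_edges_def caret_def)
    qed (use leaf_in[OF v] in \<open>auto simp: spanned_edges_def caret_def\<close>)
  qed
  then have "e \<in> spanned_edges \<Gamma> (caret T v) \<longleftrightarrow> e \<in> spanned_edges \<Gamma> T \<or> org \<Gamma> e = v \<or> ter \<Gamma> e = v" for e
    by (cases e rule: edge_cases) simp
  then show ?thesis
    unfolding forest_edges_eq[OF T] forest_edges_eq[OF caret_complete[OF T v]] by auto
qed

text \<open>The gain is \<open>CARD('c) - 2\<close> for every leaf, so simultaneous carets keep the
  numbers of leaves of domain and codomain equal.\<close>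

lemma card_leaves_caret:
  assumes T: "complete_subtree \<Gamma> T" and v: "v \<in> leaves \<Gamma> T"
  shows "card (leaves \<Gamma> (caret T v)) = (card (leaves \<Gamma> T) - 1) + (CARD('c) - 1)"
proof -
  have eq: "{nbr v c | c. c \<noteq> stem T v} = nbr v ` (UNIV - {stem T v})" by auto
  have "(leaves \<Gamma> T - {v}) \<inter> {nbr v c | c. c \<noteq> stem T v} = {}"
    using leaf_in leaf_nbr_iff[OF v] by blast
  moreover have "card {nbr v c | c. c \<noteq> stem T v} = CARD('c) - 1"
    unfolding eq by (subst card_image) (auto simp: inj_on_def card_Diff_singleton)
  ultimately show ?thesis
    unfolding caret_leaves[OF T v] using finite_leaves[OF T] v by (subst card_Un_disjoint) auto
qed

lemma forest_caret_AA:
  assumes HA: "H \<subseteq> Aut" and \<phi>: "\<phi> \<in> AA H" and v: "v \<in> leaves \<Gamma> (dom_tree \<phi>)"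
  shows "forest_caret \<phi> v \<in> AA H" "germ_eq (vmap (forest_caret \<phi> v)) (vmap \<phi>)"
proof -
  note D = AA_D[OF \<phi>]
  let ?\<psi> = "forest_caret \<phi> v" and ?T = "dom_tree \<phi>" and ?T' = "cod_tree \<phi>"
  have v': "vmap \<phi> v \<in> leaves \<Gamma> ?T'" using AA_leaves_onto[OF \<phi> HA] v by blast
  note C = caret_complete[OF D(1) v] caret_complete[OF D(2) v']
  have inj: "vmap \<phi> x = vmap \<phi> v \<longleftrightarrow> x = v" if "x \<in> FV ?T" for x
    using D(4) that leaf_in_FV[OF v] by (auto simp: bij_betw_def inj_on_def)
  have bv: "bij_betw (vmap \<phi>) (FV ?T - {v}) (FV ?T' - {vmap \<phi> v})"
    using D(4) leaf_in_FV[OF v] by (intro bij_betw_DiffI) (auto simp: bij_betw_def)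
  have be: "bij_betw (emap \<phi>) (FE (caret ?T v)) (FE (caret ?T' (vmap \<phi> v)))"
  proof -
    have "inj_on (emap \<phi>) (FE (caret ?T v))"
      using D(5) unfolding FE_caret[OF D(1) v] by (auto simp: bij_betw_def intro: inj_on_subset)
    moreover have "emap \<phi> ` FE (caret ?T v) = FE (caret ?T' (vmap \<phi> v))"
    proof (intro equalityI subsetI)
      fix e' assume "e' \<in> emap \<phi> ` FE (caret ?T v)"
      then obtain e where e: "e' = emap \<phi> e" "e \<in> FE ?T" "org \<Gamma> e \<noteq> v" "ter \<Gamma> e \<noteq> v"
        by (auto simp: FE_caret[OF D(1) v])
      then have "e' \<in> FE ?T'" using D(5) by (auto simp: bij_betw_def)
      then show "e' \<in> FE (caret ?T' (vmap \<phi> v))"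
        using e FE_endpoints[OF e(2)] inj by (simp add: FE_caret[OF D(2) v'] D(6,7))
    next
      fix e' assume e': "e' \<in> FE (caret ?T' (vmap \<phi> v))"
      then have "e' \<in> FE ?T'" by (simp add: FE_caret[OF D(2) v'])
      then obtain e where e: "e' = emap \<phi> e" "e \<in> FE ?T" using D(5) by (auto simp: bij_betw_def)
      then have "e \<in> FE (caret ?T v)"
        using e' FE_endpoints[OF e(2)] by (auto simp: FE_caret[OF D(1) v] FE_caret[OF D(2) v'] D(6,7))
      then show "e' \<in> emap \<phi> ` FE (caret ?T v)" using e by blast
    qed
    ultimately show ?thesis by (simp add: bij_betw_def)
  qed
  show "?\<psi> \<in> AA H"
  proof (rule AA_I)
    show "card (leaves \<Gamma> (dom_tree ?\<psi>)) = card (leaves \<Gamma> (cod_tree ?\<psi>))"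
      using D(3) by (simp add: forest_caret_def card_leaves_caret[OF D(1) v] card_leaves_caret[OF D(2) v'])
    show "forest_isomorphism \<Gamma> ?\<psi>"
      unfolding forest_isomorphism_def
    proof (intro conjI ballI)
      show "bij_betw (vmap ?\<psi>) (FV (dom_tree ?\<psi>)) (FV (cod_tree ?\<psi>))"
        using bv by (simp add: forest_caret_def FV_caret[OF D(1) v] FV_caret[OF D(2) v'])
      show "bij_betw (emap ?\<psi>) (FE (dom_tree ?\<psi>)) (FE (cod_tree ?\<psi>))"
        using be by (simp add: forest_caret_def)
      fix e assume "e \<in> FE (dom_tree ?\<psi>)"
      then have e: "e \<in> FE (caret ?T v)" by (simp add: forest_caret_def)
      then have "e \<in> FE ?T" by (simp add: FE_caret[OF D(1) v])
      then show "org \<Gamma> (emap ?\<psi> e) = vmap ?\<psi> (org \<Gamma> e)" "ter \<Gamma> (emap ?\<psi> e) = vmap ?\<psi> (ter \<Gamma> e)"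
          "opp \<Gamma> (emap ?\<psi> e) = emap ?\<psi> (opp \<Gamma> e)"
        using FE_endpoints[OF e] D(6-8)[of e] e by (simp_all add: forest_caret_def)
    qed (simp_all add: forest_caret_def)
    fix u assume "u \<in> leaves \<Gamma> (dom_tree ?\<psi>)"
    then have u: "u \<in> leaves \<Gamma> (caret ?T v)" by (simp add: forest_caret_def)
    \<comment> \<open>A new leaf inherits the witness of the old leaf whose half-tree contains its
      own.\<close>
    have "\<exists>w\<in>leaves \<Gamma> ?T. half u (stem (caret ?T v) u) \<subseteq> half w (stem ?T w)"
    proof (cases "u \<in> leaves \<Gamma> ?T - {v}")
      case True
      then show ?thesis using caret_stem(1)[OF D(1) v] by (intro bexI[of _ u]) auto
    next
      case False
      then obtain c where c: "u = nbr v c" "c \<noteq> stem ?T v" using u caret_leaves[OF D(1) v] by blast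
      then have "half u c \<subseteq> half v (stem ?T v)"
        using half_subset_half[of u v "stem ?T v"] toward_nbr[of v v "stem ?T v" c] word_nbr_half(2)[of v v "stem ?T v" c]
        by simp
      then show ?thesis using c v caret_stem(2)[OF D(1) v] by (intro bexI[of _ v]) auto
    qed
    then obtain w where w: "w \<in> leaves \<Gamma> ?T" "half u (stem (caret ?T v) u) \<subseteq> half w (stem ?T w)" by blast
    obtain h where h: "h \<in> H" "honest_at \<phi> h w (stem ?T w)" using AA_honest_at[OF \<phi> w(1)] by blast
    have "spanned_edges \<Gamma> (half u (stem (caret ?T v) u)) \<subseteq> spanned_edges \<Gamma> (half w (stem ?T w))"
      using w(2) by (auto simp: spanned_edges_def)
    then have "honest_at ?\<psi> h u (stem (caret ?T v) u)"
      using h(2) w(2) half_subset_FV[OF C(1) u] half_subset_FE[OF C(1) u]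
      by (auto simp: honest_at_def forest_caret_def subset_eq)
    then show "\<exists>h\<in>H. honest_at ?\<psi> h u (stem (dom_tree ?\<psi>) u)" using h(1) by (auto simp: forest_caret_def)
  qed (use C in \<open>simp_all add: forest_caret_def\<close>)
  show "germ_eq (vmap ?\<psi>) (vmap \<phi>)"
    by (rule germ_eqI[OF completeD(1)[OF C(1)]]) (simp add: forest_caret_def forest_verts_eq[OF C(1)])
qed

lemma AA_enlarge:
  assumes HA: "H \<subseteq> Aut" and \<phi>: "\<phi> \<in> AA H" and T: "complete_subtree \<Gamma> T" "dom_tree \<phi> \<subseteq> T"
  shows "\<exists>\<psi>\<in>AA H. dom_tree \<psi> = T \<and> germ_eq (vmap \<psi>) (vmap \<phi>)"
  using AA_D(1)[OF \<phi>] T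
proof (induction rule: caret_induct)
  case root
  then show ?case using \<phi> by (intro bexI[of _ \<phi>]) auto
next
  case (step T' v)
  then obtain \<psi> where \<psi>: "\<psi> \<in> AA H" "dom_tree \<psi> = T'" "germ_eq (vmap \<psi>) (vmap \<phi>)" by blast
  have "forest_caret \<psi> v \<in> AA H" "germ_eq (vmap (forest_caret \<psi> v)) (vmap \<psi>)"
    using forest_caret_AA[OF HA \<psi>(1), of v] step \<psi> by auto
  then have "germ_eq (vmap (forest_caret \<psi> v)) (vmap \<phi>)" "forest_caret \<psi> v \<in> AA H"
    using \<psi>(3) germ_eq_trans by blast+
  moreover have "dom_tree (forest_caret \<psi> v) = caret T' v" using \<psi>(2) by (simp add: forest_caret_def)
  ultimately show ?case by blast
qed

lemma forest_restriction_AA: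
  assumes HA: "H \<subseteq> Aut" and g: "g \<in> H" and T: "complete_subtree \<Gamma> T" "complete_subtree \<Gamma> (fst g ` T)"
  shows "forest_restriction \<Gamma> g T \<in> AA H" "germ_eq (vmap (forest_restriction \<Gamma> g T)) (fst g)"
proof -
  have gA: "g \<in> Aut" using g HA by blast
  let ?\<psi> = "forest_restriction \<Gamma> g T"
  have inj: "inj (fst g)" "inj (snd g)" using automorphismsD(1,2)[OF gA] by (auto simp: bij_def)
  have "fst g ` (- T) = - (fst g ` T)"
    using automorphismsD(1)[OF gA] by (simp add: bij_image_Compl_eq)
  then have FVi: "fst g ` FV T = FV (fst g ` T)"
    unfolding forest_verts_eq[OF T(1)] forest_verts_eq[OF T(2)] aut_image_leaves(1)[OF gA]
    by (simp add: image_Un)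
  have "snd g ` spanned_edges \<Gamma> T = spanned_edges \<Gamma> (fst g ` T)"
  proof (intro equalityI subsetI)
    fix e assume "e \<in> spanned_edges \<Gamma> (fst g ` T)"
    moreover obtain e' where e': "e = snd g e'" using aut_inv_apply(3)[OF gA] by metis
    ultimately have "e' \<in> spanned_edges \<Gamma> T"
      by (auto simp: spanned_edges_def automorphismsD[OF gA] aut_inv_apply[OF gA])
    then show "e \<in> snd g ` spanned_edges \<Gamma> T" using e' by blast
  qed (auto simp: spanned_edges_def automorphismsD[OF gA])
  then have FEi: "snd g ` FE T = FE (fst g ` T)"
    unfolding forest_edges_eq[OF T(1)] forest_edges_eq[OF T(2)]
    using automorphismsD(2)[OF gA] by (simp add: bij_image_Compl_eq)
  show "?\<psi> \<in> AA H"
  proof (rule AA_I)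
    show "card (leaves \<Gamma> (dom_tree ?\<psi>)) = card (leaves \<Gamma> (cod_tree ?\<psi>))"
      using inj(1) by (simp add: forest_restriction_def aut_image_leaves(1)[OF gA] card_image inj_on_subset)
    show "forest_isomorphism \<Gamma> ?\<psi>"
      unfolding forest_isomorphism_def
    proof (intro conjI ballI)
      show "bij_betw (vmap ?\<psi>) (FV (dom_tree ?\<psi>)) (FV (cod_tree ?\<psi>))"
        using inj(1) FVi by (auto simp: forest_restriction_def bij_betw_def intro: inj_on_subset)
      show "bij_betw (emap ?\<psi>) (FE (dom_tree ?\<psi>)) (FE (cod_tree ?\<psi>))"
        using inj(2) FEi by (auto simp: forest_restriction_def bij_betw_def intro: inj_on_subset)
      fix e assume "e \<in> FE (dom_tree ?\<psi>)"
      then have e: "e \<in> FE T" by (simp add: forest_restriction_def)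
      show "org \<Gamma> (emap ?\<psi> e) = vmap ?\<psi> (org \<Gamma> e)" "ter \<Gamma> (emap ?\<psi> e) = vmap ?\<psi> (ter \<Gamma> e)"
          "opp \<Gamma> (emap ?\<psi> e) = emap ?\<psi> (opp \<Gamma> e)"
        using FE_endpoints[OF e] e by (simp_all add: forest_restriction_def automorphismsD[OF gA])
    qed (simp_all add: forest_restriction_def)
    fix v assume "v \<in> leaves \<Gamma> (dom_tree ?\<psi>)"
    then have v: "v \<in> leaves \<Gamma> T" by (simp add: forest_restriction_def)
    have "honest_at ?\<psi> g v (stem T v)"
      using half_subset_FV[OF T(1) v] half_subset_FE[OF T(1) v]
      by (auto simp: honest_at_def forest_restriction_def)
    then show "\<exists>h\<in>H. honest_at ?\<psi> h v (stem (dom_tree ?\<psi>) v)" using g by (auto simp: forest_restriction_def)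
  qed (use T in \<open>simp_all add: forest_restriction_def\<close>)
  show "germ_eq (vmap ?\<psi>) (fst g)"
    by (rule germ_eqI[OF completeD(1)[OF T(1)]]) (simp add: forest_restriction_def forest_verts_eq[OF T(1)])
qed

text \<open>Complete subtrees contain the base vertex, so a ball is taken that also contains the
  preimage of the base vertex.\<close>

lemma restriction_exists:
  assumes g: "g \<in> Aut" shows "\<exists>T. complete_subtree \<Gamma> T \<and> complete_subtree \<Gamma> (fst g ` T)"
proof -
  obtain n where n: "n \<ge> 1" "{finv (fst g) (base \<Gamma>)} \<subseteq> tree_ball n"
    using finite_subset_large_ball[of "{finv (fst g) (base \<Gamma>)}" 0] by blast
  have "base \<Gamma> \<in> fst g ` tree_ball n"
    using n(2) aut_inv_apply(1)[OF g, of "base \<Gamma>"] by (metis imageI insert_subset)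
  then show ?thesis using aut_image_complete[OF g tree_ball_complete] tree_ball_complete n(1) by blast
qed

lemma class_of_automorphism_eq:
  assumes g: "g \<in> Aut" shows "class_of_automorphism \<Gamma> g = cls (fst g)"
proof -
  have *: "almost_class \<Gamma> (forest_restriction \<Gamma> g T) = cls (fst g)"
    if "complete_subtree \<Gamma> T" "complete_subtree \<Gamma> (fst g ` T)" for T
    using forest_restriction_AA[OF order_refl g that] almost_class_eq cls_cong by metis
  show ?thesis
    using restriction_exists[OF g] * unfolding class_of_automorphism_def by blast
qed

section \<open>The group of germs\<close>

text \<open>Says that \<open>f\<close>, up to a finite set, is the vertex map of an
  \<open>H\<close>-honest almost automorphism. The values of \<open>f\<close> on a finite set are
  arbitrary, so automorphisms and composites need not be truncated.\<close>

definition almost :: "(('v \<Rightarrow> 'v) \<times> ('e \<Rightarrow> 'e)) set \<Rightarrow> ('v \<Rightarrow> 'v) \<Rightarrow> bool" where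
  "almost H f \<longleftrightarrow> (\<exists>\<phi>\<in>AA H. germ_eq (vmap \<phi>) f)"

lemma almost_mono: "H \<subseteq> H' \<Longrightarrow> almost H f \<Longrightarrow> almost H' f"
  unfolding almost_def using AA_mono by blast

lemma almost_finite_fibres: "almost H f \<Longrightarrow> finite_fibres f"
  unfolding almost_def using AA_finite_fibres finite_fibres_germ_eq by blast

lemma cls_eq_iff: "almost Aut f \<Longrightarrow> cls f = cls g \<longleftrightarrow> germ_eq f g"
proof
  assume "almost Aut f" "cls f = cls g"
  then obtain \<phi> where "\<phi> \<in> AA Aut" "germ_eq (vmap \<phi>) f" "germ_eq (vmap \<phi>) g"
    by (auto simp: almost_def cls_def)
  then show "germ_eq f g" using germ_eq_sym germ_eq_trans by blast
qed (rule cls_cong)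

lemma almost_aut: "H \<subseteq> Aut \<Longrightarrow> g \<in> H \<Longrightarrow> almost H (fst g)"
proof -
  assume "H \<subseteq> Aut" "g \<in> H"
  then show ?thesis
    using restriction_exists[of g] forest_restriction_AA[of H g] unfolding almost_def by blast
qed

text \<open>With a large ball as domain tree, an automorphism that fixes the domain tree
  automatically lies in a prescribed ball fixator.\<close>

lemma almost_ball_representative:
  assumes H: "H \<subseteq> Aut" and f: "almost H f"
  shows "\<exists>N\<ge>n. \<exists>\<phi>\<in>AA H. dom_tree \<phi> = tree_ball N \<and> germ_eq (vmap \<phi>) f"
proof -
  obtain \<psi> where \<psi>: "\<psi> \<in> AA H" "germ_eq (vmap \<psi>) f" using f by (auto simp: almost_def)
  obtain N where N: "N \<ge> n" "N \<ge> 1" "dom_tree \<psi> \<subseteq> tree_ball N"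
    using finite_subset_large_ball[OF completeD(1)[OF AA_D(1)[OF \<psi>(1)]], of n] by blast
  obtain \<phi> where "\<phi> \<in> AA H" "dom_tree \<phi> = tree_ball N" "germ_eq (vmap \<phi>) (vmap \<psi>)"
    using AA_enlarge[OF H \<psi>(1) tree_ball_complete[OF N(2)] N(3)] by blast
  then show ?thesis using N(1) \<psi>(2) germ_eq_trans by blast
qed

text \<open>Enlarging controls only the domain tree. To prescribe the codomain tree of the inner
  map, its inverse is enlarged to a common ball and inverted back.\<close>

lemma composable_representatives:
  assumes H: "aut_closed \<Gamma> H" and f: "almost H f" and g: "almost H g"
  obtains \<phi> \<psi> where "\<phi> \<in> AA H" "\<psi> \<in> AA H" "germ_eq (vmap \<phi>) f" "germ_eq (vmap \<psi>) g" "cod_tree \<psi> = dom_tree \<phi>"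
proof -
  have HA: "H \<subseteq> Aut" using H by (simp add: aut_closed_def)
  obtain \<phi> where \<phi>: "\<phi> \<in> AA H" "germ_eq (vmap \<phi>) f" using f by (auto simp: almost_def)
  obtain \<psi> where \<psi>: "\<psi> \<in> AA H" "germ_eq (vmap \<psi>) g" using g by (auto simp: almost_def)
  note inv = forest_inverse_AA[OF H \<psi>(1)]
  obtain n where n: "n \<ge> 1" "dom_tree \<phi> \<union> dom_tree (forest_inverse \<psi>) \<subseteq> tree_ball n"
    using finite_subset_large_ball[of "dom_tree \<phi> \<union> dom_tree (forest_inverse \<psi>)" 0]
      completeD(1)[OF AA_D(1)[OF \<phi>(1)]] completeD(1)[OF AA_D(1)[OF inv(1)]] by auto
  obtain \<phi>' where \<phi>': "\<phi>' \<in> AA H" "dom_tree \<phi>' = tree_ball n" "germ_eq (vmap \<phi>') (vmap \<phi>)"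
    using AA_enlarge[OF HA \<phi>(1) tree_ball_complete[OF n(1)]] n(2) by auto
  obtain \<xi> where \<xi>: "\<xi> \<in> AA H" "dom_tree \<xi> = tree_ball n" "germ_eq (vmap \<xi>) (vmap (forest_inverse \<psi>))"
    using AA_enlarge[OF HA inv(1) tree_ball_complete[OF n(1)]] n(2) by auto
  note inv' = forest_inverse_AA[OF H \<xi>(1)]
  have ff: "finite_fibres (vmap \<psi>)" using AA_finite_fibres \<psi>(1) by blast
  \<comment> \<open>The inverse of the enlarged inverse has the germ of \<open>\<psi>\<close>:
    insert \<open>\<psi>\<close> with its inverse, replace that inverse by \<open>\<xi>\<close>, and
    cancel.\<close>
  have "germ_eq (vmap (forest_inverse \<xi>)) (vmap (forest_inverse \<xi>) \<circ> (vmap (forest_inverse \<psi>) \<circ> vmap \<psi>))"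
    using germ_eq_comp[OF germ_eq_refl[of "vmap (forest_inverse \<xi>)"] germ_eq_sym[OF inv(2)]]
    by (simp add: finite_fibres_def)
  also have "germ_eq \<dots> (vmap (forest_inverse \<xi>) \<circ> (vmap \<xi> \<circ> vmap \<psi>))"
  proof (rule germ_eq_comp[OF germ_eq_refl])
    show "germ_eq (vmap (forest_inverse \<psi>) \<circ> vmap \<psi>) (vmap \<xi> \<circ> vmap \<psi>)"
      using germ_eq_comp[OF germ_eq_sym[OF \<xi>(3)] germ_eq_refl ff] .
    show "finite_fibres (vmap (forest_inverse \<psi>) \<circ> vmap \<psi>)"
      using finite_fibres_germ_eq[OF _ germ_eq_sym[OF inv(2)]] by (simp add: finite_fibres_def)
  qed
  also have "germ_eq \<dots> (vmap \<psi>)"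
    using germ_eq_comp[OF inv'(2) germ_eq_refl ff] by (simp add: o_assoc)
  also have "germ_eq \<dots> g" by fact
  finally have "germ_eq (vmap (forest_inverse \<xi>)) g" .
  moreover have "cod_tree (forest_inverse \<xi>) = dom_tree \<phi>'" using \<xi> \<phi>' by (simp add: forest_inverse_def)
  ultimately show thesis using that[OF \<phi>'(1) inv'(1)] germ_eq_trans[OF \<phi>'(3) \<phi>(2)] by blast
qed

lemma almost_comp:
  assumes H: "aut_closed \<Gamma> H" and f: "almost H f" and g: "almost H g"
  shows "almost H (f \<circ> g)"
proof -
  obtain \<phi> \<psi> where *: "\<phi> \<in> AA H" "\<psi> \<in> AA H" "germ_eq (vmap \<phi>) f" "germ_eq (vmap \<psi>) g" "cod_tree \<psi> = dom_tree \<phi>"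
    by (rule composable_representatives[OF H f g])
  note fc = forest_comp_AA[OF H *(1,2,5)]
  have "germ_eq (vmap \<phi> \<circ> vmap \<psi>) (f \<circ> g)" using germ_eq_comp[OF *(3,4) AA_finite_fibres[OF *(2)]] .
  then show ?thesis unfolding almost_def using fc germ_eq_trans by blast
qed

lemma class_mult_cls:
  assumes f: "almost Aut f" and g: "almost Aut g"
  shows "class_mult \<Gamma> (cls f) (cls g) = cls (f \<circ> g)"
proof -
  note H = aut_closed_automorphisms[of \<Gamma>]
  have *: "almost_class \<Gamma> (forest_comp \<Gamma> \<phi> \<psi>) = cls (f \<circ> g)"
    if "\<phi> \<in> cls f" "\<psi> \<in> cls g" "cod_tree \<psi> = dom_tree \<phi>" for \<phi> \<psi>
  proof -
    have a: "\<phi> \<in> AA Aut" "\<psi> \<in> AA Aut" "germ_eq (vmap \<phi>) f" "germ_eq (vmap \<psi>) g"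
      using that by (auto simp: cls_def)
    note fc = forest_comp_AA[OF H a(1,2) that(3)]
    have "germ_eq (vmap \<phi> \<circ> vmap \<psi>) (f \<circ> g)" using germ_eq_comp[OF a(3,4) AA_finite_fibres[OF a(2)]] .
    then show ?thesis using almost_class_eq[OF fc(1)] cls_cong germ_eq_trans[OF fc(2)] by simp
  qed
  obtain \<phi> \<psi> where "\<phi> \<in> AA Aut" "\<psi> \<in> AA Aut" "germ_eq (vmap \<phi>) f" "germ_eq (vmap \<psi>) g" "cod_tree \<psi> = dom_tree \<phi>"
    by (rule composable_representatives[OF H f g])
  then have ex: "\<exists>\<phi> \<psi>. \<phi> \<in> cls f \<and> \<psi> \<in> cls g \<and> cod_tree \<psi> = dom_tree \<phi>" by (auto simp: cls_def)
  have "{almost_class \<Gamma> (forest_comp \<Gamma> \<phi> \<psi>) |\<phi> \<psi>. \<phi> \<in> cls f \<and> \<psi> \<in> cls g \<and> cod_tree \<psi> = dom_tree \<phi>} = {cls (f \<circ> g)}"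
    using * ex by blast
  then show ?thesis unfolding class_mult_def by simp
qed

lemma almost_inverse:
  assumes H: "aut_closed \<Gamma> H" and f: "almost H f"
  obtains g where "almost H g" "germ_eq (g \<circ> f) id" "germ_eq (f \<circ> g) id"
proof -
  obtain \<phi> where \<phi>: "\<phi> \<in> AA H" "germ_eq (vmap \<phi>) f" using f by (auto simp: almost_def)
  note inv = forest_inverse_AA[OF H \<phi>(1)]
  let ?g = "vmap (forest_inverse \<phi>)"
  have "almost H ?g" using inv(1) unfolding almost_def by (intro bexI[of _ "forest_inverse \<phi>"]) auto
  moreover have "germ_eq (?g \<circ> f) id"
    using germ_eq_trans[OF germ_eq_comp[OF germ_eq_refl germ_eq_sym[OF \<phi>(2)] almost_finite_fibres[OF f]] inv(2)] .
  moreover have "germ_eq (f \<circ> ?g) id"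
    using germ_eq_trans[OF germ_eq_comp[OF germ_eq_sym[OF \<phi>(2)] germ_eq_refl AA_finite_fibres[OF inv(1)]] inv(3)] .
  ultimately show thesis by (rule that)
qed

end

lemma mem_l_coset_iff: "y \<in> a <#\<^bsub>G\<^esub> H \<longleftrightarrow> (\<exists>h\<in>H. y = a \<otimes>\<^bsub>G\<^esub> h)"
  by (auto simp: l_coset_def)

lemma mem_r_coset_iff: "y \<in> H #>\<^bsub>G\<^esub> a \<longleftrightarrow> (\<exists>h\<in>H. y = h \<otimes>\<^bsub>G\<^esub> a)"
  by (auto simp: r_coset_def)

section \<open>Group topologies defined by a filtration\<close>

text \<open>An explicit candidate for the topology that \<open>group_topology_via\<close> only
  describes by its properties. The sets \<open>B n\<close> become a basis of open subgroups at the
  unit.\<close>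

definition coset_topology :: "('g, 'm) monoid_scheme \<Rightarrow> (nat \<Rightarrow> 'g set) \<Rightarrow> 'g topology" where
  "coset_topology G B = topology (\<lambda>W. W \<subseteq> carrier G \<and> (\<forall>w\<in>W. \<exists>n. w <#\<^bsub>G\<^esub> B n \<subseteq> W))"

text \<open>\<open>B_conj\<close> says that conjugation is continuous at the unit; it is what makes
  left cosets of the \<open>B n\<close> define a group topology.\<close>

locale filtered_group = group G for G :: "('g, 'm) monoid_scheme" (structure) +
  fixes B :: "nat \<Rightarrow> 'g set"
  assumes B_subgroup: "subgroup (B n) G"
    and B_antimono: "m \<le> n \<Longrightarrow> B n \<subseteq> B m"
    and B_conj: "g \<in> carrier G \<Longrightarrow> \<exists>m. \<forall>b\<in>B m. inv g \<otimes> b \<otimes> g \<in> B n"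
begin

lemma B_carrier: "b \<in> B n \<Longrightarrow> b \<in> carrier G"
  using B_subgroup subgroup.subset by blast

lemma openin_coset_topology:
  "openin (coset_topology G B) W \<longleftrightarrow> W \<subseteq> carrier G \<and> (\<forall>w\<in>W. \<exists>n. w <#\<^bsub>G\<^esub> B n \<subseteq> W)"
proof -
  have "istopology (\<lambda>W. W \<subseteq> carrier G \<and> (\<forall>w\<in>W. \<exists>n. w <#\<^bsub>G\<^esub> B n \<subseteq> W))"
    unfolding istopology_def
  proof (intro conjI allI impI ballI)
    fix S T w assume S: "S \<subseteq> carrier G \<and> (\<forall>w\<in>S. \<exists>n. w <#\<^bsub>G\<^esub> B n \<subseteq> S)"
      and T: "T \<subseteq> carrier G \<and> (\<forall>w\<in>T. \<exists>n. w <#\<^bsub>G\<^esub> B n \<subseteq> T)" and w: "w \<in> S \<inter> T"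
    obtain m n where "w <#\<^bsub>G\<^esub> B m \<subseteq> S" "w <#\<^bsub>G\<^esub> B n \<subseteq> T" using S T w by blast
    moreover have "w <#\<^bsub>G\<^esub> B (max m n) \<subseteq> w <#\<^bsub>G\<^esub> B m" "w <#\<^bsub>G\<^esub> B (max m n) \<subseteq> w <#\<^bsub>G\<^esub> B n"
      using B_antimono[of m "max m n"] B_antimono[of n "max m n"] by (auto simp: l_coset_def)
    ultimately show "\<exists>n. w <#\<^bsub>G\<^esub> B n \<subseteq> S \<inter> T" by blast
  next
    fix K w assume K: "\<forall>S\<in>K. S \<subseteq> carrier G \<and> (\<forall>w\<in>S. \<exists>n. w <#\<^bsub>G\<^esub> B n \<subseteq> S)" and "w \<in> \<Union>K"
    then obtain S where S: "S \<in> K" "w \<in> S" by blast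
    then obtain n where "w <#\<^bsub>G\<^esub> B n \<subseteq> S" using K by blast
    then show "\<exists>n. w <#\<^bsub>G\<^esub> B n \<subseteq> \<Union>K" using S(1) by (intro exI[of _ n]) blast
  next
    fix S T assume "S \<subseteq> carrier G \<and> (\<forall>w\<in>S. \<exists>n. w <#\<^bsub>G\<^esub> B n \<subseteq> S)"
    then show "S \<inter> T \<subseteq> carrier G" by (meson inf.coboundedI1)
  next
    fix K assume "\<forall>S\<in>K. S \<subseteq> carrier G \<and> (\<forall>w\<in>S. \<exists>n. w <#\<^bsub>G\<^esub> B n \<subseteq> S)"
    then show "\<Union>K \<subseteq> carrier G" by (meson Union_least)
  qed
  then show ?thesis by (simp add: coset_topology_def)
qed

lemma l_coset_B_mem: "g \<in> carrier G \<Longrightarrow> g \<in> g <#\<^bsub>G\<^esub> B n"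
  using subgroup.one_closed[OF B_subgroup] by (auto simp: mem_l_coset_iff intro: bexI[of _ \<one>])

lemma openin_l_coset: assumes "g \<in> carrier G" shows "openin (coset_topology G B) (g <#\<^bsub>G\<^esub> B n)"
  unfolding openin_coset_topology
proof (intro conjI ballI)
  show "g <#\<^bsub>G\<^esub> B n \<subseteq> carrier G" using assms B_carrier by (auto simp: mem_l_coset_iff)
  fix w assume "w \<in> g <#\<^bsub>G\<^esub> B n"
  then obtain b where b: "b \<in> B n" "w = g \<otimes> b" by (auto simp: mem_l_coset_iff)
  have "w <#\<^bsub>G\<^esub> B n \<subseteq> g <#\<^bsub>G\<^esub> B n"
  proof
    fix y assume "y \<in> w <#\<^bsub>G\<^esub> B n"
    then obtain b' where "b' \<in> B n" "y = w \<otimes> b'" by (auto simp: mem_l_coset_iff)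
    then show "y \<in> g <#\<^bsub>G\<^esub> B n"
      using b assms B_carrier subgroup.m_closed[OF B_subgroup] by (auto simp: mem_l_coset_iff m_assoc)
  qed
  then show "\<exists>m. w <#\<^bsub>G\<^esub> B m \<subseteq> g <#\<^bsub>G\<^esub> B n" by blast
qed

lemma openin_B: "openin (coset_topology G B) (B n)"
proof -
  have "\<one> <#\<^bsub>G\<^esub> B n = B n" using B_carrier by (auto simp: mem_l_coset_iff)
  then show ?thesis using openin_l_coset[OF one_closed, of n] by simp
qed

lemma topspace_coset_topology: "topspace (coset_topology G B) = carrier G"
proof
  show "topspace (coset_topology G B) \<subseteq> carrier G"
    using openin_topspace[of "coset_topology G B"] unfolding openin_coset_topology by blast
  have "openin (coset_topology G B) (carrier G)"
    unfolding openin_coset_topology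
    using l_coset_subset_G[OF subgroup.subset[OF B_subgroup]] by blast
  then show "carrier G \<subseteq> topspace (coset_topology G B)" by (rule openin_subset)
qed

lemma topological_group_coset_topology: "topological_group G (coset_topology G B)"
  unfolding topological_group_def
proof (intro conjI)
  let ?\<tau> = "coset_topology G B"
  show "group G" by (rule group_axioms)
  show "topspace ?\<tau> = carrier G" by (rule topspace_coset_topology)
  show "continuous_map (prod_topology ?\<tau> ?\<tau>) ?\<tau> (\<lambda>(x, y). x \<otimes> y)"
    unfolding continuous_map
  proof (intro conjI allI impI)
    fix W assume W: "openin ?\<tau> W"
    show "openin (prod_topology ?\<tau> ?\<tau>) {z \<in> topspace (prod_topology ?\<tau> ?\<tau>). (case z of (x, y) \<Rightarrow> x \<otimes> y) \<in> W}"
      unfolding openin_prod_topology_alt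
    proof (intro allI impI)
      fix x y assume "(x, y) \<in> {z \<in> topspace (prod_topology ?\<tau> ?\<tau>). (case z of (x, y) \<Rightarrow> x \<otimes> y) \<in> W}"
      then have xy: "x \<in> carrier G" "y \<in> carrier G" "x \<otimes> y \<in> W" by (auto simp: topspace_coset_topology)
      obtain n where n: "(x \<otimes> y) <#\<^bsub>G\<^esub> B n \<subseteq> W" using W xy unfolding openin_coset_topology by blast
      \<comment> \<open>The factor \<open>a\<close> has to be moved past \<open>y\<close>:
        \<open>x a y b\<close> is \<open>x y\<close> times the conjugate of \<open>a\<close> by
        \<open>y\<close> times \<open>b\<close>. Hence \<open>m\<close> depends on
        \<open>y\<close>.\<close>
      obtain m where m: "\<And>b. b \<in> B m \<Longrightarrow> inv y \<otimes> b \<otimes> y \<in> B n" using B_conj[OF xy(2)] by blast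
      have "u \<otimes> v \<in> W" if uv: "u \<in> x <#\<^bsub>G\<^esub> B m" "v \<in> y <#\<^bsub>G\<^esub> B n" for u v
      proof -
        obtain a b where ab: "a \<in> B m" "b \<in> B n" "u = x \<otimes> a" "v = y \<otimes> b"
          using uv by (auto simp: mem_l_coset_iff)
        have c: "a \<in> carrier G" "b \<in> carrier G" using ab B_carrier by auto
        have "u \<otimes> v = (x \<otimes> y) \<otimes> ((inv y \<otimes> a \<otimes> y) \<otimes> b)"
          using ab(3,4) c xy(1,2) by (simp add: m_assoc inv_solve_left' ) (simp add: m_assoc[symmetric])
        moreover have "(inv y \<otimes> a \<otimes> y) \<otimes> b \<in> B n" using m ab subgroup.m_closed[OF B_subgroup] by blast
        ultimately have "u \<otimes> v \<in> (x \<otimes> y) <#\<^bsub>G\<^esub> B n" unfolding mem_l_coset_iff by blast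
        then show ?thesis using n by blast
      qed
      moreover have "x <#\<^bsub>G\<^esub> B m \<subseteq> carrier G" "y <#\<^bsub>G\<^esub> B n \<subseteq> carrier G"
        using xy B_carrier by (auto simp: mem_l_coset_iff)
      ultimately have "(x <#\<^bsub>G\<^esub> B m) \<times> (y <#\<^bsub>G\<^esub> B n) \<subseteq> {z \<in> topspace (prod_topology ?\<tau> ?\<tau>). (case z of (x, y) \<Rightarrow> x \<otimes> y) \<in> W}"
        by (auto simp: topspace_coset_topology)
      then show "\<exists>U V. openin ?\<tau> U \<and> openin ?\<tau> V \<and> x \<in> U \<and> y \<in> V \<and>
           U \<times> V \<subseteq> {z \<in> topspace (prod_topology ?\<tau> ?\<tau>). (case z of (x, y) \<Rightarrow> x \<otimes> y) \<in> W}"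
        using openin_l_coset[OF xy(1), of m] openin_l_coset[OF xy(2), of n]
          l_coset_B_mem[OF xy(1), of m] l_coset_B_mem[OF xy(2), of n]
        by (intro exI[of _ "x <#\<^bsub>G\<^esub> B m"] exI[of _ "y <#\<^bsub>G\<^esub> B n"] conjI)
    qed
  qed (auto simp: topspace_coset_topology)
  show "continuous_map ?\<tau> ?\<tau> (\<lambda>x. inv x)"
    unfolding continuous_map
  proof (intro conjI allI impI)
    fix W assume W: "openin ?\<tau> W"
    show "openin ?\<tau> {x \<in> topspace ?\<tau>. inv x \<in> W}"
      unfolding openin_coset_topology topspace_coset_topology
    proof (intro conjI ballI)
      fix x assume "x \<in> {x \<in> carrier G. inv x \<in> W}"
      then have x: "x \<in> carrier G" "inv x \<in> W" by auto
      obtain n where n: "inv x <#\<^bsub>G\<^esub> B n \<subseteq> W" using W x unfolding openin_coset_topology by blast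
      have "\<exists>m. \<forall>b\<in>B m. x \<otimes> b \<otimes> inv x \<in> B n" using B_conj[of "inv x" n] x by simp
      then obtain m where m: "\<And>b. b \<in> B m \<Longrightarrow> x \<otimes> b \<otimes> inv x \<in> B n" by blast
      have "inv (x \<otimes> b) \<in> W" if b: "b \<in> B m" for b
      proof -
        have bc: "b \<in> carrier G" using b B_carrier by blast
        have "inv b \<in> B m" using b subgroup.m_inv_closed[OF B_subgroup] by blast
        then have "x \<otimes> inv b \<otimes> inv x \<in> B n" by (rule m)
        moreover have "inv (x \<otimes> b) = inv x \<otimes> (x \<otimes> inv b \<otimes> inv x)"
          using x bc by (simp add: inv_mult_group m_assoc[symmetric])
        ultimately have "inv (x \<otimes> b) \<in> inv x <#\<^bsub>G\<^esub> B n" unfolding mem_l_coset_iff by blast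
        then show ?thesis using n by blast
      qed
      then show "\<exists>n. x <#\<^bsub>G\<^esub> B n \<subseteq> {x \<in> carrier G. inv x \<in> W}"
        using x B_carrier by (intro exI[of _ m]) (auto simp: mem_l_coset_iff)
    qed blast
  qed (auto simp: topspace_coset_topology)
qed

lemma Hausdorff_coset_topology:
  assumes "\<And>g. (\<And>n. g \<in> B n) \<Longrightarrow> g = \<one>"
  shows "Hausdorff_space (coset_topology G B)"
  unfolding Hausdorff_space_def topspace_coset_topology
proof (intro allI impI)
  fix x y assume xy: "x \<in> carrier G \<and> y \<in> carrier G \<and> x \<noteq> y"
  have "inv x \<otimes> y \<noteq> \<one>" using xy by (metis inv_comm inv_equality inv_inv inv_closed)
  then obtain n where n: "inv x \<otimes> y \<notin> B n" using assms by blast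
  have "(x <#\<^bsub>G\<^esub> B n) \<inter> (y <#\<^bsub>G\<^esub> B n) = {}"
  proof (rule ccontr)
    assume "(x <#\<^bsub>G\<^esub> B n) \<inter> (y <#\<^bsub>G\<^esub> B n) \<noteq> {}"
    then obtain a b where ab: "a \<in> B n" "b \<in> B n" "x \<otimes> a = y \<otimes> b" by (auto simp: mem_l_coset_iff)
    have c: "a \<in> carrier G" "b \<in> carrier G" using ab B_carrier by auto
    have "inv x \<otimes> y = a \<otimes> inv b"
      using ab(3) c xy by (metis inv_closed inv_solve_left inv_solve_right m_assoc m_closed)
    then show False
      using n ab subgroup.m_closed[OF B_subgroup] subgroup.m_inv_closed[OF B_subgroup] by metis
  qed
  then show "\<exists>U V. openin (coset_topology G B) U \<and> openin (coset_topology G B) V \<and> x \<in> U \<and> y \<in> V \<and> disjnt U V"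
    using xy openin_l_coset[of _ n] l_coset_B_mem[of _ n] unfolding disjnt_def
    by (intro exI[of _ "x <#\<^bsub>G\<^esub> B n"] exI[of _ "y <#\<^bsub>G\<^esub> B n"] conjI) simp_all
qed

end

section \<open>Topological groups\<close>

lemma topological_groupD:
  assumes "topological_group G \<tau>"
  shows "group G" "topspace \<tau> = carrier G"
    "continuous_map (prod_topology \<tau> \<tau>) \<tau> (\<lambda>(x, y). x \<otimes>\<^bsub>G\<^esub> y)"
    "continuous_map \<tau> \<tau> (\<lambda>x. inv\<^bsub>G\<^esub> x)"
  using assms by (auto simp: topological_group_def)

lemma continuous_translation:
  assumes G: "topological_group G \<tau>" and g: "g \<in> carrier G"
  shows "continuous_map \<tau> \<tau> (\<lambda>x. g \<otimes>\<^bsub>G\<^esub> x)" "continuous_map \<tau> \<tau> (\<lambda>x. x \<otimes>\<^bsub>G\<^esub> g)"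
proof -
  note D = topological_groupD[OF G]
  have "continuous_map \<tau> (prod_topology \<tau> \<tau>) (\<lambda>x. (g, x))" "continuous_map \<tau> (prod_topology \<tau> \<tau>) (\<lambda>x. (x, g))"
    using g D(2) by (auto intro!: continuous_map_pairedI)
  from this[THEN continuous_map_compose[OF _ D(3)]]
  show "continuous_map \<tau> \<tau> (\<lambda>x. g \<otimes>\<^bsub>G\<^esub> x)" "continuous_map \<tau> \<tau> (\<lambda>x. x \<otimes>\<^bsub>G\<^esub> g)"
    by (simp_all add: o_def)
qed

lemma openin_translation:
  assumes G: "topological_group G \<tau>" and g: "g \<in> carrier G" and W: "openin \<tau> W"
  shows "openin \<tau> (g <#\<^bsub>G\<^esub> W)" "openin \<tau> (W #>\<^bsub>G\<^esub> g)"
proof -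
  note D = topological_groupD[OF G]
  interpret group G by (rule D(1))
  have sub: "W \<subseteq> carrier G" using openin_subset[OF W] D(2) by simp
  have ig: "inv\<^bsub>G\<^esub> g \<in> carrier G" using g by simp
  have "g <#\<^bsub>G\<^esub> W = {x \<in> topspace \<tau>. inv\<^bsub>G\<^esub> g \<otimes>\<^bsub>G\<^esub> x \<in> W}"
  proof (intro equalityI subsetI)
    fix y assume "y \<in> {x \<in> topspace \<tau>. inv\<^bsub>G\<^esub> g \<otimes>\<^bsub>G\<^esub> x \<in> W}"
    then have "inv\<^bsub>G\<^esub> g \<otimes>\<^bsub>G\<^esub> y \<in> W" "y = g \<otimes>\<^bsub>G\<^esub> (inv\<^bsub>G\<^esub> g \<otimes>\<^bsub>G\<^esub> y)"
      using g D(2) by (auto simp: m_assoc[symmetric])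
    then show "y \<in> g <#\<^bsub>G\<^esub> W" unfolding mem_l_coset_iff by blast
  qed (use sub g D(2) in \<open>auto simp: mem_l_coset_iff m_assoc[symmetric] subset_eq\<close>)
  then show "openin \<tau> (g <#\<^bsub>G\<^esub> W)"
    using openin_continuous_map_preimage[OF continuous_translation(1)[OF G ig] W] by simp
  have "W #>\<^bsub>G\<^esub> g = {x \<in> topspace \<tau>. x \<otimes>\<^bsub>G\<^esub> inv\<^bsub>G\<^esub> g \<in> W}"
  proof (intro equalityI subsetI)
    fix y assume "y \<in> {x \<in> topspace \<tau>. x \<otimes>\<^bsub>G\<^esub> inv\<^bsub>G\<^esub> g \<in> W}"
    then have "y \<otimes>\<^bsub>G\<^esub> inv\<^bsub>G\<^esub> g \<in> W" "y = (y \<otimes>\<^bsub>G\<^esub> inv\<^bsub>G\<^esub> g) \<otimes>\<^bsub>G\<^esub> g"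
      using g D(2) by (auto simp: m_assoc)
    then show "y \<in> W #>\<^bsub>G\<^esub> g" unfolding mem_r_coset_iff by blast
  qed (use sub g D(2) in \<open>auto simp: mem_r_coset_iff m_assoc subset_eq\<close>)
  then show "openin \<tau> (W #>\<^bsub>G\<^esub> g)"
    using openin_continuous_map_preimage[OF continuous_translation(2)[OF G ig] W] by simp
qed

lemma topological_group_subgroup:
  assumes G: "topological_group G \<tau>" and H: "subgroup H G"
  shows "topological_group (G\<lparr>carrier := H\<rparr>) (subtopology \<tau> H)"
  unfolding topological_group_def
proof (intro conjI)
  note D = topological_groupD[OF G]
  interpret group G by (rule D(1))
  interpret H: subgroup H G by fact
  show "group (G\<lparr>carrier := H\<rparr>)" by (rule H.subgroup_is_group) (rule D(1))
  show "topspace (subtopology \<tau> H) = carrier (G\<lparr>carrier := H\<rparr>)"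
    using D(2) H.subset by (auto simp: topspace_subtopology)
  have "continuous_map (prod_topology (subtopology \<tau> H) (subtopology \<tau> H)) \<tau> (\<lambda>(x, y). x \<otimes>\<^bsub>G\<^esub> y)"
    unfolding subtopology_Times[symmetric] by (rule continuous_map_from_subtopology[OF D(3)])
  then show "continuous_map (prod_topology (subtopology \<tau> H) (subtopology \<tau> H)) (subtopology \<tau> H)
      (\<lambda>(x, y). x \<otimes>\<^bsub>G\<lparr>carrier := H\<rparr>\<^esub> y)"
    by (auto simp: continuous_map_in_subtopology)
  have "continuous_map (subtopology \<tau> H) (subtopology \<tau> H) (\<lambda>x. inv\<^bsub>G\<^esub> x)"
    using continuous_map_from_subtopology[OF D(4), of H] by (auto simp: continuous_map_in_subtopology)
  then show "continuous_map (subtopology \<tau> H) (subtopology \<tau> H) (\<lambda>x. inv\<^bsub>G\<lparr>carrier := H\<rparr>\<^esub> x)"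
    by (rule continuous_map_eq) (auto simp: m_inv_consistent[OF H])
qed

text \<open>The complement is a finite union of translates of \<open>A\<close>, hence closed. This
  turns finite index in \<open>S\<close> into openness in \<open>S\<close>.\<close>

lemma closed_finite_index_open:
  assumes G: "topological_group G \<tau>" and A: "subgroup A G" "closedin \<tau> A"
    and fin: "finite (rcosets\<^bsub>G\<^esub> A)"
  shows "openin \<tau> A"
proof -
  note D = topological_groupD[OF G]
  interpret group G by (rule D(1))
  interpret A: subgroup A G by fact
  have closed: "closedin \<tau> C" if C: "C \<in> rcosets\<^bsub>G\<^esub> A" for C
  proof -
    obtain g where g: "g \<in> carrier G" "C = A #>\<^bsub>G\<^esub> g" using C by (auto simp: RCOSETS_def)
    have ig: "inv\<^bsub>G\<^esub> g \<in> carrier G" using g by simp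
    have "C = {x \<in> topspace \<tau>. x \<otimes>\<^bsub>G\<^esub> inv\<^bsub>G\<^esub> g \<in> A}"
    proof (intro equalityI subsetI)
      fix y assume "y \<in> {x \<in> topspace \<tau>. x \<otimes>\<^bsub>G\<^esub> inv\<^bsub>G\<^esub> g \<in> A}"
      then have "y \<otimes>\<^bsub>G\<^esub> inv\<^bsub>G\<^esub> g \<in> A" "y = (y \<otimes>\<^bsub>G\<^esub> inv\<^bsub>G\<^esub> g) \<otimes>\<^bsub>G\<^esub> g"
        using g D(2) by (auto simp: m_assoc)
      then show "y \<in> C" unfolding g(2) mem_r_coset_iff by blast
    next
      fix y assume "y \<in> C"
      then obtain a where a: "a \<in> A" "y = a \<otimes>\<^bsub>G\<^esub> g" unfolding g(2) mem_r_coset_iff by blast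
      then have "a \<in> carrier G" using A.subset by blast
      then show "y \<in> {x \<in> topspace \<tau>. x \<otimes>\<^bsub>G\<^esub> inv\<^bsub>G\<^esub> g \<in> A}"
        using a g(1) by (simp add: D(2) m_assoc)
    qed
    then show ?thesis
      using closedin_continuous_map_preimage[OF continuous_translation(2)[OF G ig] A(2)] by simp
  qed
  have Ain: "A \<in> rcosets\<^bsub>G\<^esub> A" using A.subgroup_in_rcosets[OF D(1)] .
  have "closedin \<tau> (\<Union>(rcosets\<^bsub>G\<^esub> A - {A}))"
    using fin closed by (intro closedin_Union) auto
  moreover have "topspace \<tau> - \<Union>(rcosets\<^bsub>G\<^esub> A - {A}) = A"
  proof -
    have part: "\<Union>(rcosets\<^bsub>G\<^esub> A) = carrier G" using rcosets_part_G[OF A(1)] .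
    have disj: "C \<inter> A = {}" if "C \<in> rcosets\<^bsub>G\<^esub> A - {A}" for C
      using rcos_disjoint[OF A(1)] that Ain by (auto simp: pairwise_def disjnt_def)
    show ?thesis
    proof (intro equalityI subsetI)
      fix x assume x: "x \<in> topspace \<tau> - \<Union>(rcosets\<^bsub>G\<^esub> A - {A})"
      then have "x \<in> \<Union>(rcosets\<^bsub>G\<^esub> A)" using part D(2) by simp
      then show "x \<in> A" using x by blast
    next
      fix x assume x: "x \<in> A"
      then have "x \<in> topspace \<tau>" using A.subset D(2) by blast
      then show "x \<in> topspace \<tau> - \<Union>(rcosets\<^bsub>G\<^esub> A - {A})" using disj x by blast
    qed
  qed
  ultimately show ?thesis by (metis openin_diff openin_topspace)
qed

lemma compact_open_finite_index:
  assumes G: "topological_group G \<tau>" and H: "subgroup H G" "compactin \<tau> H"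
    and K: "subgroup K G" "K \<subseteq> H" "openin \<tau> K"
  shows "finite_index G H K"
proof -
  note D = topological_groupD[OF G]
  interpret group G by (rule D(1))
  interpret H: subgroup H G by fact
  let ?H = "G\<lparr>carrier := H\<rparr>"
  interpret HG: group ?H by (rule H.subgroup_is_group) (rule D(1))
  have KH: "subgroup K ?H" using subgroup_incl[OF K(1) H(1) K(2)] .
  let ?C = "rcosets\<^bsub>?H\<^esub> K"
  have part: "\<Union>?C = H" using HG.rcosets_part_G[OF KH] by simp
  have "\<And>c. c \<in> ?C \<Longrightarrow> openin \<tau> c"
    using openin_translation(2)[OF G _ K(3)] H.subset by (auto simp: RCOSETS_def r_coset_def subset_eq)
  then obtain F where F: "finite F" "F \<subseteq> ?C" "H \<subseteq> \<Union>F"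
    using H(2) part unfolding compactin_def by (metis subset_refl)
  have "?C \<subseteq> F"
  proof
    fix c assume c: "c \<in> ?C"
    then have "c \<noteq> {}" using subgroup.rcosets_non_empty[OF KH] by blast
    then obtain x where x: "x \<in> c" by blast
    then have "x \<in> H" using part c by blast
    then obtain c' where c': "c' \<in> F" "x \<in> c'" using F by blast
    then have "c = c'" using HG.rcos_disjoint[OF KH] c x F(2) by (auto simp: pairwise_def disjnt_def)
    then show "c \<in> F" using c' by simp
  qed
  then show ?thesis using F(1) unfolding finite_index_def by (rule finite_subset)
qed

lemma (in filtered_group) continuous_coset_topology:
  assumes im: "i ` topspace \<sigma> \<subseteq> carrier G"
    and co: "\<And>h n. h \<in> topspace \<sigma> \<Longrightarrow> \<exists>W. openin \<sigma> W \<and> h \<in> W \<and> i ` W \<subseteq> i h <#\<^bsub>G\<^esub> B n"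
  shows "continuous_map \<sigma> (coset_topology G B) i"
  unfolding continuous_map
proof (intro conjI allI impI)
  show "i ` topspace \<sigma> \<subseteq> topspace (coset_topology G B)" using im by (simp add: topspace_coset_topology)
  fix V assume V: "openin (coset_topology G B) V"
  show "openin \<sigma> {x \<in> topspace \<sigma>. i x \<in> V}"
  proof (subst openin_subopen, intro ballI)
    fix h assume "h \<in> {x \<in> topspace \<sigma>. i x \<in> V}"
    then have h: "h \<in> topspace \<sigma>" "i h \<in> V" by auto
    obtain n where "i h <#\<^bsub>G\<^esub> B n \<subseteq> V" using V h unfolding openin_coset_topology by blast
    moreover obtain W where "openin \<sigma> W" "h \<in> W" "i ` W \<subseteq> i h <#\<^bsub>G\<^esub> B n" using co[OF h(1)] by blast
    ultimately show "\<exists>T. openin \<sigma> T \<and> h \<in> T \<and> T \<subseteq> {x \<in> topspace \<sigma>. i x \<in> V}"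
      using openin_subset by (intro exI[of _ W] conjI) blast+
  qed
qed

text \<open>Settles existence and uniqueness for the definite description. Any competing topology
  has the same neighbourhoods of the unit, since \<open>i\<close> is open and continuous at
  \<open>e\<close>; translations carry this to all other points. The hypotheses \<open>op\<close>
  and \<open>co\<close> are openness and continuity of \<open>i\<close>, phrased with
  cosets.\<close>

lemma (in filtered_group) group_topology_via_eq:
  assumes im: "i ` topspace \<sigma> \<subseteq> carrier G" and e: "e \<in> topspace \<sigma>" "i e = \<one>"
    and op: "\<And>W h. openin \<sigma> W \<Longrightarrow> h \<in> W \<Longrightarrow> \<exists>n. i h <#\<^bsub>G\<^esub> B n \<subseteq> i ` W"
    and co: "\<And>h n. h \<in> topspace \<sigma> \<Longrightarrow> \<exists>W. openin \<sigma> W \<and> h \<in> W \<and> i ` W \<subseteq> i h <#\<^bsub>G\<^esub> B n"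
  shows "group_topology_via G \<sigma> i = coset_topology G B"
  unfolding group_topology_via_def
proof (rule the_equality)
  let ?\<tau> = "coset_topology G B"
  show "topological_group G ?\<tau> \<and> continuous_map \<sigma> ?\<tau> i \<and> open_map \<sigma> ?\<tau> i"
  proof (intro conjI topological_group_coset_topology)
    show "continuous_map \<sigma> ?\<tau> i" by (rule continuous_coset_topology[OF im co])
    show "open_map \<sigma> ?\<tau> i"
      unfolding open_map_def openin_coset_topology
    proof (intro allI impI conjI ballI)
      fix W assume W: "openin \<sigma> W"
      show "i ` W \<subseteq> carrier G" using im openin_subset[OF W] by blast
      fix w assume "w \<in> i ` W"
      then show "\<exists>n. w <#\<^bsub>G\<^esub> B n \<subseteq> i ` W" using op[OF W] by blast
    qed
  qed
next
  let ?\<tau> = "coset_topology G B"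
  fix \<tau> assume \<tau>: "topological_group G \<tau> \<and> continuous_map \<sigma> \<tau> i \<and> open_map \<sigma> \<tau> i"
  then have G: "topological_group G \<tau>" by blast
  have sp: "topspace \<tau> = carrier G" using topological_groupD(2)[OF G] .
  show "\<tau> = ?\<tau>"
  proof (rule topology_eq[THEN iffD2], intro allI iffI)
    fix V assume V: "openin \<tau> V"
    show "openin ?\<tau> V"
      unfolding openin_coset_topology
    proof (intro conjI ballI)
      show Vs: "V \<subseteq> carrier G" using openin_subset[OF V] sp by simp
      fix v assume v: "v \<in> V"
      then have vc: "v \<in> carrier G" using Vs by blast
      let ?V = "inv v <#\<^bsub>G\<^esub> V"
      have oV: "openin \<tau> ?V" using openin_translation(1)[OF G _ V] vc by simp
      have "\<one> \<in> ?V" using v vc by (auto simp: mem_l_coset_iff intro!: bexI[of _ v])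
      then have "e \<in> {x \<in> topspace \<sigma>. i x \<in> ?V}" using e by simp
      moreover have "openin \<sigma> {x \<in> topspace \<sigma>. i x \<in> ?V}"
        using \<tau> oV openin_continuous_map_preimage by blast
      ultimately obtain n where "i e <#\<^bsub>G\<^esub> B n \<subseteq> i ` {x \<in> topspace \<sigma>. i x \<in> ?V}" using op by blast
      then have n: "\<one> <#\<^bsub>G\<^esub> B n \<subseteq> ?V" using e(2) by auto
      have "v <#\<^bsub>G\<^esub> B n \<subseteq> V"
      proof
        fix y assume "y \<in> v <#\<^bsub>G\<^esub> B n"
        then obtain b where b: "b \<in> B n" "y = v \<otimes> b" by (auto simp: mem_l_coset_iff)
        then have "b \<in> \<one> <#\<^bsub>G\<^esub> B n" using B_carrier by (auto simp: mem_l_coset_iff intro!: bexI[of _ b])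
        then have "b \<in> ?V" using n by blast
        then obtain u where u: "u \<in> V" "b = inv v \<otimes> u" by (auto simp: mem_l_coset_iff)
        then have "y = u" using b vc Vs by (auto simp: m_assoc[symmetric] subset_eq)
        then show "y \<in> V" using u by simp
      qed
      then show "\<exists>n. v <#\<^bsub>G\<^esub> B n \<subseteq> V" by blast
    qed
  next
    fix V assume V: "openin ?\<tau> V"
    then have Vs: "V \<subseteq> carrier G" by (simp add: openin_coset_topology)
    show "openin \<tau> V"
    proof (subst openin_subopen, intro ballI)
      fix v assume v: "v \<in> V"
      then obtain n where n: "v <#\<^bsub>G\<^esub> B n \<subseteq> V" using V unfolding openin_coset_topology by blast
      obtain W where W: "openin \<sigma> W" "e \<in> W" "i ` W \<subseteq> i e <#\<^bsub>G\<^esub> B n" using co[OF e(1)] by blast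
      have "i ` W \<subseteq> B n" using W(3) e(2) B_carrier by (auto simp: mem_l_coset_iff subset_eq)
      then have "v <#\<^bsub>G\<^esub> (i ` W) \<subseteq> V" using n by (auto simp: mem_l_coset_iff subset_eq)
      moreover have "openin \<tau> (v <#\<^bsub>G\<^esub> (i ` W))"
        using openin_translation(1)[OF G] \<tau> W(1) v Vs by (auto simp: open_map_def)
      moreover have "v \<in> v <#\<^bsub>G\<^esub> (i ` W)"
      proof -
        have "\<one> \<in> i ` W" using imageI[OF W(2), of i] e(2) by simp
        moreover have "v = v \<otimes> \<one>" using v Vs by (simp add: subset_eq)
        ultimately show ?thesis unfolding mem_l_coset_iff by blast
      qed
      ultimately show "\<exists>T. openin \<tau> T \<and> v \<in> T \<and> T \<subseteq> V" by blast
    qed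
  qed
qed

section \<open>Finite p-groups\<close>

text \<open>For a prime divisor \<open>q\<close> of the order, Sylow's theorem gives a subgroup of
  order \<open>q\<close>. A nontrivial element of it has order dividing both \<open>q\<close> and a
  power of \<open>p\<close>, so \<open>q = p\<close>.\<close>

lemma p_group_order:
  assumes G: "group G" and fin: "finite (carrier G)" and p: "prime p"
    and pow: "\<And>x. x \<in> carrier G \<Longrightarrow> \<exists>k. x [^]\<^bsub>G\<^esub> (p ^ k :: nat) = \<one>\<^bsub>G\<^esub>"
  shows "\<exists>n. order G = p ^ n"
proof -
  interpret group G by fact
  have pos: "order G > 0" using fin order_gt_0_iff_finite by blast
  have only_p: "q = p" if q: "prime q" "q dvd order G" for q
  proof -
    obtain m where "order G = q ^ 1 * m" using q(2) by (auto simp: dvd_def)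
    then obtain H where H: "subgroup H G" "card H = q ^ 1" using sylow_thm[OF q(1) G _ fin] by blast
    interpret H: subgroup H G by fact
    have "card H > 1" using H(2) using prime_gt_1_nat[OF q(1)] by simp
    have "\<exists>x\<in>H. x \<noteq> \<one>\<^bsub>G\<^esub>"
    proof (rule ccontr)
      assume "\<not> ?thesis"
      then have "H \<subseteq> {\<one>\<^bsub>G\<^esub>}" by blast
      then have "card H \<le> 1" using card_mono[of "{\<one>\<^bsub>G\<^esub>}" H] by simp
      then show False using \<open>card H > 1\<close> by simp
    qed
    then obtain x where x: "x \<in> H" "x \<noteq> \<one>\<^bsub>G\<^esub>" by blast
    have xc: "x \<in> carrier G" using x H.subset by blast
    interpret HG: group "G\<lparr>carrier := H\<rparr>" by (rule H.subgroup_is_group[OF G])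
    have "x [^]\<^bsub>G\<lparr>carrier := H\<rparr>\<^esub> order (G\<lparr>carrier := H\<rparr>) = \<one>\<^bsub>G\<lparr>carrier := H\<rparr>\<^esub>"
      using x(1) by (intro HG.pow_order_eq_1) auto
    then have "x [^]\<^bsub>G\<^esub> q = \<one>\<^bsub>G\<^esub>" using H(2) by (simp add: order_def nat_pow_consistent[symmetric])
    then have "ord x dvd q" using pow_eq_id[OF xc] by blast
    moreover obtain k where "x [^]\<^bsub>G\<^esub> (p ^ k) = \<one>\<^bsub>G\<^esub>" using pow[OF xc] by blast
    then have "ord x dvd p ^ k" using pow_eq_id[OF xc] by blast
    moreover have "ord x \<noteq> 1" using x(2) ord_eq_1[OF xc] by blast
    ultimately have "q dvd p ^ k" using q(1) by (metis prime_nat_iff)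
    then show ?thesis using q(1) p by (metis prime_dvd_power primes_dvd_imp_eq)
  qed
  have "order G \<noteq> 0" "\<not> is_unit p" using pos p by auto
  from multiplicity_decompose'[OF this]
  obtain m where m: "order G = p ^ multiplicity p (order G) * m" "\<not> p dvd m" by metis
  have "m = 1"
  proof (rule ccontr)
    assume "m \<noteq> 1"
    then obtain q where "prime q" "q dvd m" using prime_factor_nat by blast
    moreover have "m dvd order G" using m(1) by (metis dvd_triv_right)
    ultimately show False using only_p[of q] m(2) dvd_trans by metis
  qed
  then have "order G = p ^ multiplicity p (order G)" using m(1) by simp
  then show ?thesis by blast
qed

text \<open>Open sets of the pullback are traces of preimages, so a cover of \<open>K\<close> is
  induced by a cover of its image. Needed because the permutation topology is pulled back along the
  vertex map.\<close>

lemma compactin_pullback_topology: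
  assumes "K \<subseteq> A" "compactin X (f ` K)"
  shows "compactin (pullback_topology A f X) K"
  unfolding compactin_def
proof (intro conjI allI impI)
  show "K \<subseteq> topspace (pullback_topology A f X)"
    using assms compactin_subset_topspace[OF assms(2)] by (auto simp: topspace_pullback_topology)
  fix \<U> assume \<U>: "(\<forall>U\<in>\<U>. openin (pullback_topology A f X) U) \<and> K \<subseteq> \<Union>\<U>"
  then have "\<forall>U\<in>\<U>. \<exists>V. openin X V \<and> U = f -` V \<inter> A" by (simp add: openin_pullback_topology)
  then obtain V where V: "\<And>U. U \<in> \<U> \<Longrightarrow> openin X (V U) \<and> U = f -` V U \<inter> A" by metis
  have "\<forall>W\<in>V ` \<U>. openin X W" using V by blast
  moreover have "f ` K \<subseteq> \<Union>(V ` \<U>)"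
  proof
    fix y assume "y \<in> f ` K"
    then obtain x U where "y = f x" "x \<in> K" "x \<in> U" "U \<in> \<U>" using \<U> by blast
    then show "y \<in> \<Union>(V ` \<U>)" using V[of U] by blast
  qed
  ultimately obtain F where F: "finite F" "F \<subseteq> V ` \<U>" "f ` K \<subseteq> \<Union>F"
    using assms(2) unfolding compactin_def by meson
  then obtain G where G: "G \<subseteq> \<U>" "finite G" "F = V ` G" by (metis finite_subset_image)
  have "K \<subseteq> \<Union>G"
  proof
    fix x assume x: "x \<in> K"
    then obtain U where "U \<in> G" "f x \<in> V U" using F(3) G(3) by blast
    then show "x \<in> \<Union>G" using V[of U] G(1) x assms(1) by blast
  qed
  then show "\<exists>\<F>. finite \<F> \<and> \<F> \<subseteq> \<U> \<and> K \<subseteq> \<Union>\<F>" using G by blast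
qed

context colored_tree
begin

lemma Aut_id: "(id, id) \<in> Aut" and U_id: "subgroup F Sym \<Longrightarrow> (id, id) \<in> U F"
  and U_comp: "subgroup F Sym \<Longrightarrow> g \<in> U F \<Longrightarrow> h \<in> U F \<Longrightarrow> pair_comp g h \<in> U F"
  and U_inv: "subgroup F Sym \<Longrightarrow> g \<in> U F \<Longrightarrow> pair_inv g \<in> U F"
  and U_Aut: "U F \<subseteq> Aut"
proof -
  show "(id, id) \<in> Aut" using aut_closed_automorphisms[of \<Gamma>] unfolding aut_closed_def by blast
  show "U F \<subseteq> Aut" by (auto simp: universal_group_def)
  assume "subgroup F Sym"
  note H = aut_closed_universal[OF this, unfolded aut_closed_def]
  show "(id, id) \<in> U F" using H by blast
  show "g \<in> U F \<Longrightarrow> h \<in> U F \<Longrightarrow> pair_comp g h \<in> U F" using H by blast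
  show "g \<in> U F \<Longrightarrow> pair_inv g \<in> U F" using H by blast
qed

text \<open>Automorphisms fixing the base vertex preserve the finite balls around it. Compactness of
  the stabilizers and normality of the ball fixators in them depend on this.\<close>

lemma aut_level_le:
  assumes g: "g \<in> Aut" and b: "fst g (base \<Gamma>) = base \<Gamma>" shows "level (fst g x) \<le> level x"
proof (induction "level x" arbitrary: x)
  case 0
  then show ?case using b by simp
next
  case (Suc m)
  define c where "c = last (word (base \<Gamma>) x)"
  have "x \<noteq> base \<Gamma>" using Suc(2) by auto
  then have l: "level (nbr x c) = m" using Suc(2) by (simp add: c_def level_nbr)
  have "fst g x = nbr (fst g (nbr x c)) (loc g (nbr x c) c)"
    using aut_nbr[OF g, of "nbr x c" c] by simp
  then have "level (fst g x) \<le> Suc (level (fst g (nbr x c)))" using level_nbr_le by metis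
  then show ?case using Suc l by fastforce
qed

section \<open>The Neretin group as a group of germs\<close>

abbreviation "NG \<equiv> neretin_group \<Gamma>"

lemma almost_Aut: "almost (U F) f \<Longrightarrow> almost Aut f"
  using almost_mono[OF U_Aut] .

lemma neretin_carrier: "carrier (NG F) = cls ` {f. almost (U F) f}"
proof -
  have AA: "AA (U F) \<subseteq> AA Aut" using AA_mono[OF U_Aut] .
  have "almost_class \<Gamma> ` AA (U F) = cls ` {f. almost (U F) f}"
  proof (intro equalityI subsetI)
    fix A assume "A \<in> almost_class \<Gamma> ` AA (U F)"
    then obtain \<phi> where \<phi>: "\<phi> \<in> AA (U F)" "A = almost_class \<Gamma> \<phi>" by blast
    then have "A = cls (vmap \<phi>)" using almost_class_eq AA by blast
    moreover have "almost (U F) (vmap \<phi>)" using \<phi> germ_eq_refl unfolding almost_def by blast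
    ultimately show "A \<in> cls ` {f. almost (U F) f}" by blast
  next
    fix A assume "A \<in> cls ` {f. almost (U F) f}"
    then obtain f \<phi> where \<phi>: "A = cls f" "\<phi> \<in> AA (U F)" "germ_eq (vmap \<phi>) f" by (auto simp: almost_def)
    then have "A = almost_class \<Gamma> \<phi>" using almost_class_eq AA cls_cong by blast
    then show "A \<in> almost_class \<Gamma> ` AA (U F)" using \<phi> by blast
  qed
  then show ?thesis by (simp add: neretin_group_def)
qed

lemma neretin_mult: "almost Aut f \<Longrightarrow> almost Aut g \<Longrightarrow> cls f \<otimes>\<^bsub>NG F\<^esub> cls g = cls (f \<circ> g)"
  by (simp add: neretin_group_def class_mult_cls)

lemma neretin_one: "\<one>\<^bsub>NG F\<^esub> = cls id"
  by (simp add: neretin_group_def class_of_automorphism_eq[OF Aut_id])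

lemma neretin_carrier_mono: "F \<subseteq> F' \<Longrightarrow> carrier (NG F) \<subseteq> carrier (NG F')"
proof -
  assume "F \<subseteq> F'"
  then have "U F \<subseteq> U F'" by (auto simp: universal_group_def)
  then show ?thesis unfolding neretin_carrier using almost_mono by blast
qed

text \<open>Agrees with \<open>class_of_automorphism\<close> on automorphisms, but depends on the
  vertex map alone.\<close>

definition germ :: "('v \<Rightarrow> 'v) \<times> ('e \<Rightarrow> 'e) \<Rightarrow> ('v, 'e) forest_map set" where
  "germ g = cls (fst g)"

lemma germ_eq_iff: "g \<in> Aut \<Longrightarrow> h \<in> Aut \<Longrightarrow> germ g = germ h \<longleftrightarrow> g = h"
  using cls_eq_iff[OF almost_aut[OF order_refl]] aut_agree_cofinite[of g h]
  by (auto simp: germ_def germ_eq_def)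

lemma class_of_automorphism_germ: "g \<in> Aut \<Longrightarrow> class_of_automorphism \<Gamma> g = germ g"
  by (simp add: class_of_automorphism_eq germ_def)

lemma germ_mult:
  assumes "g \<in> Aut" "h \<in> Aut" shows "germ g \<otimes>\<^bsub>NG F\<^esub> germ h = germ (pair_comp g h)"
proof -
  have "fst (pair_comp g h) = fst g \<circ> fst h" by (simp add: pair_comp_def)
  then show ?thesis using assms neretin_mult almost_aut[OF order_refl] by (simp add: germ_def)
qed

lemma germ_one: "\<one>\<^bsub>NG F\<^esub> = germ (id, id)"
  by (simp add: germ_def neretin_one)

lemma germ_in: "g \<in> U F \<Longrightarrow> germ g \<in> carrier (NG F)"
  using almost_aut[OF U_Aut] by (auto simp: neretin_carrier germ_def)

text \<open>Radius 0 gives the stabilizer of the base vertex in \<open>U F\<close>, so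
  \<open>germ_fixator P 0\<close> will be the subgroup \<open>S\<close>.\<close>

definition ball_fixator :: "('c \<Rightarrow> 'c) set \<Rightarrow> nat \<Rightarrow> (('v \<Rightarrow> 'v) \<times> ('e \<Rightarrow> 'e)) set" where
  "ball_fixator F n = {g \<in> U F. \<forall>x\<in>tree_ball n. fst g x = x}"

definition germ_fixator :: "('c \<Rightarrow> 'c) set \<Rightarrow> nat \<Rightarrow> ('v, 'e) forest_map set set" where
  "germ_fixator F n = germ ` ball_fixator F n"

lemma ball_fixatorD: "g \<in> ball_fixator F n \<Longrightarrow> g \<in> U F" "g \<in> ball_fixator F n \<Longrightarrow> g \<in> Aut"
  "g \<in> ball_fixator F n \<Longrightarrow> x \<in> tree_ball n \<Longrightarrow> fst g x = x"
  using U_Aut by (auto simp: ball_fixator_def)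

lemma ball_fixator_closed:
  assumes X: "subgroup X Sym"
  shows "(id, id) \<in> ball_fixator X n"
    "g \<in> ball_fixator X n \<Longrightarrow> h \<in> ball_fixator X n \<Longrightarrow> pair_comp g h \<in> ball_fixator X n"
    "g \<in> ball_fixator X n \<Longrightarrow> pair_inv g \<in> ball_fixator X n"
proof -
  show "(id, id) \<in> ball_fixator X n" using U_id[OF X] by (simp add: ball_fixator_def)
  show "pair_comp g h \<in> ball_fixator X n" if "g \<in> ball_fixator X n" "h \<in> ball_fixator X n" for g h
    using that U_comp[OF X] by (simp add: ball_fixator_def)
  show "pair_inv g \<in> ball_fixator X n" if g: "g \<in> ball_fixator X n" for g
  proof -
    have "finv (fst g) x = x" if "x \<in> tree_ball n" for x
      using ball_fixatorD(3)[OF g that] aut_inv_apply(2)[OF ball_fixatorD(2)[OF g], of x] by simp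
    then show ?thesis using g U_inv[OF X] by (simp add: ball_fixator_def)
  qed
qed

text \<open>Inside \<open>T\<close> the portrait is trivial, on the branch at \<open>v\<close> it is
  that of \<open>a v\<close>. The two match along the stem because \<open>a v\<close> fixes the stem
  colour, so the branches can be moved independently of each other.\<close>

lemma glue_automorphisms:
  assumes F: "subgroup F Sym" and T: "complete_subtree \<Gamma> T"
    and a: "\<And>v. v \<in> leaves \<Gamma> T \<Longrightarrow> a v \<in> U F \<and> fst (a v) v = v \<and> loc (a v) v (stem T v) = stem T v"
  shows "\<exists>g\<in>U F. (\<forall>x\<in>T. fst g x = x) \<and>
    (\<forall>v\<in>leaves \<Gamma> T. \<forall>x\<in>half v (stem T v). fst g x = fst (a v) x)"
proof -
  \<comment> \<open>The choice is unique, since the half-trees of different leaves are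
    disjoint.\<close>
  define \<pi> where "\<pi> x = (if \<exists>v\<in>leaves \<Gamma> T. x \<in> half v (stem T v)
    then loc (a (SOME v. v \<in> leaves \<Gamma> T \<and> x \<in> half v (stem T v))) x else id)" for x
  have \<pi>_half: "\<pi> x = loc (a v) x" if v: "v \<in> leaves \<Gamma> T" "x \<in> half v (stem T v)" for x v
  proof -
    let ?w = "SOME v. v \<in> leaves \<Gamma> T \<and> x \<in> half v (stem T v)"
    have "?w \<in> leaves \<Gamma> T \<and> x \<in> half ?w (stem T ?w)" by (rule someI[of _ v]) (use v in blast)
    then have "?w = v" using leaf_halves_disjoint[OF completeD(2)[OF T], of ?w v] v by blast
    then show ?thesis using v by (auto simp: \<pi>_def)
  qed
  \<comment> \<open>At a leaf the only colour leading into \<open>T\<close> is the stem, which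
    \<open>a v\<close> fixes; the other vertices of \<open>T\<close> lie in no branch and carry the
    identity.\<close>
  have \<pi>_T: "\<pi> x c = c" if x: "x \<in> T" "nbr x c \<in> T" for x c
  proof (cases "x \<in> leaves \<Gamma> T")
    case True
    then show ?thesis using \<pi>_half[OF True half_self] a[OF True] leaf_nbr_iff[OF True, of c] x by simp
  next
    case False
    then have "\<not> (\<exists>v\<in>leaves \<Gamma> T. x \<in> half v (stem T v))"
      using leaf_half_disjoint[OF completeD(2)[OF T] _ x(1)] by blast
    then show ?thesis by (simp add: \<pi>_def)
  qed
  have \<pi>_F: "\<pi> x \<in> F" for x
  proof (cases "\<exists>v\<in>leaves \<Gamma> T. x \<in> half v (stem T v)")
    case True
    then obtain v where v: "v \<in> leaves \<Gamma> T" "x \<in> half v (stem T v)" by blast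
    then show ?thesis using \<pi>_half[OF v] a[OF v(1)] universal_groupD(2) by simp
  next
    case False
    then show ?thesis using Sym_subgroupD(1)[OF F] by (simp add: \<pi>_def)
  qed
  have compat1: "\<pi> (nbr x c) c = \<pi> x c" if x: "x \<notin> T" for x c
  proof -
    obtain v where v: "v \<in> leaves \<Gamma> T" "x \<in> half v (stem T v)" using halves_cover[OF T, of x] x by blast
    have "x \<noteq> v" using x leaf_in[OF v(1)] by blast
    then have "nbr x c \<in> half v (stem T v)" using half_nbr[OF v(2)] by blast
    then show ?thesis
      using \<pi>_half[OF v(1)] v(2) loc_nbr[OF universal_groupD(1)] a[OF v(1)] by metis
  qed
  have compat: "\<pi> (nbr x c) c = \<pi> x c" for x c
  proof -
    consider "x \<notin> T" | "nbr x c \<notin> T" | "x \<in> T" "nbr x c \<in> T" by blast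
    then show ?thesis
    proof cases
      case 2
      then show ?thesis using compat1[OF 2, of c] by simp
    next
      case 3
      then show ?thesis using \<pi>_T[OF 3] \<pi>_T[OF 3(2), of c] by simp
    qed (rule compat1)
  qed
  obtain g where g: "g \<in> U F" "fst g (base \<Gamma>) = base \<Gamma>" "\<And>x. loc g x = \<pi> x"
    using portrait_universal[of F \<pi> "base \<Gamma>" "base \<Gamma>", OF F \<pi>_F compat] by blast
  have gA: "g \<in> Aut" using g(1) by (rule universal_groupD)
  have gT: "fst g x = x" if "x \<in> T" for x
    using completeD(2,3)[OF T] that
  proof (induction rule: subtree_induct)
    case (step x c)
    then show ?case using \<pi>_T[of x c] by (simp add: aut_nbr[OF gA] g(3))
  qed (rule g(2))
  have "fst g x = fst (a v) x" if v: "v \<in> leaves \<Gamma> T" "x \<in> half v (stem T v)" for v x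
  proof (rule agree_on_halfI[OF gA _ _ _ v(2)])
    show "a v \<in> Aut" using a[OF v(1)] universal_groupD by blast
    show "fst g v = fst (a v) v" using a[OF v(1)] gT[OF leaf_in[OF v(1)]] by simp
    show "loc g y = loc (a v) y" if "y \<in> half v (stem T v)" for y using g(3) \<pi>_half[OF v(1) that] by simp
  qed
  with g(1) gT show ?thesis by blast
qed

text \<open>Continuity of conjugation by a germ. If \<open>u\<close> fixes the codomain tree of a
  representative, it preserves each branch there; pulling it back by the witnesses
  \<open>h v\<close> gives one automorphism for each leaf of the domain ball, and these are glued to
  an honest automorphism \<open>g\<close> that fixes the ball.\<close>

lemma conjugate_fixator:
  assumes F: "subgroup F Sym" and f: "almost (U F) f"
  shows "\<exists>m. \<forall>u\<in>ball_fixator F m. \<exists>g\<in>ball_fixator F n. germ_eq (f \<circ> fst g) (fst u \<circ> f)"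
proof -
  obtain N \<phi> where N: "N \<ge> n" and \<phi>: "\<phi> \<in> AA (U F)" "dom_tree \<phi> = tree_ball N"
    and \<phi>f: "germ_eq (vmap \<phi>) f"
    using almost_ball_representative[OF U_Aut f] by blast
  note D = AA_D[OF \<phi>(1)]
  let ?T = "dom_tree \<phi>" and ?T' = "cod_tree \<phi>"
  have "\<forall>v\<in>leaves \<Gamma> ?T. \<exists>h. h \<in> U F \<and> honest_at \<phi> h v (stem ?T v)" using AA_honest_at[OF \<phi>(1)] by blast
  then obtain h where h: "\<And>v. v \<in> leaves \<Gamma> ?T \<Longrightarrow> h v \<in> U F"
    "\<And>v. v \<in> leaves \<Gamma> ?T \<Longrightarrow> honest_at \<phi> (h v) v (stem ?T v)" by metis
  \<comment> \<open>Only the codomain tree decides how much \<open>u\<close> has to fix; the domain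
    ball has radius at least \<open>n\<close> by the choice of the representative.\<close>
  obtain m where m: "?T' \<subseteq> tree_ball m" using finite_subset_tree_ball[OF completeD(1)[OF D(2)]] by blast
  have "\<exists>g\<in>ball_fixator F n. germ_eq (f \<circ> fst g) (fst u \<circ> f)" if u: "u \<in> ball_fixator F m" for u
  proof -
    note uD = ball_fixatorD[OF u]
    define a where "a v = pair_comp (pair_inv (h v)) (pair_comp u (h v))" for v
    have a: "a v \<in> U F \<and> fst (a v) v = v \<and> loc (a v) v (stem ?T v) = stem ?T v"
      if v: "v \<in> leaves \<Gamma> ?T" for v
    proof -
      have hA: "h v \<in> Aut" using h(1)[OF v] universal_groupD by blast
      note im = AA_leaf_image[OF \<phi>(1) v hA h(2)[OF v]]
      have aU: "a v \<in> U F" unfolding a_def using F h(1)[OF v] uD(1) by (intro U_comp U_inv)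
      have "fst u (fst (h v) v) = fst (h v) v" using uD(3) leaf_in[OF im(1)] m by blast
      then have av: "fst (a v) v = v" by (simp add: a_def aut_inv_apply[OF hA])
      have "fst (h v) (nbr v (stem ?T v)) \<in> ?T'"
        using leaf_nbr_iff[OF im(1), of "stem ?T' (fst (h v) v)"] im(2) by (simp add: aut_nbr[OF hA])
      then have "fst u (fst (h v) (nbr v (stem ?T v))) = fst (h v) (nbr v (stem ?T v))" using uD(3) m by blast
      then have "fst (a v) (nbr v (stem ?T v)) = nbr v (stem ?T v)" by (simp add: a_def aut_inv_apply[OF hA])
      then have "loc (a v) v (stem ?T v) = loc (id, id) v (stem ?T v)"
        using av universal_groupD(1)[OF aU] Aut_id by (intro loc_determined) auto
      then show ?thesis using aU av by simp
    qed
    obtain g where g: "g \<in> U F" "\<And>x. x \<in> ?T \<Longrightarrow> fst g x = x"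
      "\<And>v x. v \<in> leaves \<Gamma> ?T \<Longrightarrow> x \<in> half v (stem ?T v) \<Longrightarrow> fst g x = fst (a v) x"
      using glue_automorphisms[of F ?T a, OF F D(1) a] by blast
    have gF: "g \<in> ball_fixator F n"
      using g(1,2) tree_ball_mono[OF N] \<phi>(2) by (auto simp: ball_fixator_def)
    have key: "vmap \<phi> (fst g x) = fst u (vmap \<phi> x)" if x: "x \<notin> ?T" for x
    proof -
      obtain v where v: "v \<in> leaves \<Gamma> ?T" "x \<in> half v (stem ?T v)" using halves_cover[OF D(1), of x] x by blast
      have hA: "h v \<in> Aut" using h(1)[OF v(1)] universal_groupD by blast
      note av = a[OF v(1)]
      have "fst (a v) x \<in> half v (stem ?T v)"
        using aut_half_into[OF universal_groupD(1) v(2), of "a v" F] av by simp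
      then have "vmap \<phi> (fst g x) = fst (h v) (fst (a v) x)"
        using g(3)[OF v] h(2)[OF v(1)] by (simp add: honest_at_def)
      also have "\<dots> = fst u (fst (h v) x)" by (simp add: a_def aut_inv_apply[OF hA])
      also have "\<dots> = fst u (vmap \<phi> x)" using h(2)[OF v(1)] v(2) by (simp add: honest_at_def)
      finally show ?thesis .
    qed
    have "germ_eq (f \<circ> fst g) (vmap \<phi> \<circ> fst g)"
      using germ_eq_comp[OF germ_eq_sym[OF \<phi>f] germ_eq_refl] almost_finite_fibres[OF almost_aut[OF U_Aut g(1)]] by blast
    also have "germ_eq \<dots> (fst u \<circ> vmap \<phi>)"
      by (rule germ_eqI[OF completeD(1)[OF D(1)]]) (simp add: key)
    also have "germ_eq \<dots> (fst u \<circ> f)"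
      using germ_eq_comp[OF germ_eq_refl \<phi>f AA_finite_fibres[OF \<phi>(1)]] .
    finally show ?thesis using gF by blast
  qed
  then show ?thesis by blast
qed

context
  fixes F :: "('c \<Rightarrow> 'c) set"
  assumes F: "subgroup F Sym"
begin

lemma neretin_group_group: "group (NG F)"
proof (rule groupI)
  note H = aut_closed_universal[OF F]
  show "\<one>\<^bsub>NG F\<^esub> \<in> carrier (NG F)" using germ_in[OF U_id[OF F]] by (simp add: germ_one)
  fix x assume "x \<in> carrier (NG F)"
  then obtain f where f: "x = cls f" "almost (U F) f" by (auto simp: neretin_carrier)
  show "\<one>\<^bsub>NG F\<^esub> \<otimes>\<^bsub>NG F\<^esub> x = x"
    using neretin_mult[OF almost_aut[OF order_refl Aut_id] almost_Aut[OF f(2)]] f by (simp add: neretin_one)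
  obtain g where g: "almost (U F) g" "germ_eq (g \<circ> f) id" by (rule almost_inverse[OF H f(2)])
  then have "cls g \<otimes>\<^bsub>NG F\<^esub> x = \<one>\<^bsub>NG F\<^esub>"
    using neretin_mult[OF almost_Aut almost_Aut] f cls_cong by (simp add: neretin_one)
  then show "\<exists>y\<in>carrier (NG F). y \<otimes>\<^bsub>NG F\<^esub> x = \<one>\<^bsub>NG F\<^esub>" using g(1) by (auto simp: neretin_carrier)
  fix y assume "y \<in> carrier (NG F)"
  then obtain f' where f': "y = cls f'" "almost (U F) f'" by (auto simp: neretin_carrier)
  note ff' = almost_comp[OF H f(2) f'(2)]
  have xy: "x \<otimes>\<^bsub>NG F\<^esub> y = cls (f \<circ> f')"
    using neretin_mult[OF almost_Aut almost_Aut] f f' by simp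
  then show "x \<otimes>\<^bsub>NG F\<^esub> y \<in> carrier (NG F)" using ff' by (auto simp: neretin_carrier)
  fix z assume "z \<in> carrier (NG F)"
  then obtain f'' where f'': "z = cls f''" "almost (U F) f''" by (auto simp: neretin_carrier)
  have "y \<otimes>\<^bsub>NG F\<^esub> z = cls (f' \<circ> f'')"
    using neretin_mult[OF almost_Aut almost_Aut] f' f'' by simp
  then show "x \<otimes>\<^bsub>NG F\<^esub> y \<otimes>\<^bsub>NG F\<^esub> z = x \<otimes>\<^bsub>NG F\<^esub> (y \<otimes>\<^bsub>NG F\<^esub> z)"
    using xy neretin_mult[OF almost_Aut[OF ff'] almost_Aut[OF f''(2)]] f f''
      neretin_mult[OF almost_Aut[OF f(2)] almost_Aut[OF almost_comp[OF H f'(2) f''(2)]]]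
    by (simp add: o_assoc)
qed

lemma neretin_inv:
  assumes "almost (U F) f" "almost (U F) g" "germ_eq (g \<circ> f) id"
  shows "inv\<^bsub>NG F\<^esub> cls f = cls g"
proof -
  have "cls g \<otimes>\<^bsub>NG F\<^esub> cls f = \<one>\<^bsub>NG F\<^esub>"
    using neretin_mult[OF almost_Aut almost_Aut] assms cls_cong by (simp add: neretin_one)
  then show ?thesis
    using group.inv_equality[OF neretin_group_group] assms by (auto simp: neretin_carrier)
qed

lemma germ_inv: assumes "g \<in> U F" shows "inv\<^bsub>NG F\<^esub> germ g = germ (pair_inv g)"
proof -
  have "germ (pair_inv g) \<otimes>\<^bsub>NG F\<^esub> germ g = \<one>\<^bsub>NG F\<^esub>"
    using germ_mult[OF aut_inv, of g g F] pair_inv_comp(1)[of g] universal_groupD(1)[OF assms]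
    by (simp add: germ_one)
  then show ?thesis
    using group.inv_equality[OF neretin_group_group] germ_in U_inv[OF F] assms by blast
qed

lemma germ_subgroup:
  assumes H: "H \<subseteq> U F" "(id, id) \<in> H" "\<And>g h. g \<in> H \<Longrightarrow> h \<in> H \<Longrightarrow> pair_comp g h \<in> H"
    "\<And>g. g \<in> H \<Longrightarrow> pair_inv g \<in> H"
  shows "subgroup (germ ` H) (NG F)"
proof
  show "germ ` H \<subseteq> carrier (NG F)" using germ_in H(1) by blast
  show "\<one>\<^bsub>NG F\<^esub> \<in> germ ` H" using H(2) by (simp add: germ_one)
  show "x \<otimes>\<^bsub>NG F\<^esub> y \<in> germ ` H" if xy: "x \<in> germ ` H" "y \<in> germ ` H" for x y
  proof -
    obtain g h where "x = germ g" "g \<in> H" "y = germ h" "h \<in> H" using xy by blast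
    then show ?thesis using H(1,3) U_Aut germ_mult[of g h F] by (metis imageI subsetD)
  qed
  show "inv\<^bsub>NG F\<^esub> x \<in> germ ` H" if x: "x \<in> germ ` H" for x
  proof -
    obtain g where g: "x = germ g" "g \<in> H" using x by blast
    then have "inv\<^bsub>NG F\<^esub> x = germ (pair_inv g)" using germ_inv[of g] H(1) by blast
    then show ?thesis using H(4)[OF g(2)] by blast
  qed
qed

lemma germ_fixator_subgroup: "subgroup (germ_fixator F n) (NG F)"
  unfolding germ_fixator_def
  by (rule germ_subgroup) (use ball_fixator_closed[OF F] in \<open>auto simp: ball_fixatorD(1)\<close>)

lemma filtered_neretin: "filtered_group (NG F) (germ_fixator F)"
proof -
  interpret group "NG F" by (rule neretin_group_group)
  note H = aut_closed_universal[OF F]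
  have conj: "\<exists>m. \<forall>b\<in>germ_fixator F m. inv\<^bsub>NG F\<^esub> x \<otimes>\<^bsub>NG F\<^esub> b \<otimes>\<^bsub>NG F\<^esub> x \<in> germ_fixator F n"
    if x: "x \<in> carrier (NG F)" for x n
  proof -
    from x obtain f where f: "x = cls f" "almost (U F) f" by (auto simp: neretin_carrier)
    obtain f' where f': "almost (U F) f'" "germ_eq (f' \<circ> f) id" by (rule almost_inverse[OF H f(2)])
    have ix: "inv\<^bsub>NG F\<^esub> x = cls f'" using neretin_inv f f' by simp
    obtain m where m: "\<And>u. u \<in> ball_fixator F m \<Longrightarrow> \<exists>g\<in>ball_fixator F n. germ_eq (f \<circ> fst g) (fst u \<circ> f)"
      using conjugate_fixator[OF F f(2)] by blast
    have "inv\<^bsub>NG F\<^esub> x \<otimes>\<^bsub>NG F\<^esub> b \<otimes>\<^bsub>NG F\<^esub> x \<in> germ_fixator F n" if b: "b \<in> germ_fixator F m" for b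
    proof -
      obtain u where u: "u \<in> ball_fixator F m" "b = germ u" using b by (auto simp: germ_fixator_def)
      obtain g where g: "g \<in> ball_fixator F n" "germ_eq (f \<circ> fst g) (fst u \<circ> f)" using m[OF u(1)] by blast
      have al: "almost (U F) (fst u)" "almost (U F) (fst g)"
        using almost_aut[OF U_Aut] ball_fixatorD(1) u(1) g(1) by blast+
      have ff: "finite_fibres (f \<circ> fst g)" using almost_finite_fibres[OF almost_comp[OF H f(2) al(2)]] .
      have "germ_eq (f' \<circ> (fst u \<circ> f)) (f' \<circ> (f \<circ> fst g))"
        using germ_eq_sym[OF germ_eq_comp[OF germ_eq_refl g(2) ff]] .
      also have "germ_eq (f' \<circ> (f \<circ> fst g)) (id \<circ> fst g)"
        using germ_eq_comp[OF f'(2) germ_eq_refl almost_finite_fibres[OF al(2)]] by (simp add: o_assoc)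
      finally have "cls (f' \<circ> (fst u \<circ> f)) = germ g" using cls_cong by (simp add: germ_def)
      moreover have "inv\<^bsub>NG F\<^esub> x \<otimes>\<^bsub>NG F\<^esub> b \<otimes>\<^bsub>NG F\<^esub> x = cls (f' \<circ> (fst u \<circ> f))"
        using ix f u(2) f'(1) al(1) almost_comp[OF H f'(1) al(1)]
        by (simp add: germ_def neretin_mult almost_Aut o_assoc)
      ultimately show ?thesis using g(1) by (simp add: germ_fixator_def)
    qed
    then show ?thesis by blast
  qed
  have mono: "germ_fixator F n \<subseteq> germ_fixator F m" if "m \<le> n" for m n
    using tree_ball_mono[OF that] by (auto simp: germ_fixator_def ball_fixator_def)
  show ?thesis
    by (intro filtered_group.intro filtered_group_axioms.intro neretin_group_group
        germ_fixator_subgroup mono conj)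
qed

end

section \<open>The permutation topology\<close>

abbreviation "UT \<equiv> universal_group_topology \<Gamma>"

definition cylinder :: "('c \<Rightarrow> 'c) set \<Rightarrow> ('v \<Rightarrow> 'v) \<times> ('e \<Rightarrow> 'e) \<Rightarrow> nat \<Rightarrow> (('v \<Rightarrow> 'v) \<times> ('e \<Rightarrow> 'e)) set" where
  "cylinder F h n = {g \<in> U F. \<forall>x\<in>tree_ball n. fst g x = fst h x}"

abbreviation "pointwise \<equiv> product_topology (\<lambda>_ :: 'v. discrete_topology (UNIV :: 'v set)) UNIV"

lemma openin_pointwise_cylinder: "finite A \<Longrightarrow> openin pointwise {f'. \<forall>x\<in>A. f' x = f x}"
proof -
  assume A: "finite A"
  have "{f'. \<forall>x\<in>A. f' x = f x} = PiE UNIV (\<lambda>x. if x \<in> A then {f x} else UNIV)"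
    by (auto simp: PiE_def Pi_def extensional_def split: if_splits)
  moreover have "{i. (if i \<in> A then {f i} else UNIV) \<noteq> UNIV} \<subseteq> A" by auto
  then have "finite {i. (if i \<in> A then {f i} else UNIV) \<noteq> UNIV}" using A by (rule finite_subset)
  ultimately show ?thesis by (simp add: openin_PiE_gen)
qed

lemma openin_pointwise_finite:
  assumes "openin pointwise W" "f \<in> W"
  shows "\<exists>A. finite A \<and> (\<forall>f'. (\<forall>x\<in>A. f' x = f x) \<longrightarrow> f' \<in> W)"
proof -
  obtain V where V: "finite {i. V i \<noteq> (UNIV :: 'v set)}" "f \<in> PiE UNIV V" "PiE UNIV V \<subseteq> W"
    using assms unfolding openin_product_topology_alt by fastforce
  have "f' \<in> W" if "\<forall>x\<in>{i. V i \<noteq> UNIV}. f' x = f x" for f'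
  proof -
    have "f' x \<in> V x" for x using that V(2) by (cases "V x = UNIV") (auto simp: PiE_def Pi_def)
    then show ?thesis using V(3) by auto
  qed
  then show ?thesis using V(1) by blast
qed

text \<open>Basic open sets prescribe the images of finitely many vertices, and finitely many
  vertices lie in a ball.\<close>

lemma openin_UT:
  "openin (UT F) W \<longleftrightarrow> W \<subseteq> U F \<and> (\<forall>h\<in>W. \<exists>n. cylinder F h n \<subseteq> W)"
proof -
  have eq: "openin (UT F) W \<longleftrightarrow> (\<exists>V. openin pointwise V \<and> W = fst -` V \<inter> U F)"
  proof -
    have key: "fst -` V \<inter> Aut \<inter> U F = fst -` V \<inter> U F" for V :: "('v \<Rightarrow> 'v) set"
      using U_Aut[of F] by blast
    have "openin (UT F) W \<longleftrightarrow> (\<exists>T. (\<exists>V. openin pointwise V \<and> T = fst -` V \<inter> Aut) \<and> W = T \<inter> U F)"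
      unfolding universal_group_topology_def automorphism_topology_def openin_subtopology
        openin_pullback_topology ..
    also have "\<dots> \<longleftrightarrow> (\<exists>V. openin pointwise V \<and> W = fst -` V \<inter> Aut \<inter> U F)" by blast
    finally show ?thesis unfolding key .
  qed
  show ?thesis
    unfolding eq
  proof (intro iffI conjI ballI)
    assume "\<exists>V. openin pointwise V \<and> W = fst -` V \<inter> U F"
    then obtain V where V: "openin pointwise V" "W = fst -` V \<inter> U F" by blast
    then show "W \<subseteq> U F" by blast
    fix h assume "h \<in> W"
    then obtain A where A: "finite A" "\<And>f'. (\<forall>x\<in>A. f' x = fst h x) \<Longrightarrow> f' \<in> V"
      using openin_pointwise_finite[OF V(1), of "fst h"] V(2) by blast
    obtain n where n: "A \<subseteq> tree_ball n" using finite_subset_tree_ball[OF A(1)] by blast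
    have "cylinder F h n \<subseteq> W"
    proof
      fix g assume g: "g \<in> cylinder F h n"
      then have "fst g \<in> V" using n by (intro A(2)) (auto simp: cylinder_def)
      then show "g \<in> W" using g V(2) by (simp add: cylinder_def)
    qed
    then show "\<exists>n. cylinder F h n \<subseteq> W" by blast
  next
    assume W: "W \<subseteq> U F \<and> (\<forall>h\<in>W. \<exists>n. cylinder F h n \<subseteq> W)"
    then obtain n where n: "\<And>h. h \<in> W \<Longrightarrow> cylinder F h (n h) \<subseteq> W" by metis
    let ?V = "\<Union>h\<in>W. {f'. \<forall>x\<in>tree_ball (n h). f' x = fst h x}"
    have "openin pointwise ?V" using openin_pointwise_cylinder[OF finite_tree_ball] by (intro openin_Union) blast
    moreover have "W = fst -` ?V \<inter> U F"
    proof (intro equalityI subsetI)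
      fix g assume "g \<in> fst -` ?V \<inter> U F"
      then obtain h where "h \<in> W" "g \<in> cylinder F h (n h)" by (auto simp: cylinder_def)
      then show "g \<in> W" using n by blast
    qed (use W in auto)
    ultimately show "\<exists>V. openin pointwise V \<and> W = fst -` V \<inter> U F" by blast
  qed
qed

lemma topspace_UT: "topspace (UT F) = U F"
proof
  show "topspace (UT F) \<subseteq> U F" using openin_topspace[of "UT F"] unfolding openin_UT by blast
  show "U F \<subseteq> topspace (UT F)"
    by (rule openin_subset) (unfold openin_UT, auto simp: cylinder_def)
qed

lemma openin_cylinder: "openin (UT F) (cylinder F h n)"
  unfolding openin_UT by (auto simp: cylinder_def intro!: exI[of _ n])

text \<open>A pointwise limit \<open>f\<close> agrees on each ball with some group element
  \<open>G n\<close>. The local action at a vertex is visible on a finite ball, so the local actions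
  of the \<open>G n\<close> stabilise to a portrait with values in \<open>F\<close>; the
  automorphism with this portrait has vertex map \<open>f\<close>.\<close>

lemma base_stabilizer_closed:
  assumes F: "subgroup F Sym"
  shows "closedin pointwise (fst ` base_stabilizer \<Gamma> (U F))"
proof -
  let ?C = "fst ` base_stabilizer \<Gamma> (U F)"
  have "f \<in> ?C" if f: "f \<in> pointwise closure_of ?C" for f
  proof -
    have "\<exists>g. g \<in> base_stabilizer \<Gamma> (U F) \<and> (\<forall>x\<in>tree_ball n. fst g x = f x)" for n
    proof -
      have "\<exists>y. y \<in> ?C \<and> y \<in> {f'. \<forall>x\<in>tree_ball n. f' x = f x}"
        by (rule f[unfolded in_closure_of, THEN conjunct2, THEN spec, THEN mp])
          (use openin_pointwise_cylinder[OF finite_tree_ball, of n f] in simp)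
      then show ?thesis by auto
    qed
    then obtain G where G: "\<And>n. G n \<in> base_stabilizer \<Gamma> (U F)" "\<And>n x. x \<in> tree_ball n \<Longrightarrow> fst (G n) x = f x"
      by metis
    have GU: "G n \<in> U F" for n using G(1)[of n] by (simp add: base_stabilizer_def)
    then have GA: "G n \<in> Aut" for n using U_Aut by blast
    \<comment> \<open>The local action at \<open>x\<close> involves the neighbours of
      \<open>x\<close>, which may lie one level higher.\<close>
    define \<pi> where "\<pi> x = loc (G (Suc (level x))) x" for x
    have \<pi>: "loc (G m) x = \<pi> x" if "m \<ge> Suc (level x)" for m x
    proof
      fix c
      have "x \<in> tree_ball k \<and> nbr x c \<in> tree_ball k" if "k \<ge> Suc (level x)" for k
        using that level_nbr_le[of x c] by (auto simp: tree_ball_def)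
      then show "loc (G m) x c = \<pi> x c"
        unfolding \<pi>_def using GA G(2) that by (intro loc_determined) (metis order_refl)+
    qed
    have compat: "\<pi> (nbr x c) c = \<pi> x c" for x c
      using \<pi>[of "nbr x c" "Suc (max (level x) (level (nbr x c)))"] \<pi>[of x "Suc (max (level x) (level (nbr x c)))"]
        loc_nbr[OF GA, of "Suc (max (level x) (level (nbr x c)))" x c] by simp
    have \<pi>_F: "\<pi> x \<in> F" for x unfolding \<pi>_def using universal_groupD(2)[OF GU] .
    obtain g where g: "g \<in> U F" "fst g (base \<Gamma>) = base \<Gamma>" "\<And>x. loc g x = \<pi> x"
      using portrait_universal[of F \<pi> "base \<Gamma>" "base \<Gamma>", OF F \<pi>_F compat] by blast
    have "fst g x = f x" for x
    proof (induction x rule: tree_induct[of _ "base \<Gamma>"])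
      case 1
      have "f (base \<Gamma>) = fst (G 0) (base \<Gamma>)" using G(2)[of "base \<Gamma>" 0] by (simp add: tree_ball_def)
      then show ?case using g(2) G(1)[of 0] by (simp add: base_stabilizer_def)
    next
      case (2 x c)
      let ?m = "Suc (level x)"
      have "f (nbr x c) = fst (G ?m) (nbr x c)" "f x = fst (G ?m) x"
        using G(2)[of _ ?m] level_nbr_le[of x c] by (auto simp: tree_ball_def)
      then show ?case using 2 universal_groupD(1)[OF g(1)] GA by (simp add: aut_nbr g(3) \<pi>)
    qed
    then have "fst g = f" by auto
    then show ?thesis using g by (auto simp: base_stabilizer_def)
  qed
  then show ?thesis by (simp add: closure_of_subset_eq[symmetric] subset_eq)
qed

text \<open>Level is not raised, so the vertex maps form a closed subset of a product of finite
  balls, which is compact by Tychonoff's theorem.\<close>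

lemma compactin_base_stabilizer:
  assumes F: "subgroup F Sym" shows "compactin (UT F) (base_stabilizer \<Gamma> (U F))"
proof -
  let ?K = "base_stabilizer \<Gamma> (U F)"
  let ?P = "PiE UNIV (\<lambda>x. tree_ball (level x))"
  have KU: "?K \<subseteq> U F" by (auto simp: base_stabilizer_def)
  have "compactin pointwise ?P"
    unfolding compactin_PiE by (simp add: finite_imp_compactin finite_tree_ball)
  moreover have "fst ` ?K \<subseteq> ?P"
    using aut_level_le KU U_Aut by (fastforce simp: base_stabilizer_def tree_ball_def)
  ultimately have "compactin pointwise (fst ` ?K)"
    using closed_compactin base_stabilizer_closed[OF F] by blast
  then have "compactin (automorphism_topology \<Gamma>) ?K"
    unfolding automorphism_topology_def using KU U_Aut by (intro compactin_pullback_topology) auto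
  then show ?thesis unfolding universal_group_topology_def compactin_subtopology using KU by simp
qed

context
  fixes F :: "('c \<Rightarrow> 'c) set"
  assumes F: "subgroup F Sym"
begin

interpretation filtered_group "NG F" "germ_fixator F"
  by (rule filtered_neretin[OF F])

lemma germ_coset:
  assumes h: "h \<in> U F" shows "germ h <#\<^bsub>NG F\<^esub> germ_fixator F n = germ ` cylinder F h n"
proof (intro equalityI subsetI)
  have hA: "h \<in> Aut" using h U_Aut by blast
  fix y assume "y \<in> germ h <#\<^bsub>NG F\<^esub> germ_fixator F n"
  then obtain u where u: "u \<in> ball_fixator F n" "y = germ h \<otimes>\<^bsub>NG F\<^esub> germ u"
    by (auto simp: mem_l_coset_iff germ_fixator_def)
  then have "y = germ (pair_comp h u)" using germ_mult hA ball_fixatorD(2) by simp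
  moreover have "pair_comp h u \<in> cylinder F h n"
    using u(1) U_comp[OF F h ball_fixatorD(1)] by (simp add: cylinder_def ball_fixatorD(3))
  ultimately show "y \<in> germ ` cylinder F h n" by blast
next
  have hA: "h \<in> Aut" using h U_Aut by blast
  fix y assume "y \<in> germ ` cylinder F h n"
  then obtain g where g: "g \<in> cylinder F h n" "y = germ g" by blast
  then have gU: "g \<in> U F" "g \<in> Aut" using U_Aut by (auto simp: cylinder_def)
  let ?u = "pair_comp (pair_inv h) g"
  have "?u \<in> ball_fixator F n"
    using g(1) U_comp[OF F U_inv[OF F h] gU(1)] by (simp add: ball_fixator_def cylinder_def aut_inv_apply[OF hA])
  moreover have "pair_comp h ?u = g"
    by (rule prod_eqI) (auto simp: fun_eq_iff aut_inv_apply[OF hA])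
  then have "y = germ h \<otimes>\<^bsub>NG F\<^esub> germ ?u"
    using germ_mult[OF hA, of ?u F] aut_comp[OF aut_inv[OF hA] gU(2)] g(2) by simp
  ultimately show "y \<in> germ h <#\<^bsub>NG F\<^esub> germ_fixator F n"
    unfolding mem_l_coset_iff germ_fixator_def by blast
qed

text \<open>By \<open>germ_coset\<close> the map \<open>germ\<close> takes cylinders to cosets of
  the germ fixators; this gives continuity and openness at once.\<close>

lemma neretin_topology_eq: "neretin_topology \<Gamma> F = coset_topology (NG F) (germ_fixator F)"
  and continuous_germ: "continuous_map (UT F) (coset_topology (NG F) (germ_fixator F)) germ"
proof -
  have i: "class_of_automorphism \<Gamma> h = germ h" if "h \<in> U F" for h
    using that U_Aut class_of_automorphism_germ by blast
  have im: "germ ` topspace (UT F) \<subseteq> carrier (NG F)" using germ_in by (auto simp: topspace_UT)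
  have co: "\<exists>W. openin (UT F) W \<and> h \<in> W \<and> germ ` W \<subseteq> germ h <#\<^bsub>NG F\<^esub> germ_fixator F n"
    if "h \<in> topspace (UT F)" for h n
    using that germ_coset[of h n] openin_cylinder[of F h n]
    by (intro exI[of _ "cylinder F h n"]) (auto simp: topspace_UT cylinder_def)
  show "continuous_map (UT F) (coset_topology (NG F) (germ_fixator F)) germ"
    by (rule continuous_coset_topology[OF im co])
  show "neretin_topology \<Gamma> F = coset_topology (NG F) (germ_fixator F)"
    unfolding neretin_topology_def
  proof (rule group_topology_via_eq)
    show "class_of_automorphism \<Gamma> ` topspace (UT F) \<subseteq> carrier (NG F)" using im i by (auto simp: topspace_UT)
    show "(id, id) \<in> topspace (UT F)" using U_id[OF F] by (simp add: topspace_UT)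
    show "class_of_automorphism \<Gamma> (id, id) = \<one>\<^bsub>NG F\<^esub>" using i[OF U_id[OF F]] by (simp add: germ_one)
    fix W h assume W: "openin (UT F) W" and h: "h \<in> W"
    then obtain n where n: "cylinder F h n \<subseteq> W" "W \<subseteq> U F" unfolding openin_UT by blast
    have "germ ` W = class_of_automorphism \<Gamma> ` W" using i n(2) by (intro image_cong) auto
    moreover have hU: "h \<in> U F" using h n(2) by blast
    ultimately show "\<exists>n. class_of_automorphism \<Gamma> h <#\<^bsub>NG F\<^esub> germ_fixator F n \<subseteq> class_of_automorphism \<Gamma> ` W"
      using germ_coset[OF hU, of n] i[OF hU] image_mono[OF n(1), of germ] by (metis (no_types))
  next
    fix h n assume h: "h \<in> topspace (UT F)"
    obtain W where W: "openin (UT F) W" "h \<in> W" "germ ` W \<subseteq> germ h <#\<^bsub>NG F\<^esub> germ_fixator F n"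
      using co[OF h] by blast
    have "germ ` W = class_of_automorphism \<Gamma> ` W"
      using i openin_subset[OF W(1)] by (intro image_cong) (auto simp: topspace_UT)
    then show "\<exists>W. openin (UT F) W \<and> h \<in> W \<and>
        class_of_automorphism \<Gamma> ` W \<subseteq> class_of_automorphism \<Gamma> h <#\<^bsub>NG F\<^esub> germ_fixator F n"
      using W i[of h] h by (intro exI[of _ W]) (auto simp: topspace_UT)
  qed
qed

lemma topological_group_neretin: "topological_group (NG F) (neretin_topology \<Gamma> F)"
  unfolding neretin_topology_eq by (rule topological_group_coset_topology)

lemma openin_germ_fixator: "openin (neretin_topology \<Gamma> F) (germ_fixator F n)"
  unfolding neretin_topology_eq by (rule openin_B)

text \<open>An element of all germ fixators lifts to an automorphism for each radius. Injectivity of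
  \<open>germ\<close> makes these lifts equal, so the lift fixes every vertex.\<close>

lemma Hausdorff_neretin: "Hausdorff_space (neretin_topology \<Gamma> F)"
  unfolding neretin_topology_eq
proof (rule Hausdorff_coset_topology)
  fix x assume x: "\<And>n. x \<in> germ_fixator F n"
  then have "\<forall>n. \<exists>g\<in>ball_fixator F n. x = germ g" unfolding germ_fixator_def by blast
  then obtain g where g: "\<And>n. g n \<in> ball_fixator F n" "\<And>n. x = germ (g n)" by metis
  have eq: "g n = g 0" for n
    using g germ_eq_iff[of "g n" "g 0"] ball_fixatorD(2) by metis
  have "fst (g 0) y = y" for y
    using ball_fixatorD(3)[OF g(1)[of "level y"], of y] unfolding eq[of "level y"] by (simp add: tree_ball_def)
  then have "g 0 = (id, id)" using ball_fixatorD(2)[OF g(1)] Aut_id by (intro aut_eqI) auto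
  then show "x = \<one>\<^bsub>NG F\<^esub>" using g(2)[of 0] by (simp add: germ_one)
qed

lemma compactin_germ_stabilizer:
  "compactin (neretin_topology \<Gamma> F) (germ ` base_stabilizer \<Gamma> (U F))"
  unfolding neretin_topology_eq
  by (rule image_compactin[OF compactin_base_stabilizer[OF F] continuous_germ])

end

end

section \<open>Permutation groups\<close>

lemma Sym_simps:
  "carrier Sym = {f. bij f}" "bij f \<Longrightarrow> bij g \<Longrightarrow> f \<otimes>\<^bsub>Sym\<^esub> g = f \<circ> g" "\<one>\<^bsub>Sym\<^esub> = id"
  by (auto simp: BijGroup_def Bij_def compose_def restrict_def o_def id_def)

lemma Sym_inv: "bij f \<Longrightarrow> inv\<^bsub>Sym\<^esub> f = finv f"
  using inv_BijGroup[of f UNIV] by (simp add: Bij_def restrict_def)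

lemma Sym_subgroupI:
  assumes "\<And>f. f \<in> X \<Longrightarrow> bij f" "id \<in> X" "\<And>f g. f \<in> X \<Longrightarrow> g \<in> X \<Longrightarrow> f \<circ> g \<in> X"
    "\<And>f. f \<in> X \<Longrightarrow> finv f \<in> X"
  shows "subgroup X Sym"
  by (rule subgroup.intro) (use assms in \<open>auto simp: Sym_simps(1,2) Sym_simps(3)[unfolded id_def] id_def Sym_inv\<close>)

lemma perm_group_simps:
  assumes "subgroup X Sym"
  shows "carrier (perm_group X) = X" "f \<in> X \<Longrightarrow> g \<in> X \<Longrightarrow> f \<otimes>\<^bsub>perm_group X\<^esub> g = f \<circ> g"
    "\<one>\<^bsub>perm_group X\<^esub> = id" "f \<in> X \<Longrightarrow> inv\<^bsub>perm_group X\<^esub> f = finv f" "group (perm_group X)"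
proof -
  note D = Sym_subgroupD[OF assms]
  interpret group "Sym :: ('a \<Rightarrow> 'a) monoid" by (rule group_BijGroup)
  show "carrier (perm_group X) = X" by (simp add: perm_group_def)
  show "f \<in> X \<Longrightarrow> g \<in> X \<Longrightarrow> f \<otimes>\<^bsub>perm_group X\<^esub> g = f \<circ> g"
    using D(4) by (simp add: perm_group_def Sym_simps)
  show "\<one>\<^bsub>perm_group X\<^esub> = id" by (simp add: perm_group_def Sym_simps)
  show "f \<in> X \<Longrightarrow> inv\<^bsub>perm_group X\<^esub> f = finv f"
    unfolding perm_group_def using m_inv_consistent[OF assms] D(4) by (simp add: Sym_inv)
  show "group (perm_group X)"
    unfolding perm_group_def using subgroup.subgroup_is_group[OF assms] group_BijGroup by blast
qed

lemma perm_group_pow: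
  assumes X: "subgroup X Sym" and f: "f \<in> X"
  shows "f [^]\<^bsub>perm_group X\<^esub> (n::nat) = f ^^ n \<and> f ^^ n \<in> X"
proof (induction n)
  case 0
  then show ?case using Sym_subgroupD(1)[OF X] by (simp add: perm_group_simps[OF X] id_def)
next
  case (Suc n)
  then show ?case
    using f Sym_subgroupD(2)[OF X, of "f ^^ n" f] perm_group_simps(2)[OF X, of "f ^^ n" f]
    unfolding funpow_Suc_right nat_pow_Suc by metis
qed

lemma point_stabilizer_eq: "point_stabilizer F \<omega> = {f \<in> F. f \<omega> = \<omega>}"
  by (simp add: point_stabilizer_def stabilizer_def perm_group_def)

lemma perm_orbits_eq: "perm_orbits F = (\<lambda>x. (\<lambda>f. f x) ` F) ` UNIV"
  by (auto simp: perm_orbits_def orbits_def orbit_def perm_group_def)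

lemma point_stabilizer_subgroup:
  assumes F: "subgroup F Sym" shows "subgroup (point_stabilizer F \<omega>) Sym"
proof (rule Sym_subgroupI)
  note D = Sym_subgroupD[OF F]
  show "finv f \<in> point_stabilizer F \<omega>" if f: "f \<in> point_stabilizer F \<omega>" for f
  proof -
    have "finv f \<omega> = \<omega>" using f D(4) inv_f_f[of f \<omega>] by (simp add: point_stabilizer_eq bij_is_inj)
    then show ?thesis using f D(3) by (simp add: point_stabilizer_eq)
  qed
qed (use Sym_subgroupD[OF F] in \<open>auto simp: point_stabilizer_eq\<close>)

lemma card_orbit_stabilizer:
  fixes F :: "('c::finite \<Rightarrow> 'c) set"
  assumes F: "subgroup F Sym"
  shows "card ((\<lambda>f. f \<omega>) ` F) * card (point_stabilizer F \<omega>) = card F"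
proof -
  note S = perm_group_simps[OF F]
  have "group_action (perm_group F) UNIV (\<lambda>f. f)"
    unfolding group_action_def group_hom_def group_hom_axioms_def
  proof (intro conjI)
    show "(\<lambda>f. f) \<in> hom (perm_group F) Sym"
      using Sym_subgroupD(4)[OF F] unfolding hom_def by (auto simp: S Sym_simps)
  qed (use S(5) group_BijGroup in auto)
  from group_action.orbit_stabilizer_theorem[OF this, of \<omega>]
  show ?thesis
    by (simp add: point_stabilizer_def orbit_def S(1) order_def setcompr_eq_image)
qed

text \<open>\<open>R\<close> is a \<open>p\<close>-group because its elements have
  \<open>p\<close>-power order. Its order divides that of \<open>B\<close>, so it cannot exceed the
  \<open>p\<close>-part of the latter, which is the size of \<open>A\<close>.\<close>

lemma sylow_maximal:
  fixes B :: "('c::finite \<Rightarrow> 'c) set"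
  assumes p: "prime p" and B: "subgroup B Sym" and R: "subgroup R Sym" and sub: "A \<subseteq> R" "R \<subseteq> B"
    and card: "card A = p ^ multiplicity p (card B)"
    and pow: "\<And>r. r \<in> R \<Longrightarrow> \<exists>k. r ^^ (p ^ k) = id"
  shows "R = A"
proof -
  have "\<exists>n. order (perm_group R) = p ^ n"
    using p_group_order[OF perm_group_simps(5)[OF R] _ p] pow perm_group_pow[OF R]
    by (simp add: perm_group_simps[OF R])
  then obtain n where n: "card R = p ^ n" by (auto simp: order_def perm_group_simps[OF R])
  interpret S: group "Sym :: ('c \<Rightarrow> 'c) monoid" by (rule group_BijGroup)
  have "subgroup R (perm_group B)" unfolding perm_group_def by (rule S.subgroup_incl[OF R B sub(2)])
  from group.lagrange_finite[OF perm_group_simps(5)[OF B] _ this]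
  have "card R dvd card B" by (metis dvd_triv_right order_def perm_group_simps(1)[OF B] finite)
  moreover have "card B \<noteq> 0" using Sym_subgroupD(1)[OF B] by (auto simp: card_eq_0_iff)
  ultimately have "n \<le> multiplicity p (card B)" using n p by (intro multiplicity_geI) auto
  then have "card R \<le> card A" using n card prime_gt_0_nat[OF p] by (simp add: power_increasing)
  then show ?thesis using card_seteq[OF _ sub(1)] by (metis finite)
qed

text \<open>Orbit and stabilizer for both groups on the common orbit. As a \<open>P\<close>-orbit it
  has \<open>p\<close>-power size, so passing to stabilizers removes the same power of
  \<open>p\<close> from the order of \<open>P\<close> and from the \<open>p\<close>-part of the
  order of \<open>F\<close>.\<close>

lemma stabilizer_sylow:
  fixes F :: "('c::finite \<Rightarrow> 'c) set"
  assumes p: "prime p" and F: "subgroup F Sym" and P: "subgroup P Sym"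
    and card: "card P = p ^ multiplicity p (card F)" and orb: "(\<lambda>f. f \<omega>) ` F = (\<lambda>f. f \<omega>) ` P"
  shows "card (point_stabilizer P \<omega>) = p ^ multiplicity p (card (point_stabilizer F \<omega>))"
proof -
  let ?o = "card ((\<lambda>f. f \<omega>) ` P)"
  have eF: "?o * card (point_stabilizer F \<omega>) = card F" using card_orbit_stabilizer[OF F, of \<omega>] orb by simp
  have eP: "?o * card (point_stabilizer P \<omega>) = p ^ multiplicity p (card F)"
    using card_orbit_stabilizer[OF P, of \<omega>] card by simp
  obtain b c where bc: "?o = p ^ b" "card (point_stabilizer P \<omega>) = p ^ c"
    using divides_primepow_nat[OF p] eP by (metis dvd_triv_left dvd_triv_right)
  have pe: "prime_elem p" using p by simp
  have "card F \<noteq> 0" using Sym_subgroupD(1)[OF F] by (auto simp: card_eq_0_iff)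
  then have nz: "?o \<noteq> 0" "card (point_stabilizer F \<omega>) \<noteq> 0" using eF by (metis mult_0, metis mult_0_right)
  have "p ^ (b + c) = p ^ multiplicity p (card F)" using eP bc by (simp add: power_add)
  then have "b + c = multiplicity p (card F)" using power_inject_exp[OF prime_gt_1_nat[OF p]] by blast
  also have "\<dots> = b + multiplicity p (card (point_stabilizer F \<omega>))"
    using prime_elem_multiplicity_mult_distrib[OF pe nz] eF bc(1) pe by simp
  finally show ?thesis using bc(2) by simp
qed

section \<open>Powers of automorphisms\<close>

definition pair_pow :: "('a \<Rightarrow> 'a) \<times> ('b \<Rightarrow> 'b) \<Rightarrow> nat \<Rightarrow> ('a \<Rightarrow> 'a) \<times> ('b \<Rightarrow> 'b)" where
  "pair_pow g n = (fst g ^^ n, snd g ^^ n)"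

lemma pair_pow_simps:
  "pair_pow g 0 = (id, id)" "pair_pow g (Suc n) = pair_comp (pair_pow g n) g"
  "pair_pow (pair_pow g m) n = pair_pow g (m * n)"
  by (simp_all add: pair_pow_def pair_comp_def funpow_Suc_right funpow_mult del: funpow.simps(2))

section \<open>The stabilizer in \<open>U P\<close> as a pro-p subgroup\<close>

locale local_sylow_tree = colored_tree \<Gamma> for \<Gamma> :: "('v, 'e, 'c :: finite) colored_graph" +
  fixes F P :: "('c \<Rightarrow> 'c) set" and p :: nat
  assumes prime_p: "prime p" and F: "subgroup F Sym" and P_sylow: "sylow_subgroup p (perm_group F) P"
    and orbits_eq: "perm_orbits F = perm_orbits P"
begin

lemma P_subset: "P \<subseteq> F" and P: "subgroup P Sym" and card_P: "card P = p ^ multiplicity p (card F)"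
proof -
  have s: "subgroup P (Sym\<lparr>carrier := F\<rparr>)" and c: "card P = p ^ multiplicity p (card F)"
    using P_sylow by (simp_all add: sylow_subgroup_def perm_group_def order_def)
  show "P \<subseteq> F" using subgroup.subset[OF s] by simp
  show "subgroup P Sym" using group.incl_subgroup[OF group_BijGroup F s] .
  show "card P = p ^ multiplicity p (card F)" by (rule c)
qed

text \<open>The hypothesis equates the two partitions as sets of blocks; the block that contains
  \<omega> is its orbit under either group.\<close>

lemma orbit_eq: "(\<lambda>f. f \<omega>) ` F = (\<lambda>f. f \<omega>) ` P"
proof -
  note DP = Sym_subgroupD[OF P] and DF = Sym_subgroupD[OF F]
  have "(\<lambda>f. f \<omega>) ` F \<in> perm_orbits P" unfolding orbits_eq[symmetric] by (auto simp: perm_orbits_eq)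
  then obtain x where x: "(\<lambda>f. f \<omega>) ` F = (\<lambda>f. f x) ` P" by (auto simp: perm_orbits_eq)
  have "\<omega> \<in> (\<lambda>f. f \<omega>) ` F" using DF(1) by (intro image_eqI[of _ _ id]) auto
  then obtain q where q: "q \<in> P" "\<omega> = q x" using x by auto
  have xq: "finv q \<omega> = x" using q DP(4) by (simp add: bij_is_inj)
  have "f x \<in> (\<lambda>f. f \<omega>) ` P" if "f \<in> P" for f
    using that DP(2)[OF that DP(3)[OF q(1)]] xq by (intro image_eqI[of _ _ "f \<circ> finv q"]) auto
  then have "(\<lambda>f. f \<omega>) ` F \<subseteq> (\<lambda>f. f \<omega>) ` P" using x by auto
  then show ?thesis using P_subset by blast
qed

lemma UP_UF: "U P \<subseteq> U F"
  using P_subset by (auto simp: universal_group_def)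

lemma base_stabilizer_eq: "base_stabilizer \<Gamma> (U X) = ball_fixator X 0"
  by (auto simp: base_stabilizer_def ball_fixator_def tree_ball_def)

abbreviation "\<tau> \<equiv> neretin_topology \<Gamma> F"
abbreviation "S \<equiv> germ_fixator P 0"

lemma germ_image_ball_fixator: "class_of_automorphism \<Gamma> ` base_stabilizer \<Gamma> (U X) = germ_fixator X 0"
  unfolding base_stabilizer_eq germ_fixator_def
  using class_of_automorphism_germ ball_fixatorD(2) by (intro image_cong) auto

text \<open>Holds by injectivity of \<open>germ\<close>. It says that the filtrations of the Neretin
  groups of \<open>F\<close> and of \<open>P\<close> induce the same filtration on \<open>S\<close>,
  and with it the same topology.\<close>

lemma germ_fixator_Int_S: "germ_fixator F n \<inter> S = germ_fixator P n"
proof (intro equalityI subsetI)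
  fix x assume x: "x \<in> germ_fixator F n \<inter> S"
  then obtain g h where gh: "g \<in> ball_fixator F n" "x = germ g" "h \<in> ball_fixator P 0" "x = germ h"
    by (auto simp: germ_fixator_def)
  then have "g = h" using germ_eq_iff[of g h] ball_fixatorD(2) by metis
  then show "x \<in> germ_fixator P n" using gh by (auto simp: germ_fixator_def ball_fixator_def)
next
  fix x assume "x \<in> germ_fixator P n"
  moreover have "ball_fixator P n \<subseteq> ball_fixator F n" "ball_fixator P n \<subseteq> ball_fixator P 0"
    using UP_UF tree_ball_mono[of 0 n] by (auto simp: ball_fixator_def)
  ultimately show "x \<in> germ_fixator F n \<inter> S" by (auto simp: germ_fixator_def)
qed

lemma ball_fixator_P_F: "ball_fixator P n \<subseteq> ball_fixator F n"
  using UP_UF by (auto simp: ball_fixator_def)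

lemma ball_fixator_pow:
  "subgroup X Sym \<Longrightarrow> g \<in> ball_fixator X n \<Longrightarrow> pair_pow g m \<in> ball_fixator X n"
  by (induction m) (simp_all add: pair_pow_simps ball_fixator_closed)

lemma S_subgroup: "subgroup S (NG F)"
  unfolding germ_fixator_def
  by (rule germ_subgroup[OF F]) (use ball_fixator_closed[OF P] UP_UF in \<open>auto simp: ball_fixatorD(1) subset_eq\<close>)

lemma compactin_S: "compactin \<tau> S"
proof -
  have "compactin (automorphism_topology \<Gamma>) (base_stabilizer \<Gamma> (U P))"
    using compactin_base_stabilizer[OF P] unfolding universal_group_topology_def compactin_subtopology by simp
  moreover have "base_stabilizer \<Gamma> (U P) \<subseteq> U F" using UP_UF by (auto simp: base_stabilizer_def)
  ultimately have "compactin (UT F) (base_stabilizer \<Gamma> (U P))"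
    unfolding universal_group_topology_def compactin_subtopology by simp
  then have "compactin \<tau> (germ ` base_stabilizer \<Gamma> (U P))"
    unfolding neretin_topology_eq[OF F] by (rule image_compactin[OF _ continuous_germ[OF F]])
  then show ?thesis by (simp add: base_stabilizer_eq germ_fixator_def)
qed

lemma germ_pow: "g \<in> U X \<Longrightarrow> subgroup X Sym \<Longrightarrow> germ g [^]\<^bsub>NG F\<^esub> n = germ (pair_pow g n) \<and> pair_pow g n \<in> U X"
proof (induction n)
  case 0
  then show ?case using U_id by (simp add: pair_pow_simps germ_one)
next
  case (Suc n)
  then show ?case using U_comp U_Aut[of X] by (simp add: pair_pow_simps germ_mult subset_eq)
qed

lemma loc_pow:
  assumes g: "g \<in> Aut" and x: "fst g x = x"
  shows "loc (pair_pow g n) x = (loc g x) ^^ n"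
proof (induction n)
  case (Suc n)
  then show ?case using loc_comp[OF g, of "pair_pow g n" x] x
    by (simp add: pair_pow_simps funpow_Suc_right del: funpow.simps(2))
qed (simp add: pair_pow_simps)

lemma pow_card_P: assumes "\<sigma> \<in> P" shows "\<sigma> ^^ card P = id"
  using group.pow_order_eq_1[OF perm_group_simps(5)[OF P], of \<sigma>] perm_group_pow[OF P assms] assms
  by (simp add: perm_group_simps[OF P] order_def)

text \<open>Each layer of \<open>S\<close> is killed by the exponent of \<open>P\<close>, so \<open>S\<close> is residually a \<open>p\<close>-group.\<close>

lemma ball_fixator_layer:
  assumes g: "g \<in> ball_fixator P n" shows "pair_pow g (card P) \<in> ball_fixator P (Suc n)"
proof -
  note gD = ball_fixatorD[OF g]
  let ?h = "pair_pow g (card P)"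
  have h: "?h \<in> ball_fixator P n" using ball_fixator_pow[OF P g] .
  have loc: "loc ?h x = id" if "x \<in> tree_ball n" for x
    using loc_pow[OF gD(2) gD(3)[OF that]] pow_card_P[OF universal_groupD(2)[OF gD(1)]] by simp
  have "fst ?h y = y" if y: "y \<in> tree_ball (Suc n)" for y
  proof (cases "y \<in> tree_ball n")
    case True
    then show ?thesis using ball_fixatorD(3)[OF h] by blast
  next
    case False
    define c where "c = last (word (base \<Gamma>) y)"
    have "y \<noteq> base \<Gamma>" using False by (auto simp: tree_ball_def)
    then have x: "nbr y c \<in> tree_ball n" using y by (auto simp: tree_ball_def c_def level_nbr)
    have "fst ?h (nbr (nbr y c) c) = nbr (fst ?h (nbr y c)) (loc ?h (nbr y c) c)"
      using aut_nbr[OF ball_fixatorD(2)[OF h]] .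
    then show ?thesis using loc[OF x] ball_fixatorD(3)[OF h x] by simp
  qed
  then show ?thesis using ball_fixatorD(1)[OF h] by (simp add: ball_fixator_def)
qed

lemma pow_in_ball_fixator: "g \<in> ball_fixator P 0 \<Longrightarrow> \<exists>k. pair_pow g (p ^ k) \<in> ball_fixator P n"
proof (induction n)
  case 0
  then show ?case by (intro exI[of _ 0]) (simp add: pair_pow_def)
next
  case (Suc n)
  then obtain k where k: "pair_pow g (p ^ k) \<in> ball_fixator P n" by blast
  have "pair_pow g (p ^ k * card P) \<in> ball_fixator P (Suc n)"
    using ball_fixator_layer[OF k] by (simp add: pair_pow_simps)
  then show ?case using card_P by (intro exI[of _ "k + multiplicity p (card F)"]) (simp add: power_add)
qed

lemma open_in_S_small:
  assumes W: "openin (subtopology \<tau> S) W" "\<one>\<^bsub>NG F\<^esub> \<in> W"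
  shows "\<exists>n. germ_fixator P n \<subseteq> W"
proof -
  interpret fil: filtered_group "NG F" "germ_fixator F" by (rule filtered_neretin[OF F])
  obtain V where V: "openin \<tau> V" "W = V \<inter> S" using W(1) by (auto simp: openin_subtopology)
  then obtain n where "\<one>\<^bsub>NG F\<^esub> <#\<^bsub>NG F\<^esub> germ_fixator F n \<subseteq> V"
    using W(2) unfolding neretin_topology_eq[OF F] fil.openin_coset_topology by auto
  moreover have "\<one>\<^bsub>NG F\<^esub> <#\<^bsub>NG F\<^esub> germ_fixator F n = germ_fixator F n"
    using fil.B_carrier by (force simp: mem_l_coset_iff)
  ultimately have "germ_fixator P n \<subseteq> W" using germ_fixator_Int_S[of n] V(2) by blast
  then show ?thesis by blast
qed

lemma quotient_pow:
  assumes "group G" "N \<lhd> G" "x \<in> carrier G"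
  shows "(N #>\<^bsub>G\<^esub> x) [^]\<^bsub>G Mod N\<^esub> (n::nat) = N #>\<^bsub>G\<^esub> (x [^]\<^bsub>G\<^esub> n)"
  using hom_nat_pow[OF normal.r_coset_hom_Mod[OF assms(2)] assms(3,1) normal.factorgroup_is_group[OF assms(2)]]
  by simp

text \<open>An open normal subgroup contains the germ fixator of some ball. A \<open>p\<close>-power
  of each element of \<open>S\<close> falls into it, so the finite quotient is a
  \<open>p\<close>-group by \<open>p_group_order\<close>.\<close>

lemma pro_p_S: "pro_p_subgroup p (NG F) \<tau> S"
proof -
  let ?G = "(NG F)\<lparr>carrier := S\<rparr>" and ?\<tau> = "subtopology \<tau> S"
  note T = topological_group_neretin[OF F]
  interpret N: group "NG F" by (rule neretin_group_group[OF F])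
  note TS = topological_group_subgroup[OF T S_subgroup]
  interpret SG: group ?G using topological_groupD(1)[OF TS] .
  interpret fil: filtered_group "NG F" "germ_fixator F" by (rule filtered_neretin[OF F])
  have sub: "subgroup (germ_fixator P n) ?G" for n
  proof -
    have "subgroup (germ_fixator F n \<inter> S) (NG F)"
      using N.subgroups_Inter_pair[OF fil.B_subgroup S_subgroup] .
    then show ?thesis using N.subgroup_incl[OF _ S_subgroup] germ_fixator_Int_S[of n] by auto
  qed
  have op: "openin ?\<tau> (germ_fixator P n)" for n
    using openin_germ_fixator[OF F, of n] germ_fixator_Int_S[of n] by (auto simp: openin_subtopology)
  have cS: "compactin ?\<tau> S" using compactin_S by (simp add: compactin_subtopology)
  have "profinite_group ?G ?\<tau>"
    unfolding profinite_group_def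
  proof (intro conjI allI impI)
    show "topological_group ?G ?\<tau>" by (rule TS)
    show "compact_space ?\<tau>" using compactin_S by (rule compact_space_subtopology)
    show "Hausdorff_space ?\<tau>" using Hausdorff_neretin[OF F] by (rule Hausdorff_space_subtopology)
    fix W assume "openin ?\<tau> W \<and> \<one>\<^bsub>?G\<^esub> \<in> W"
    then show "\<exists>H. subgroup H ?G \<and> openin ?\<tau> H \<and> H \<subseteq> W" using open_in_S_small[of W] sub op by auto
  qed
  moreover have "\<exists>n. order (?G Mod N) = p ^ n" if N: "N \<lhd> ?G" "openin ?\<tau> N" for N
  proof (rule p_group_order)
    interpret nor: normal N ?G by (rule N(1))
    show "group (?G Mod N)" by (rule nor.factorgroup_is_group)
    show "prime p" by (rule prime_p)
    have "finite_index ?G S N"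
      using compact_open_finite_index[OF TS SG.subgroup_self[simplified] cS nor.subgroup_axioms _ N(2)] nor.subset
      by simp
    then show "finite (carrier (?G Mod N))" by (simp add: finite_index_def FactGroup_def)
    fix C assume "C \<in> carrier (?G Mod N)"
    then obtain x where x: "x \<in> S" "C = N #>\<^bsub>?G\<^esub> x" by (auto simp: FactGroup_def RCOSETS_def)
    obtain g where g: "g \<in> ball_fixator P 0" "x = germ g" using x(1) by (auto simp: germ_fixator_def)
    obtain n where n: "germ_fixator P n \<subseteq> N" using open_in_S_small[OF N(2)] nor.one_closed by auto
    obtain k where k: "pair_pow g (p ^ k) \<in> ball_fixator P n" using pow_in_ball_fixator[OF g(1)] by blast
    have "x [^]\<^bsub>?G\<^esub> (p ^ k) = germ (pair_pow g (p ^ k))"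
      using germ_pow[OF ball_fixatorD(1)[OF g(1)] P] g(2) N.nat_pow_consistent[of x "p ^ k" S] by simp
    then have "x [^]\<^bsub>?G\<^esub> (p ^ k) \<in> N" using k n by (auto simp: germ_fixator_def)
    then have "N #>\<^bsub>?G\<^esub> (x [^]\<^bsub>?G\<^esub> (p ^ k)) = N"
      using SG.coset_join2 nor.subset nor.subgroup_axioms by blast
    moreover have "C [^]\<^bsub>?G Mod N\<^esub> (p ^ k) = N #>\<^bsub>?G\<^esub> (x [^]\<^bsub>?G\<^esub> (p ^ k))"
      unfolding x(2) by (rule quotient_pow[OF SG.group_axioms N(1)]) (use x(1) in simp)
    ultimately have "C [^]\<^bsub>?G Mod N\<^esub> (p ^ k) = \<one>\<^bsub>?G Mod N\<^esub>" by (simp add: FactGroup_def)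
    then show "\<exists>k. C [^]\<^bsub>?G Mod N\<^esub> (p ^ k) = \<one>\<^bsub>?G Mod N\<^esub>" by blast
  qed
  ultimately show ?thesis unfolding pro_p_subgroup_def pro_p_group_def using S_subgroup by blast
qed

section \<open>Maximality\<close>

context
  fixes Q assumes QK: "Q \<subseteq> germ_fixator F 0" and Qp: "pro_p_subgroup p (NG F) \<tau> Q" and SQ: "S \<subseteq> Q"
begin

text \<open>The automorphisms behind \<open>Q\<close>; injectivity of \<open>germ\<close> makes the
  correspondence bijective, so that local actions make sense for elements of
  \<open>Q\<close>.\<close>

definition lift where "lift = {g \<in> ball_fixator F 0. germ g \<in> Q}"

lemma Q_subgroup: "subgroup Q (NG F)"
  using Qp by (simp add: pro_p_subgroup_def)

lemma liftD: "g \<in> lift \<Longrightarrow> g \<in> ball_fixator F 0" "g \<in> lift \<Longrightarrow> g \<in> Aut" "g \<in> lift \<Longrightarrow> g \<in> U F"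
    "g \<in> lift \<Longrightarrow> fst g (base \<Gamma>) = base \<Gamma>"
  using ball_fixatorD[of g F 0] by (auto simp: lift_def tree_ball_def)

lemma lift_closed:
  "(id, id) \<in> lift" "g \<in> lift \<Longrightarrow> h \<in> lift \<Longrightarrow> pair_comp g h \<in> lift" "g \<in> lift \<Longrightarrow> pair_inv g \<in> lift"
  "ball_fixator P 0 \<subseteq> lift"
proof -
  note S = Q_subgroup
  show "(id, id) \<in> lift"
    using ball_fixator_closed(1)[OF F] subgroup.one_closed[OF S] by (simp add: lift_def germ_one)
  show "pair_comp g h \<in> lift" if gh: "g \<in> lift" "h \<in> lift" for g h
    using ball_fixator_closed(2)[OF F] subgroup.m_closed[OF S, of "germ g" "germ h"] gh
      germ_mult[OF liftD(2)[OF gh(1)] liftD(2)[OF gh(2)], of F]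
    by (simp add: lift_def)
  show "pair_inv g \<in> lift" if g: "g \<in> lift" for g
    using ball_fixator_closed(3)[OF F] subgroup.m_inv_closed[OF S, of "germ g"] g germ_inv[OF F liftD(3)[OF g]]
    by (simp add: lift_def)
  show "ball_fixator P 0 \<subseteq> lift"
    using ball_fixator_P_F SQ by (auto simp: lift_def germ_fixator_def)
qed

text \<open>The part of \<open>Q\<close> fixing the ball of radius \<open>n\<close> is open and
  normal in \<open>Q\<close>, so it has \<open>p\<close>-power index; the order of that quotient
  serves as exponent.\<close>

lemma lift_pow:
  assumes q: "q \<in> lift" shows "\<exists>k. pair_pow q (p ^ k) \<in> ball_fixator F n"
proof -
  let ?G = "(NG F)\<lparr>carrier := Q\<rparr>" and ?\<tau> = "subtopology \<tau> Q"
  interpret N: group "NG F" by (rule neretin_group_group[OF F])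
  interpret QG: group ?G using subgroup.subgroup_is_group[OF Q_subgroup] N.group_axioms by blast
  interpret fil: filtered_group "NG F" "germ_fixator F" by (rule filtered_neretin[OF F])
  define M where "M = germ_fixator F n \<inter> Q"
  have "subgroup M (NG F)" unfolding M_def using N.subgroups_Inter_pair[OF fil.B_subgroup Q_subgroup] .
  then have sub: "subgroup M ?G" using N.subgroup_incl[OF _ Q_subgroup] by (auto simp: M_def)
  have M: "M \<lhd> ?G"
    unfolding QG.normal_inv_iff
  proof (intro conjI ballI sub)
    fix x u assume "x \<in> carrier ?G" "u \<in> M"
    then have xQ: "x \<in> Q" "u \<in> Q" "u \<in> germ_fixator F n" by (auto simp: M_def)
    obtain g where g: "g \<in> ball_fixator F 0" "x = germ g" using xQ(1) QK by (auto simp: germ_fixator_def)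
    obtain h where h: "h \<in> ball_fixator F n" "u = germ h" using xQ(3) by (auto simp: germ_fixator_def)
    note gA = ball_fixatorD(2)[OF g(1)] and hA = ball_fixatorD(2)[OF h(1)]
    let ?w = "pair_comp (pair_comp g h) (pair_inv g)"
    have "fst ?w y = y" if y: "y \<in> tree_ball n" for y
    proof -
      have i: "pair_inv g \<in> ball_fixator F 0" using ball_fixator_closed(3)[OF F g(1)] .
      \<comment> \<open>Normality: elements of \<open>Q\<close> fix the base vertex, so they
        preserve the ball and conjugation respects its pointwise fixator.\<close>
      have "level (fst (pair_inv g) y) \<le> level y"
        using aut_level_le[OF ball_fixatorD(2)[OF i]] ball_fixatorD(3)[OF i, of "base \<Gamma>"] by (simp add: tree_ball_def)
      then have "finv (fst g) y \<in> tree_ball n" using y by (simp add: tree_ball_def)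
      then show ?thesis using ball_fixatorD(3)[OF h(1)] by (simp add: aut_inv_apply[OF gA])
    qed
    then have "?w \<in> ball_fixator F n"
      using U_comp[OF F U_comp[OF F ball_fixatorD(1)[OF g(1)] ball_fixatorD(1)[OF h(1)]] U_inv[OF F ball_fixatorD(1)[OF g(1)]]]
      by (simp add: ball_fixator_def)
    moreover have "germ ?w = x \<otimes>\<^bsub>NG F\<^esub> u \<otimes>\<^bsub>NG F\<^esub> inv\<^bsub>NG F\<^esub> x"
      using g(2) h(2) germ_inv[OF F ball_fixatorD(1)[OF g(1)]] gA hA
      by (simp add: germ_mult aut_comp aut_inv)
    ultimately have "x \<otimes>\<^bsub>NG F\<^esub> u \<otimes>\<^bsub>NG F\<^esub> inv\<^bsub>NG F\<^esub> x \<in> germ_fixator F n" unfolding germ_fixator_def by (metis imageI)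
    moreover have "x \<otimes>\<^bsub>NG F\<^esub> u \<otimes>\<^bsub>NG F\<^esub> inv\<^bsub>NG F\<^esub> x \<in> Q"
      using xQ Q_subgroup by (meson subgroup.m_closed subgroup.m_inv_closed)
    ultimately show "x \<otimes>\<^bsub>?G\<^esub> u \<otimes>\<^bsub>?G\<^esub> inv\<^bsub>?G\<^esub> x \<in> M"
      using N.m_inv_consistent[OF Q_subgroup xQ(1)] by (simp add: M_def)
  qed
  have "openin ?\<tau> M" using openin_germ_fixator[OF F, of n] by (auto simp: openin_subtopology M_def)
  then obtain k where k: "order (?G Mod M) = p ^ k"
    using Qp M by (auto simp: pro_p_subgroup_def pro_p_group_def)
  interpret nor: normal M ?G by (rule M)
  interpret quo: group "?G Mod M" by (rule nor.factorgroup_is_group)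
  have x: "germ q \<in> carrier ?G" using q by (simp add: lift_def)
  have "M #>\<^bsub>?G\<^esub> germ q \<in> carrier (?G Mod M)" using x by (auto simp: FactGroup_def RCOSETS_def)
  from quo.pow_order_eq_1[OF this]
  have "M #>\<^bsub>?G\<^esub> (germ q [^]\<^bsub>?G\<^esub> (p ^ k)) = M"
    using quotient_pow[OF QG.group_axioms M x] k by (simp add: FactGroup_def)
  then have "germ q [^]\<^bsub>?G\<^esub> (p ^ k) \<in> M"
    using QG.coset_join1 sub QG.nat_pow_closed[OF x] by blast
  moreover have "germ q [^]\<^bsub>?G\<^esub> (p ^ k) = germ (pair_pow q (p ^ k))"
    using germ_pow[OF liftD(3)[OF q] F] N.nat_pow_consistent[of "germ q" "p ^ k" Q] by simp
  ultimately obtain u where u: "u \<in> ball_fixator F n" "germ (pair_pow q (p ^ k)) = germ u"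
    by (auto simp: M_def germ_fixator_def)
  then have "pair_pow q (p ^ k) = u"
    using germ_eq_iff ball_fixatorD(2)[OF u(1)] germ_pow[OF liftD(3)[OF q] F] U_Aut by blast
  then show ?thesis using u(1) by blast
qed

definition local_group :: "'v \<Rightarrow> ('c \<Rightarrow> 'c) set" where
  "local_group x = (\<lambda>q. loc q x) ` {q \<in> lift. fst q x = x}"

lemma local_group_subgroup: "subgroup (local_group x) Sym"
proof (rule Sym_subgroupI)
  show "bij f" if "f \<in> local_group x" for f
    using that loc_bij liftD(2) by (auto simp: local_group_def)
  show "id \<in> local_group x"
    unfolding local_group_def using lift_closed(1) by (intro image_eqI[of _ _ "(id, id)"]) auto
  show "f \<circ> g \<in> local_group x" if fg: "f \<in> local_group x" "g \<in> local_group x" for f g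
  proof -
    obtain q r where "q \<in> lift" "fst q x = x" "f = loc q x" "r \<in> lift" "fst r x = x" "g = loc r x"
      using fg by (auto simp: local_group_def)
    then show ?thesis
      unfolding local_group_def using lift_closed(2) loc_comp[OF liftD(2)]
      by (intro image_eqI[of _ _ "pair_comp q r"]) auto
  qed
  show "finv f \<in> local_group x" if f: "f \<in> local_group x" for f
  proof -
    obtain q where q: "q \<in> lift" "fst q x = x" "f = loc q x" using f by (auto simp: local_group_def)
    have "finv (fst q) x = x" using q(2) aut_inv_apply(2)[OF liftD(2)[OF q(1)], of x] by simp
    then show ?thesis
      unfolding local_group_def using q lift_closed(3)[OF q(1)] loc_inv[OF liftD(2)[OF q(1)], of x]
      by (intro image_eqI[of _ _ "pair_inv q"]) auto
  qed
qed

lemma local_group_pow: assumes "f \<in> local_group x" shows "\<exists>k. f ^^ (p ^ k) = id"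
proof -
  obtain q where q: "q \<in> lift" "fst q x = x" "f = loc q x" using assms by (auto simp: local_group_def)
  \<comment> \<open>Radius \<open>level x + 1\<close> is needed so that the neighbours of
    \<open>x\<close> are fixed too and the local action at \<open>x\<close> becomes trivial.\<close>
  obtain k where k: "pair_pow q (p ^ k) \<in> ball_fixator F (Suc (level x))" using lift_pow[OF q(1)] by blast
  note kD = ball_fixatorD[OF k]
  have "loc (pair_pow q (p ^ k)) x c = c" for c
  proof -
    have "fst (pair_pow q (p ^ k)) x = x" "fst (pair_pow q (p ^ k)) (nbr x c) = nbr x c"
      using kD(3) level_nbr_le[of x c] by (auto simp: tree_ball_def)
    then show ?thesis using loc_determined[OF kD(2) Aut_id, of x c] by simp
  qed
  then have "f ^^ (p ^ k) = id" using loc_pow[OF liftD(2)[OF q(1)] q(2)] q(3) by (metis ext id_apply)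
  then show ?thesis by blast
qed

lemma local_group_P: "local_group x \<subseteq> P"
proof (cases "x = base \<Gamma>")
  case True
  have "P \<subseteq> local_group x"
  proof
    fix \<tau>' assume t: "\<tau>' \<in> P"
    \<comment> \<open>A constant portrait is always compatible, so every element of \<open>P\<close>
      occurs as a local action at the base vertex.\<close>
    obtain s where s: "s \<in> U P" "fst s x = x" "\<And>y. loc s y = \<tau>'"
      using portrait_universal[of P "\<lambda>_. \<tau>'" x x, OF P] t by blast
    then have "s \<in> ball_fixator P 0" using True by (simp add: ball_fixator_def tree_ball_def)
    then have "s \<in> lift" using lift_closed(4) by blast
    then show "\<tau>' \<in> local_group x"
      unfolding local_group_def using s by (intro image_eqI[of _ _ s]) auto
  qed
  moreover have "local_group x \<subseteq> F" using universal_groupD(2) liftD(3) by (auto simp: local_group_def)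
  ultimately have "local_group x = P"
    by (rule sylow_maximal[OF prime_p F local_group_subgroup _ _ card_P local_group_pow])
  then show ?thesis by simp
next
  case False
  \<comment> \<open>The colour at \<open>x\<close> of the edge towards the base vertex. Rotations of
    \<open>half x \<omega>\<close> fix the base vertex, so they realise the whole stabilizer of
    \<omega> in \<open>P\<close> inside \<open>Q\<close>.\<close>
  define \<omega> where "\<omega> = last (word (base \<Gamma>) x)"
  have "point_stabilizer P \<omega> \<subseteq> local_group x"
  proof
    fix \<tau>' assume t: "\<tau>' \<in> point_stabilizer P \<omega>"
    then obtain s where s: "s \<in> U P" "\<And>y. y \<notin> half x \<omega> \<Longrightarrow> fst s y = y" "fst s x = x"
      "\<And>y. y \<in> half x \<omega> \<Longrightarrow> loc s y = \<tau>'"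
      using half_rotation[OF P, of \<tau>' \<omega> x] by (auto simp: point_stabilizer_eq)
    have "hd (word x (base \<Gamma>)) = \<omega>" by (simp add: word_rev[of x "base \<Gamma>"] hd_rev \<omega>_def)
    then have "base \<Gamma> \<notin> half x \<omega>" using False by (simp add: half_iff')
    then have "s \<in> ball_fixator P 0" using s(1,2) by (simp add: ball_fixator_def tree_ball_def)
    then have "s \<in> lift" using lift_closed(4) by blast
    then show "\<tau>' \<in> local_group x"
      unfolding local_group_def using s by (intro image_eqI[of _ _ s]) auto
  qed
  moreover have "local_group x \<subseteq> point_stabilizer F \<omega>"
  proof
    fix f assume "f \<in> local_group x"
    then obtain q where q: "q \<in> lift" "fst q x = x" "f = loc q x" by (auto simp: local_group_def)
    \<comment> \<open>Conversely \<open>q\<close> cannot raise levels, and \<omega> is the only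
      colour leading from \<open>x\<close> to a lower level, so its local action fixes
      \<omega>.\<close>
    have "level (fst q (nbr x \<omega>)) \<le> level (nbr x \<omega>)"
      using aut_level_le[OF liftD(2,4)[OF q(1)]] .
    moreover have "level x \<noteq> 0" using False by simp
    moreover have "level (nbr x \<omega>) = level x - 1" using False by (simp add: level_nbr \<omega>_def)
    ultimately have "level (fst q (nbr x \<omega>)) < level x" by linarith
    moreover have "fst q (nbr x \<omega>) = nbr x (f \<omega>)" using q aut_nbr[OF liftD(2)[OF q(1)]] by simp
    ultimately have "f \<omega> = \<omega>" by (auto simp: level_nbr \<omega>_def split: if_splits)
    then show "f \<in> point_stabilizer F \<omega>"
      using q universal_groupD(2)[OF liftD(3)[OF q(1)]] by (simp add: point_stabilizer_eq)
  qed
  ultimately have "local_group x = point_stabilizer P \<omega>"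
    by (rule sylow_maximal[OF prime_p point_stabilizer_subgroup[OF F] local_group_subgroup _ _
        stabilizer_sylow[OF prime_p F P card_P orbit_eq] local_group_pow])
  then show ?thesis by (auto simp: point_stabilizer_eq)
qed

text \<open>On the ball \<open>r\<close> is trivial, and on the next layer it is given by its local
  actions at the boundary, which lie in \<open>P\<close>. Each of them is continued as a constant
  portrait on its branch, and the branches are glued.\<close>

lemma extend_approximation:
  assumes r: "r \<in> lift" "\<And>x. x \<in> tree_ball n \<Longrightarrow> fst r x = x"
  shows "\<exists>t\<in>ball_fixator P 0. \<forall>x\<in>tree_ball (Suc n). fst t x = fst r x"
proof -
  note rA = liftD(2)[OF r(1)]
  have locP: "loc r x \<in> P" if "x \<in> tree_ball n" for x
    using local_group_P[of x] r that by (auto simp: local_group_def)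
  have const: "\<exists>a\<in>U P. fst a v = v \<and> (\<forall>y. loc a y = loc r v)" if "v \<in> tree_ball n" for v
    using portrait_universal[of P "\<lambda>_. loc r v" v v, OF P] locP[OF that] by blast
  have ext: ?thesis if t: "t \<in> U P" "\<And>x. x \<in> tree_ball n \<Longrightarrow> fst t x = x"
    "\<And>v c. level v = n \<Longrightarrow> nbr v c \<notin> tree_ball n \<Longrightarrow> fst t (nbr v c) = fst r (nbr v c)" for t
  proof -
    have "fst t y = fst r y" if y: "y \<in> tree_ball (Suc n)" for y
    proof (cases "y \<in> tree_ball n")
      case False
      define c where "c = last (word (base \<Gamma>) y)"
      have "y \<noteq> base \<Gamma>" using False by (auto simp: tree_ball_def)
      then have "level (nbr y c) = n" using y False by (simp add: tree_ball_def c_def level_nbr)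
      then show ?thesis using t(3)[of "nbr y c" c] False by simp
    qed (use t(2) r(2) in simp)
    moreover have "t \<in> ball_fixator P 0"
      using t(1,2) tree_ball_mono[of 0 n] by (auto simp: ball_fixator_def)
    ultimately show ?thesis by blast
  qed
  show ?thesis
  \<comment> \<open>The ball of radius 0 is not a complete subtree, so gluing does not apply to it;
    one constant portrait around the base vertex replaces it.\<close>
  proof (cases "n = 0")
    case True
    obtain t where t: "t \<in> U P" "fst t (base \<Gamma>) = base \<Gamma>" "\<And>y. loc t y = loc r (base \<Gamma>)"
      using const[of "base \<Gamma>"] by (auto simp: tree_ball_def)
    show ?thesis
      using t(2) True liftD(4)[OF r(1)]
      by (intro ext[OF t(1)])
        (auto simp: tree_ball_def aut_nbr[OF universal_groupD(1)[OF t(1)]] aut_nbr[OF rA] t(3))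
  next
    case False
    then have n: "n \<ge> 1" by simp
    note L = tree_ball_leaves[OF n] and C = tree_ball_complete[OF n]
    obtain a where a: "\<And>v. v \<in> tree_ball n \<Longrightarrow> a v \<in> U P \<and> fst (a v) v = v \<and> (\<forall>y. loc (a v) y = loc r v)"
      using const by metis
    have stem: "loc r v (stem (tree_ball n) v) = stem (tree_ball n) v" if v: "v \<in> leaves \<Gamma> (tree_ball n)" for v
    proof -
      have "nbr v (stem (tree_ball n) v) \<in> tree_ball n" using leaf_nbr_iff[OF v] by simp
      then show ?thesis
        using r(2) leaf_in[OF v] loc_determined[OF rA Aut_id, of v "stem (tree_ball n) v"] by simp
    qed
    have av: "a v \<in> U P \<and> fst (a v) v = v \<and> loc (a v) v (stem (tree_ball n) v) = stem (tree_ball n) v"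
      if "v \<in> leaves \<Gamma> (tree_ball n)" for v
      using a[OF leaf_in[OF that]] stem[OF that] by simp
    obtain t where t: "t \<in> U P" "\<And>x. x \<in> tree_ball n \<Longrightarrow> fst t x = x"
      "\<And>v x. v \<in> leaves \<Gamma> (tree_ball n) \<Longrightarrow> x \<in> half v (stem (tree_ball n) v) \<Longrightarrow> fst t x = fst (a v) x"
      using glue_automorphisms[of P "tree_ball n" a, OF P C av] by blast
    show ?thesis
    proof (rule ext[OF t(1,2)])
      fix v c assume v: "level v = n" "nbr v c \<notin> tree_ball n"
      then have vl: "v \<in> leaves \<Gamma> (tree_ball n)" by (simp add: L)
      have "c \<noteq> stem (tree_ball n) v" using v(2) leaf_nbr_iff[OF vl] by blast
      then have "nbr v c \<in> half v (stem (tree_ball n) v)" using half_nbr by simp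
      then have "fst t (nbr v c) = fst (a v) (nbr v c)" using t(3)[OF vl] by blast
      also have "\<dots> = nbr v (loc r v c)"
        using a[OF leaf_in[OF vl]] by (simp add: aut_nbr universal_groupD(1)[of "a v" P])
      also have "\<dots> = fst r (nbr v c)" using r(2)[OF leaf_in[OF vl]] by (simp add: aut_nbr[OF rA])
      finally show "fst t (nbr v c) = fst r (nbr v c)" .
    qed
  qed
qed

text \<open>If \<open>s\<close> agrees with \<open>q\<close> on a ball, the inverse of
  \<open>s\<close> times \<open>q\<close> fixes that ball; correcting it on the next layer by
  \<open>t\<close> makes \<open>s\<close> times \<open>t\<close> agree with \<open>q\<close> one
  layer further.\<close>

lemma approximation:
  assumes q: "q \<in> lift" shows "\<exists>s\<in>ball_fixator P 0. \<forall>x\<in>tree_ball n. fst s x = fst q x"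
proof (induction n)
  case 0
  show ?case
    using ball_fixator_closed(1)[OF P, of 0] liftD(4)[OF q] by (intro bexI[of _ "(id, id)"]) (auto simp: tree_ball_def)
next
  case (Suc n)
  then obtain s where s: "s \<in> ball_fixator P 0" "\<And>x. x \<in> tree_ball n \<Longrightarrow> fst s x = fst q x" by blast
  note sA = ball_fixatorD(2)[OF s(1)]
  define r where "r = pair_comp (pair_inv s) q"
  have "s \<in> lift" using s(1) lift_closed(4) by blast
  then have rl: "r \<in> lift" unfolding r_def using q lift_closed(2,3) by blast
  have "fst r x = x" if "x \<in> tree_ball n" for x
    using s(2)[OF that, symmetric] by (simp add: r_def aut_inv_apply[OF sA])
  then obtain t where t: "t \<in> ball_fixator P 0" "\<forall>x\<in>tree_ball (Suc n). fst t x = fst r x"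
    using extend_approximation[OF rl] by blast
  have "fst (pair_comp s t) x = fst q x" if "x \<in> tree_ball (Suc n)" for x
    using t(2) that by (simp add: r_def aut_inv_apply[OF sA])
  then show ?case using ball_fixator_closed(2)[OF P s(1) t(1)] by blast
qed

text \<open>Membership in \<open>U P\<close> is a condition on each local action separately, and the
  local action of \<open>q\<close> at \<open>x\<close> is seen on the ball of radius
  \<open>level x + 1\<close>, where \<open>q\<close> agrees with an element of
  \<open>U P\<close>.\<close>

lemma maximal: "Q = S"
proof
  show "Q \<subseteq> S"
  proof
    fix y assume y: "y \<in> Q"
    then obtain q where q: "q \<in> ball_fixator F 0" "y = germ q" using QK by (auto simp: germ_fixator_def)
    then have ql: "q \<in> lift" using y by (simp add: lift_def)
    note qA = liftD(2)[OF ql]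
    have "loc q x \<in> P" for x
    proof -
      obtain s where s: "s \<in> ball_fixator P 0" "\<And>x'. x' \<in> tree_ball (Suc (level x)) \<Longrightarrow> fst s x' = fst q x'"
        using approximation[OF ql] by blast
      have "loc q x c = loc s x c" for c
        using s(2)[of x] s(2)[of "nbr x c"] level_nbr_le[of x c]
        by (intro loc_determined[OF qA ball_fixatorD(2)[OF s(1)]]) (auto simp: tree_ball_def)
      then have "loc q x = loc s x" by auto
      then show ?thesis using universal_groupD(2)[OF ball_fixatorD(1)[OF s(1)]] by simp
    qed
    then have "q \<in> ball_fixator P 0" using q(1) qA by (simp add: ball_fixator_def universal_group_def)
    then show "y \<in> S" using q(2) by (simp add: germ_fixator_def)
  qed
qed (rule SQ)

end

lemma local_sylow: "local_sylow_subgroup p (NG F) \<tau> S"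
  unfolding local_sylow_subgroup_def
proof (intro exI[of _ "germ_fixator F 0"] conjI allI impI)
  show "subgroup (germ_fixator F 0) (NG F)" by (rule germ_fixator_subgroup[OF F])
  show "openin \<tau> (germ_fixator F 0)" by (rule openin_germ_fixator[OF F])
  show "compactin \<tau> (germ_fixator F 0)"
    using compactin_germ_stabilizer[OF F] by (simp add: base_stabilizer_eq germ_fixator_def)
  show "S \<subseteq> germ_fixator F 0" using ball_fixator_P_F by (auto simp: germ_fixator_def)
  show "pro_p_subgroup p (NG F) \<tau> S" by (rule pro_p_S)
  show "Q = S" if "Q \<subseteq> germ_fixator F 0 \<and> pro_p_subgroup p (NG F) \<tau> Q \<and> S \<subseteq> Q" for Q
    using maximal[of Q] that by blast
qed

end

section \<open>Commensurating germs and the localization\<close>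

lemma mem_conj_coset_iff: "y \<in> x <#\<^bsub>G\<^esub> K #>\<^bsub>G\<^esub> z \<longleftrightarrow> (\<exists>k\<in>K. y = x \<otimes>\<^bsub>G\<^esub> k \<otimes>\<^bsub>G\<^esub> z)"
  by (auto simp: l_coset_def r_coset_def)

lemma compactin_conj:
  assumes G: "topological_group G T" and x: "x \<in> carrier G" and K: "compactin T K"
  shows "compactin T (x <#\<^bsub>G\<^esub> K #>\<^bsub>G\<^esub> inv\<^bsub>G\<^esub> x)"
proof -
  interpret group G using topological_groupD(1)[OF G] .
  have "x <#\<^bsub>G\<^esub> K #>\<^bsub>G\<^esub> inv\<^bsub>G\<^esub> x = (\<lambda>y. y \<otimes>\<^bsub>G\<^esub> inv\<^bsub>G\<^esub> x) ` ((\<lambda>y. x \<otimes>\<^bsub>G\<^esub> y) ` K)"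
    by (auto simp: mem_conj_coset_iff)
  then show ?thesis
    using image_compactin[OF image_compactin[OF K continuous_translation(1)[OF G x]]
        continuous_translation(2)[OF G inv_closed[OF x]]] by simp
qed

locale neretin_localization = local_sylow_tree +
  assumes self_normalizing: "normalizer (perm_group (point_stabilizer (orbit_sym F) \<omega>)) (point_stabilizer P \<omega>)
    = point_stabilizer P \<omega>"
begin

lemma orbit_sym_subgroup: "subgroup (orbit_sym F) Sym"
proof (rule Sym_subgroupI)
  show "finv f \<in> orbit_sym F" if f: "f \<in> orbit_sym F" for f
  proof -
    have b: "bij f" using f by (simp add: orbit_sym_def Sym_simps)
    have "finv f ` A = A" if "A \<in> perm_orbits F" for A
    proof -
      have "f ` A = A" using f that by (simp add: orbit_sym_def)
      then have "finv f ` (f ` A) = finv f ` A" by simp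
      then show ?thesis using b by (simp add: image_inv_f_f bij_is_inj)
    qed
    then show ?thesis using b by (simp add: orbit_sym_def Sym_simps bij_imp_bij_inv)
  qed
  show "f \<circ> g \<in> orbit_sym F" if "f \<in> orbit_sym F" "g \<in> orbit_sym F" for f g
  proof -
    have "(f \<circ> g) ` A = A" if "A \<in> perm_orbits F" for A
      using that \<open>f \<in> orbit_sym F\<close> \<open>g \<in> orbit_sym F\<close> unfolding image_comp[symmetric]
      by (simp add: orbit_sym_def)
    then show ?thesis using that bij_comp[of g f] by (simp add: orbit_sym_def Sym_simps del: o_apply)
  qed
qed (auto simp: orbit_sym_def Sym_simps)

lemma F_orbit_sym: "F \<subseteq> orbit_sym F"
proof
  note D = Sym_subgroupD[OF F]
  fix f assume f: "f \<in> F"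
  have "f ` A = A" if A: "A \<in> perm_orbits F" for A
  proof -
    obtain x where x: "A = (\<lambda>g. g x) ` F" using A by (auto simp: perm_orbits_eq)
    show ?thesis
    proof (intro equalityI subsetI)
      fix y assume "y \<in> f ` A"
      then obtain g where "g \<in> F" "y = (f \<circ> g) x" using x by auto
      then show "y \<in> A" unfolding x using D(2)[OF f, of g] by (intro image_eqI[of _ _ "f \<circ> g"]) auto
    next
      fix y assume "y \<in> A"
      then obtain g where g: "g \<in> F" "y = g x" using x by auto
      have "f (finv f y) = y" using D(4)[OF f] by (simp add: bij_is_surj surj_f_inv_f)
      moreover have "finv f y \<in> A"
        unfolding x using D(2)[OF D(3)[OF f] g(1)] g(2) by (intro image_eqI[of _ _ "finv f \<circ> g"]) auto
      ultimately show "y \<in> f ` A" by (metis imageI)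
    qed
  qed
  then show "f \<in> orbit_sym F" using D(4)[OF f] by (simp add: orbit_sym_def Sym_simps)
qed

text \<open>The form in which the hypothesis is applied: \<open>F\<close> lies in
  \<open>orbit_sym F\<close>, so \<open>g\<close> belongs to the ambient point stabilizer, and it
  remains to see that it normalizes the stabilizer of \<omega> in \<open>P\<close>.\<close>

lemma normalizing_in_P:
  assumes g: "g \<in> F" "g \<omega> = \<omega>"
    and nrm: "\<And>t. t \<in> point_stabilizer P \<omega> \<Longrightarrow> g \<circ> t \<circ> finv g \<in> P"
  shows "g \<in> P"
proof -
  let ?X = "point_stabilizer (orbit_sym F) \<omega>" and ?Y = "point_stabilizer P \<omega>"
  note X = point_stabilizer_subgroup[OF orbit_sym_subgroup, of \<omega>]
  note S = perm_group_simps[OF X] and D = Sym_subgroupD[OF X]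
  have gb: "bij g" using Sym_subgroupD(4)[OF F g(1)] .
  have gX: "g \<in> ?X" using g F_orbit_sym by (auto simp: point_stabilizer_eq)
  have YX: "?Y \<subseteq> ?X" using P_subset F_orbit_sym by (auto simp: point_stabilizer_eq)
  have igw: "finv g \<omega> = \<omega>" using g(2) gb inv_f_f[of g \<omega>] by (simp add: bij_is_inj)
  have conj: "g <#\<^bsub>perm_group ?X\<^esub> ?Y #>\<^bsub>perm_group ?X\<^esub> (inv\<^bsub>perm_group ?X\<^esub> g) = (\<lambda>t. g \<circ> t \<circ> finv g) ` ?Y"
  proof -
    have "g \<otimes>\<^bsub>perm_group ?X\<^esub> t \<otimes>\<^bsub>perm_group ?X\<^esub> (inv\<^bsub>perm_group ?X\<^esub> g) = g \<circ> t \<circ> finv g" if "t \<in> ?Y" for t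
    proof -
      have t: "t \<in> ?X" using that YX by blast
      show ?thesis using S(2)[OF gX t] S(2)[OF D(2)[OF gX t] D(3)[OF gX]] S(4)[OF gX] by simp
    qed
    then show ?thesis by (auto simp: l_coset_def r_coset_def)
  qed
  \<comment> \<open>Conjugation by \<open>g\<close> is an injective self-map of a finite set, so the
    inclusion is already an equality.\<close>
  have "(\<lambda>t. g \<circ> t \<circ> finv g) ` ?Y = ?Y"
  proof (rule endo_inj_surj)
    show "(\<lambda>t. g \<circ> t \<circ> finv g) ` ?Y \<subseteq> ?Y"
      using nrm g(2) igw by (auto simp: point_stabilizer_eq)
    show "inj_on (\<lambda>t. g \<circ> t \<circ> finv g) ?Y"
    proof (rule inj_onI)
      fix s t assume "g \<circ> s \<circ> finv g = g \<circ> t \<circ> finv g"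
      then have "g (s (finv g (g y))) = g (t (finv g (g y)))" for y by (metis comp_apply)
      then show "s = t" using gb by (auto simp: bij_is_inj inj_eq)
    qed
  qed simp
  then have "g \<in> normalizer (perm_group ?X) ?Y"
    using gX YX conj by (simp add: normalizer_def stabilizer_def S(1))
  then show ?thesis unfolding self_normalizing by (simp add: point_stabilizer_eq)
qed

text \<open>The relation in \<open>rot\<close> holds only off a finite set, but both sides are
  automorphisms, so by \<open>half_agree_cofinite\<close> it holds on the whole half-tree. Comparing
  local actions at \<open>x\<close>, which \<rho> fixes, yields
  \<open>?\<sigma> \<circ> t = loc s (fst h x) \<circ> ?\<sigma>\<close>.\<close>

lemma intertwiner_local_action:
  assumes h: "h \<in> U F" and x: "x \<in> half v k"
    and rot: "\<And>\<rho>. \<rho> \<in> U P \<Longrightarrow> (\<And>y. y \<notin> half x (toward v k x) \<Longrightarrow> fst \<rho> y = y) \<Longrightarrow> fst \<rho> x = x \<Longrightarrow>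
      \<exists>s\<in>U P. finite {z \<in> half v k. fst h (fst \<rho> z) \<noteq> fst s (fst h z)}"
  shows "loc h x \<in> P"
proof -
  let ?\<omega> = "toward v k x" and ?\<sigma> = "loc h x"
  note DP = Sym_subgroupD[OF P]
  have hA: "h \<in> Aut" and \<sigma>F: "?\<sigma> \<in> F" using universal_groupD[OF h] by blast+
  have \<sigma>b: "bij ?\<sigma>" using loc_bij[OF hA] .
  have conj: "?\<sigma> \<circ> t \<circ> finv ?\<sigma> \<in> P" if t: "t \<in> point_stabilizer P ?\<omega>" for t
  proof -
    obtain \<rho> where \<rho>: "\<rho> \<in> U P" "\<And>y. y \<notin> half x ?\<omega> \<Longrightarrow> fst \<rho> y = y" "fst \<rho> x = x"
      "\<And>y. y \<in> half x ?\<omega> \<Longrightarrow> loc \<rho> y = t"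
      using half_rotation[OF P, of t ?\<omega> x] t by (auto simp: point_stabilizer_eq)
    obtain s where s: "s \<in> U P" "finite {z \<in> half v k. fst h (fst \<rho> z) \<noteq> fst s (fst h z)}"
      using rot[OF \<rho>(1,2,3)] by blast
    have A: "\<rho> \<in> Aut" "s \<in> Aut" using \<rho>(1) s(1) universal_groupD by blast+
    have "fst (pair_comp h \<rho>) z = fst (pair_comp s h) z" if "z \<in> half v k" for z
      using half_agree_cofinite[OF aut_comp[OF hA A(1)] aut_comp[OF A(2) hA] _ that] s(2) by simp
    from loc_agree_half[OF aut_comp[OF hA A(1)] aut_comp[OF A(2) hA] this x]
    have "?\<sigma> \<circ> t = loc s (fst h x) \<circ> ?\<sigma>"
      using loc_comp[OF A(1), of h x] loc_comp[OF hA, of s x] \<rho>(3,4) by simp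
    then have "?\<sigma> \<circ> t \<circ> finv ?\<sigma> = loc s (fst h x)"
      using \<sigma>b by (simp add: comp_assoc bij_is_surj flip: surj_iff) (metis bij_is_surj comp_id surj_iff)
    then show ?thesis using universal_groupD(2)[OF s(1)] by simp
  qed
  \<comment> \<open>\<open>?\<sigma>\<close> lies in \<open>F\<close> and need not fix the colour,
    but the orbit under \<open>P\<close> is the same, so some \<open>q\<close> in \<open>P\<close>
    moves the colour to the same place.\<close>
  have "?\<sigma> ?\<omega> \<in> (\<lambda>f. f ?\<omega>) ` P" using \<sigma>F orbit_eq[of ?\<omega>] by blast
  then obtain q where q: "q \<in> P" "?\<sigma> ?\<omega> = q ?\<omega>" by blast
  have qb: "bij q" using DP(4)[OF q(1)] .
  define g where "g = finv q \<circ> ?\<sigma>"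
  have g\<omega>: "g ?\<omega> = ?\<omega>" using q(2) qb by (simp add: g_def bij_is_inj)
  have gF: "g \<in> F" unfolding g_def using Sym_subgroupD(2,3)[OF F] q(1) \<sigma>F P_subset by blast
  have "g \<circ> t \<circ> finv g \<in> P" if t: "t \<in> point_stabilizer P ?\<omega>" for t
  proof -
    have "finv g = finv ?\<sigma> \<circ> q"
      unfolding g_def using o_inv_distrib[of "finv q" ?\<sigma>] \<sigma>b qb by (simp add: bij_imp_bij_inv inv_inv_eq)
    then have "g \<circ> t \<circ> finv g = finv q \<circ> (?\<sigma> \<circ> t \<circ> finv ?\<sigma>) \<circ> q" by (simp add: g_def comp_assoc)
    then show ?thesis using DP(2)[OF DP(2)[OF DP(3)[OF q(1)] conj[OF t]] q(1)] by simp
  qed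
  then have "g \<in> P" using normalizing_in_P[OF gF g\<omega>] by blast
  moreover have "?\<sigma> = q \<circ> g" using qb by (auto simp: g_def fun_eq_iff bij_is_surj surj_f_inv_f)
  ultimately show ?thesis using DP(2)[OF q(1)] by simp
qed

text \<open>The portrait of \<open>h\<close> on a half-tree extends constantly to the other side.\<close>

lemma half_extension:
  assumes h: "h \<in> Aut" and loc: "\<And>x. x \<in> half v k \<Longrightarrow> loc h x \<in> P"
  shows "\<exists>g\<in>U P. \<forall>x\<in>half v k. fst g x = fst h x"
proof -
  define \<pi> where "\<pi> y = (if y \<in> half v k then loc h y else loc h v)" for y
  have "\<pi> (nbr y c) c = \<pi> y c" for y c
  proof (cases "y \<in> half v k")
    case True
    then show ?thesis using half_back_iff[OF True, of c] by (auto simp: \<pi>_def loc_nbr[OF h])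
  next
    case False
    then show ?thesis using half_back_iff[of "nbr y c" v k c] by (auto simp: \<pi>_def)
  qed
  moreover have "\<pi> y \<in> P" for y using loc by (simp add: \<pi>_def)
  ultimately obtain g where g: "g \<in> U P" "fst g v = fst h v" "\<And>y. loc g y = \<pi> y"
    using portrait_universal[of P \<pi> v "fst h v", OF P] by blast
  have "fst g x = fst h x" if "x \<in> half v k" for x
    by (rule agree_on_halfI[OF universal_groupD(1)[OF g(1)] h g(2) _ that]) (simp add: g(3) \<pi>_def)
  then show ?thesis using g(1) by blast
qed

text \<open>Applied to the inverse of a commensurating germ. On each branch the test rotations show
  that all local actions of the witness \<open>h\<close> lie in \<open>P\<close>;
  \<open>half_extension\<close> then replaces \<open>h\<close> by a witness from
  \<open>U P\<close>.\<close>

lemma intertwiner_almost: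
  assumes f: "almost (U F) f"
    and conj: "\<And>u. u \<in> ball_fixator P n \<Longrightarrow> \<exists>s\<in>U P. germ_eq (f \<circ> fst u) (fst s \<circ> f)"
  shows "almost (U P) f"
proof -
  obtain N \<phi> where N: "N \<ge> n" and \<phi>: "\<phi> \<in> AA (U F)" "dom_tree \<phi> = tree_ball N"
    and \<phi>f: "germ_eq (vmap \<phi>) f"
    using almost_ball_representative[OF U_Aut f] by blast
  note D = AA_D[OF \<phi>(1)]
  let ?T = "dom_tree \<phi>"
  have "\<exists>g\<in>U P. honest_at \<phi> g v (stem ?T v)" if v: "v \<in> leaves \<Gamma> ?T" for v
  proof -
    let ?k = "stem ?T v"
    obtain h where h: "h \<in> U F" "honest_at \<phi> h v ?k" using AA_honest_at[OF \<phi>(1) v] by blast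
    have hA: "h \<in> Aut" using universal_groupD(1)[OF h(1)] .
    have "loc h x \<in> P" if x: "x \<in> half v ?k" for x
    proof (rule intertwiner_local_action[OF h(1) x])
      let ?\<omega> = "toward v ?k x"
      fix \<rho> assume \<rho>: "\<rho> \<in> U P" "\<And>y. y \<notin> half x ?\<omega> \<Longrightarrow> fst \<rho> y = y" "fst \<rho> x = x"
      have sub: "half x ?\<omega> \<subseteq> half v ?k" using half_subset_half[OF x] .
      have \<rho>v: "fst \<rho> v = v"
      proof (cases "x = v")
        case False
        have "hd (word x v) = ?\<omega>" using False by (simp add: word_rev[of x v] hd_rev toward_def)
        then have "v \<notin> half x ?\<omega>" using False by (simp add: half_iff')
        then show ?thesis by (rule \<rho>(2))
      qed (use \<rho>(3) in simp)
      \<comment> \<open>The rotated half-tree lies inside the branch at \<open>v\<close> and so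
        meets the domain tree at most in \<open>v\<close>. Since that tree is a ball of radius at
        least \<open>n\<close>, the rotation belongs to the ball fixator to which
        \<open>conj\<close> applies.\<close>
      have "fst \<rho> y = y" if y: "y \<in> ?T" for y
      proof (cases "y \<in> half x ?\<omega>")
        case True
        then have "y = v" using leaf_half_disjoint[OF completeD(2)[OF D(1)] v y] sub by blast
        then show ?thesis using \<rho>v by simp
      qed (rule \<rho>(2))
      then have "\<rho> \<in> ball_fixator P n"
        using \<rho>(1) \<phi>(2) tree_ball_mono[OF N] by (auto simp: ball_fixator_def)
      then obtain s where s: "s \<in> U P" "germ_eq (f \<circ> fst \<rho>) (fst s \<circ> f)" using conj by blast
      have \<rho>A: "\<rho> \<in> Aut" using universal_groupD(1)[OF \<rho>(1)] .
      have "nbr v ?k \<notin> half x ?\<omega>" using sub half_back by blast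
      then have "loc \<rho> v ?k = ?k"
        using loc_determined[OF \<rho>A Aut_id, of v ?k] \<rho>(2) \<rho>v by simp
      \<comment> \<open>Honesty allows \<open>vmap \<phi>\<close> to be replaced by \<open>h\<close>
        both at \<open>z\<close> and at its image under \<rho>, because both lie in the
        branch.\<close>
      then have stable: "fst \<rho> z \<in> half v ?k" if "z \<in> half v ?k" for z
        using aut_half_into[OF \<rho>A that] \<rho>v by simp
      have "germ_eq (vmap \<phi> \<circ> fst \<rho>) (f \<circ> fst \<rho>)"
        using germ_eq_comp[OF \<phi>f germ_eq_refl] almost_finite_fibres[OF almost_aut[OF U_Aut \<rho>(1)]] by blast
      also have "germ_eq \<dots> (fst s \<circ> f)" by (rule s(2))
      also have "germ_eq \<dots> (fst s \<circ> vmap \<phi>)"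
        using germ_eq_comp[OF germ_eq_refl germ_eq_sym[OF \<phi>f] almost_finite_fibres[OF f]] .
      finally have fin: "finite {z. vmap \<phi> (fst \<rho> z) \<noteq> fst s (vmap \<phi> z)}" by (simp add: germ_eq_def)
      have "{z \<in> half v ?k. fst h (fst \<rho> z) \<noteq> fst s (fst h z)} \<subseteq> {z. vmap \<phi> (fst \<rho> z) \<noteq> fst s (vmap \<phi> z)}"
        using h(2) stable by (auto simp: honest_at_def)
      then show "\<exists>s\<in>U P. finite {z \<in> half v ?k. fst h (fst \<rho> z) \<noteq> fst s (fst h z)}"
        using s(1) finite_subset[OF _ fin] by blast
    qed
    then obtain g where g: "g \<in> U P" "\<And>x. x \<in> half v ?k \<Longrightarrow> fst g x = fst h x"
      using half_extension[OF hA] by blast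
    have gA: "g \<in> Aut" using universal_groupD(1)[OF g(1)] .
    have "snd g e = snd h e" if "e \<in> spanned_edges \<Gamma> (half v ?k)" for e
      using that g(2) by (intro edge_endpoints_eq) (simp_all add: automorphismsD[OF gA] automorphismsD[OF hA] spanned_edges_def)
    then have "honest_at \<phi> g v ?k" using h(2) g(2) by (simp add: honest_at_def)
    then show ?thesis using g(1) by blast
  qed
  \<comment> \<open>The representative stays the same; only the witnesses of honesty have been
    exchanged.\<close>
  then have "\<phi> \<in> AA (U P)"
    using AA_I[OF D(1,2,3)] \<phi>(1) by (simp add: honest_almost_automorphisms_def)
  then show ?thesis using \<phi>f unfolding almost_def by blast
qed

abbreviation conj_S :: "('a, 'b) forest_map set \<Rightarrow> ('a, 'b) forest_map set set" where
  "conj_S x \<equiv> x <#\<^bsub>NG F\<^esub> S #>\<^bsub>NG F\<^esub> inv\<^bsub>NG F\<^esub> x"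

lemma conj_S_iff: "y \<in> conj_S x \<longleftrightarrow> (\<exists>s\<in>S. y = x \<otimes>\<^bsub>NG F\<^esub> s \<otimes>\<^bsub>NG F\<^esub> inv\<^bsub>NG F\<^esub> x)"
  by (rule mem_conj_coset_iff)

lemma conj_S_subgroup: assumes x: "x \<in> carrier (NG F)" shows "subgroup (conj_S x) (NG F)"
proof -
  interpret group "NG F" by (rule neretin_group_group[OF F])
  interpret S: subgroup S "NG F" by (rule S_subgroup)
  show ?thesis
  proof
    show "conj_S x \<subseteq> carrier (NG F)" using x by (auto simp: conj_S_iff)
    show "\<one>\<^bsub>NG F\<^esub> \<in> conj_S x"
      unfolding conj_S_iff using x by (intro bexI[of _ "\<one>\<^bsub>NG F\<^esub>"]) auto
    show "y \<otimes>\<^bsub>NG F\<^esub> z \<in> conj_S x" if yz: "y \<in> conj_S x" "z \<in> conj_S x" for y z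
    proof -
      obtain s t where st: "s \<in> S" "t \<in> S" "y = x \<otimes>\<^bsub>NG F\<^esub> s \<otimes>\<^bsub>NG F\<^esub> inv\<^bsub>NG F\<^esub> x" "z = x \<otimes>\<^bsub>NG F\<^esub> t \<otimes>\<^bsub>NG F\<^esub> inv\<^bsub>NG F\<^esub> x"
        using yz unfolding conj_S_iff by blast
      then have "y \<otimes>\<^bsub>NG F\<^esub> z = x \<otimes>\<^bsub>NG F\<^esub> (s \<otimes>\<^bsub>NG F\<^esub> t) \<otimes>\<^bsub>NG F\<^esub> inv\<^bsub>NG F\<^esub> x"
        using x by (simp add: m_assoc inv_solve_left')
      then show ?thesis unfolding conj_S_iff using st by blast
    qed
    show "inv\<^bsub>NG F\<^esub> y \<in> conj_S x" if y: "y \<in> conj_S x" for y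
    proof -
      obtain s where s: "s \<in> S" "y = x \<otimes>\<^bsub>NG F\<^esub> s \<otimes>\<^bsub>NG F\<^esub> inv\<^bsub>NG F\<^esub> x" using y unfolding conj_S_iff by blast
      then have "inv\<^bsub>NG F\<^esub> y = x \<otimes>\<^bsub>NG F\<^esub> inv\<^bsub>NG F\<^esub> s \<otimes>\<^bsub>NG F\<^esub> inv\<^bsub>NG F\<^esub> x"
        using x by (simp add: inv_mult_group m_assoc)
      then show ?thesis unfolding conj_S_iff using s(1) by blast
    qed
  qed
qed

text \<open>The intersection of \<open>S\<close> with its conjugate is closed, being cut out by a
  compact set, and has finite index in \<open>S\<close>; so it is open and contains the fixator of a
  ball in \<open>U P\<close>. An element \<open>u\<close> of that fixator is the conjugate by
  \<open>x\<close> of some \<open>s\<close> in \<open>S\<close>, that is, \<open>f'\<close>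
  intertwines \<open>u\<close> with \<open>s\<close>.\<close>

lemma commensurator_sub:
  assumes "x \<in> commensurator (NG F) S" shows "x \<in> carrier (NG P)"
proof -
  let ?G = "(NG F)\<lparr>carrier := S\<rparr>" and ?A = "S \<inter> conj_S x"
  interpret group "NG F" by (rule neretin_group_group[OF F])
  have x: "x \<in> carrier (NG F)" and fin: "finite (rcosets\<^bsub>?G\<^esub> ?A)"
    using assms by (simp_all add: commensurator_def Let_def finite_index_def)
  note TS = topological_group_subgroup[OF topological_group_neretin[OF F] S_subgroup]
  have A: "subgroup ?A ?G"
    using subgroup_incl[OF subgroups_Inter_pair[OF S_subgroup conj_S_subgroup[OF x]] S_subgroup] by simp
  have "closedin \<tau> (conj_S x)"
    using compactin_conj[OF topological_group_neretin[OF F] x compactin_S] Hausdorff_neretin[OF F]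
    by (rule compactin_imp_closedin[rotated])
  then have "closedin (subtopology \<tau> S) ?A" by (auto simp: closedin_subtopology)
  then have "openin (subtopology \<tau> S) ?A" using closed_finite_index_open[OF TS A _ fin] by simp
  then obtain n where n: "germ_fixator P n \<subseteq> ?A"
    using open_in_S_small[of ?A] subgroup.one_closed[OF A] by auto
  obtain f where f: "x = cls f" "almost (U F) f" using x by (auto simp: neretin_carrier)
  note H = aut_closed_universal[OF F]
  obtain f' where f': "almost (U F) f'" "germ_eq (f' \<circ> f) id" "germ_eq (f \<circ> f') id"
    by (rule almost_inverse[OF H f(2)])
  have ix: "inv\<^bsub>NG F\<^esub> x = cls f'" using neretin_inv[OF F f(2) f'(1,2)] f(1) by simp
  have "\<exists>s\<in>U P. germ_eq (f' \<circ> fst u) (fst s \<circ> f')" if u: "u \<in> ball_fixator P n" for u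
  proof -
    have uA: "u \<in> U P" "u \<in> U F" using ball_fixatorD(1)[OF u] UP_UF by blast+
    have "germ u \<in> conj_S x" using u n by (auto simp: germ_fixator_def)
    then obtain y where y: "y \<in> S" "germ u = x \<otimes>\<^bsub>NG F\<^esub> y \<otimes>\<^bsub>NG F\<^esub> inv\<^bsub>NG F\<^esub> x" unfolding conj_S_iff by blast
    then obtain s where s: "s \<in> ball_fixator P 0" "y = germ s" by (auto simp: germ_fixator_def)
    have sU: "s \<in> U P" "s \<in> U F" using ball_fixatorD(1)[OF s(1)] UP_UF by blast+
    have yc: "y \<in> carrier (NG F)" using germ_in[OF sU(2)] s(2) by simp
    have "inv\<^bsub>NG F\<^esub> x \<otimes>\<^bsub>NG F\<^esub> germ u = y \<otimes>\<^bsub>NG F\<^esub> inv\<^bsub>NG F\<^esub> x"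
      unfolding y(2) using x yc by (simp add: m_assoc[symmetric])
    then have "cls (f' \<circ> fst u) = cls (fst s \<circ> f')"
      unfolding ix s(2) germ_def
      using neretin_mult[OF almost_Aut[OF f'(1)] almost_aut[OF order_refl], of u F] neretin_mult[OF almost_aut[OF order_refl] almost_Aut[OF f'(1)], of s F]
        uA sU U_Aut[of P] by auto
    moreover have "almost Aut (f' \<circ> fst u)"
      using almost_Aut[OF almost_comp[OF H f'(1) almost_aut[OF U_Aut uA(2)]]] .
    ultimately show ?thesis using cls_eq_iff sU(1) by blast
  qed
  then have fP: "almost (U P) f'" by (rule intertwiner_almost[OF f'(1)])
  \<comment> \<open>The inverse of \<open>f'\<close> is taken once more, now among the
    \<open>U P\<close>-honest germs; uniqueness of inverses identifies it with
    \<open>x\<close>.\<close>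
  obtain g where g: "almost (U P) g" "germ_eq (g \<circ> f') id" by (rule almost_inverse[OF aut_closed_universal[OF P] fP])
  have ff': "finite_fibres (f' \<circ> f)"
    using finite_fibres_germ_eq[OF _ germ_eq_sym[OF f'(2)]] by (simp add: finite_fibres_def)
  have "germ_eq (g \<circ> id) (g \<circ> (f' \<circ> f))"
    using germ_eq_sym[OF germ_eq_comp[OF germ_eq_refl f'(2) ff']] .
  also have "germ_eq (g \<circ> (f' \<circ> f)) (id \<circ> f)"
    using germ_eq_comp[OF g(2) germ_eq_refl almost_finite_fibres[OF f(2)]] by (simp add: comp_assoc)
  finally have "cls g = x" using cls_cong f(1) by simp
  then show ?thesis using g(1) by (auto simp: neretin_carrier)
qed

text \<open>Product and unit are defined on classes of all almost automorphisms, so the groups for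
  different \<open>F\<close> differ only in their carriers.\<close>

lemma neretin_carrier_update: "(NG F)\<lparr>carrier := A\<rparr> = (NG P)\<lparr>carrier := A\<rparr>"
  by (simp add: neretin_group_def)

lemma neretin_mult_eq: "x \<otimes>\<^bsub>NG F\<^esub> y = x \<otimes>\<^bsub>NG P\<^esub> y"
  by (simp add: neretin_group_def)

lemma neretin_cosets_eq: "x <#\<^bsub>NG F\<^esub> A = x <#\<^bsub>NG P\<^esub> A" "A #>\<^bsub>NG F\<^esub> x = A #>\<^bsub>NG P\<^esub> x"
  by (simp_all add: l_coset_def r_coset_def neretin_mult_eq)

lemma neretin_inv_eq: assumes "x \<in> carrier (NG P)" shows "inv\<^bsub>NG F\<^esub> x = inv\<^bsub>NG P\<^esub> x"
proof -
  obtain f where f: "x = cls f" "almost (U P) f" using assms by (auto simp: neretin_carrier)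
  obtain g where g: "almost (U P) g" "germ_eq (g \<circ> f) id" by (rule almost_inverse[OF aut_closed_universal[OF P] f(2)])
  show ?thesis
    using neretin_inv[OF F almost_mono[OF UP_UF f(2)] almost_mono[OF UP_UF g(1)] g(2)]
      neretin_inv[OF P f(2) g] f(1) by simp
qed

lemma finite_index_eq: "finite_index (NG F) A B = finite_index (NG P) A B"
  by (simp add: finite_index_def neretin_carrier_update)

text \<open>The indices are computed in the topology of the Neretin group of \<open>P\<close>. There
  \<open>S\<close> and its conjugate are compact and open, so their intersection is an open subgroup
  of both and has finite index in each.\<close>

lemma sub_commensurator:
  assumes x: "x \<in> carrier (NG P)" shows "x \<in> commensurator (NG F) S"
proof -
  let ?T = "neretin_topology \<Gamma> P"
  note TG = topological_group_neretin[OF P]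
  interpret group "NG P" by (rule neretin_group_group[OF P])
  have xF: "x \<in> carrier (NG F)" using x neretin_carrier_mono[OF P_subset] by blast
  have S: "subgroup S (NG P)" by (rule germ_fixator_subgroup[OF P])
  have cS: "compactin ?T S" using compactin_germ_stabilizer[OF P] by (simp add: base_stabilizer_eq germ_fixator_def)
  have oS: "openin ?T S" by (rule openin_germ_fixator[OF P])
  have eq: "conj_S x = x <#\<^bsub>NG P\<^esub> S #>\<^bsub>NG P\<^esub> inv\<^bsub>NG P\<^esub> x"
    by (simp add: neretin_cosets_eq neretin_inv_eq[OF x])
  have sub: "conj_S x \<subseteq> carrier (NG P)"
    unfolding eq using x subgroup.mem_carrier[OF S] by (auto simp: mem_conj_coset_iff)
  have C: "subgroup (conj_S x) (NG P)"
  proof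
    note CF = conj_S_subgroup[OF xF]
    show "conj_S x \<subseteq> carrier (NG P)" by (rule sub)
    show "\<one>\<^bsub>NG P\<^esub> \<in> conj_S x" using subgroup.one_closed[OF CF] by (simp add: neretin_one)
    show "y \<otimes>\<^bsub>NG P\<^esub> z \<in> conj_S x" if "y \<in> conj_S x" "z \<in> conj_S x" for y z
      using subgroup.m_closed[OF CF that] by (simp add: neretin_mult_eq)
    show "inv\<^bsub>NG P\<^esub> y \<in> conj_S x" if "y \<in> conj_S x" for y
      using subgroup.m_inv_closed[OF CF that] neretin_inv_eq[of y] that sub by auto
  qed
  have cC: "compactin ?T (conj_S x)" unfolding eq by (rule compactin_conj[OF TG x cS])
  have oC: "openin ?T (conj_S x)"
    unfolding eq using openin_translation(2)[OF TG inv_closed[OF x] openin_translation(1)[OF TG x oS]] .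
  have I: "subgroup (S \<inter> conj_S x) (NG P)" "openin ?T (S \<inter> conj_S x)"
    using subgroups_Inter_pair[OF S C] oS oC by auto
  have "finite_index (NG P) S (S \<inter> conj_S x)"
    by (rule compact_open_finite_index[OF TG S cS I(1) _ I(2)]) blast
  moreover have "finite_index (NG P) (conj_S x) (S \<inter> conj_S x)"
    by (rule compact_open_finite_index[OF TG C cC I(1) _ I(2)]) blast
  ultimately show ?thesis
    using xF by (simp add: commensurator_def Let_def finite_index_eq Int_commute)
qed

lemma commensurator_eq: "commensurator (NG F) S = carrier (NG P)"
  using commensurator_sub sub_commensurator by blast

text \<open>The localization is topologised through \<open>S\<close> as a subspace of the Neretin
  group of \<open>F\<close>. By \<open>germ_fixator_Int_S\<close> the neighbourhoods of the unit in
  \<open>S\<close> are the germ fixators of \<open>P\<close>, which also define the topology of the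
  Neretin group of \<open>P\<close>.\<close>

lemma localization_topology:
  "group_topology_via (NG P) (subtopology \<tau> S) (\<lambda>s. s) = neretin_topology \<Gamma> P"
proof -
  interpret filP: filtered_group "NG P" "germ_fixator P" by (rule filtered_neretin[OF P])
  interpret filF: filtered_group "NG F" "germ_fixator F" by (rule filtered_neretin[OF F])
  have sp: "topspace (subtopology \<tau> S) = S"
    using subgroup.subset[OF S_subgroup] topological_groupD(2)[OF topological_group_neretin[OF F]] by auto
  have "group_topology_via (NG P) (subtopology \<tau> S) (\<lambda>s. s) = coset_topology (NG P) (germ_fixator P)"
  proof (rule filP.group_topology_via_eq)
    show "(\<lambda>s. s) ` topspace (subtopology \<tau> S) \<subseteq> carrier (NG P)"
      using subgroup.subset[OF germ_fixator_subgroup[OF P, of 0]] sp by simp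
    show "\<one>\<^bsub>NG P\<^esub> \<in> topspace (subtopology \<tau> S)"
      using subgroup.one_closed[OF germ_fixator_subgroup[OF P, of 0]] sp by simp
    show "\<one>\<^bsub>NG P\<^esub> = \<one>\<^bsub>NG P\<^esub>" by simp
  next
    fix W h assume W: "openin (subtopology \<tau> S) W" and h: "h \<in> W"
    obtain V where V: "openin \<tau> V" "W = V \<inter> S" using W by (auto simp: openin_subtopology)
    obtain n where n: "h <#\<^bsub>NG F\<^esub> germ_fixator F n \<subseteq> V"
      using V h unfolding neretin_topology_eq[OF F] filF.openin_coset_topology by blast
    have "h <#\<^bsub>NG P\<^esub> germ_fixator P n \<subseteq> W"
    proof
      fix y assume "y \<in> h <#\<^bsub>NG P\<^esub> germ_fixator P n"
      then obtain u where u: "u \<in> germ_fixator P n" "y = h \<otimes>\<^bsub>NG F\<^esub> u"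
        by (auto simp: mem_l_coset_iff neretin_mult_eq)
      then have "u \<in> germ_fixator F n" "u \<in> S" using germ_fixator_Int_S[of n] by blast+
      moreover from this have "y \<in> h <#\<^bsub>NG F\<^esub> germ_fixator F n" using u(2) by (auto simp: mem_l_coset_iff)
      ultimately show "y \<in> W" using n u(2) V(2) h subgroup.m_closed[OF S_subgroup] by auto
    qed
    then show "\<exists>n. h <#\<^bsub>NG P\<^esub> germ_fixator P n \<subseteq> (\<lambda>s. s) ` W" by auto
  next
    fix h n assume "h \<in> topspace (subtopology \<tau> S)"
    then have h: "h \<in> S" "h \<in> carrier (NG F)" using sp subgroup.subset[OF S_subgroup] by blast+
    let ?W = "(h <#\<^bsub>NG F\<^esub> germ_fixator F n) \<inter> S"
    have "openin (subtopology \<tau> S) ?W"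
      using filF.openin_l_coset[OF h(2), of n] unfolding neretin_topology_eq[OF F] by (auto simp: openin_subtopology)
    moreover have "h \<in> ?W" using h filF.l_coset_B_mem[OF h(2)] by blast
    moreover have "?W \<subseteq> h <#\<^bsub>NG P\<^esub> germ_fixator P n"
    proof
      fix y assume y: "y \<in> ?W"
      then obtain u where u: "u \<in> germ_fixator F n" "y = h \<otimes>\<^bsub>NG F\<^esub> u" by (auto simp: mem_l_coset_iff)
      have uc: "u \<in> carrier (NG F)" using u(1) filF.B_carrier by blast
      have "u = inv\<^bsub>NG F\<^esub> h \<otimes>\<^bsub>NG F\<^esub> y" using u(2) h(2) uc by (simp add: filF.m_assoc[symmetric])
      then have "u \<in> S" using y h(1) subgroup.m_closed[OF S_subgroup] subgroup.m_inv_closed[OF S_subgroup] by auto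
      then have "u \<in> germ_fixator P n" using u(1) germ_fixator_Int_S[of n] by blast
      then show "y \<in> h <#\<^bsub>NG P\<^esub> germ_fixator P n" using u(2) by (auto simp: mem_l_coset_iff neretin_mult_eq)
    qed
    ultimately show "\<exists>W. openin (subtopology \<tau> S) W \<and> h \<in> W \<and> (\<lambda>s. s) ` W \<subseteq> h <#\<^bsub>NG P\<^esub> germ_fixator P n"
      by (intro exI[of _ ?W]) auto
  qed
  then show ?thesis using neretin_topology_eq[OF P] by simp
qed

lemma localization_eq: "localization (NG F) \<tau> S = (NG P, neretin_topology \<Gamma> P)"
proof -
  have "(NG F)\<lparr>carrier := commensurator (NG F) S\<rparr> = NG P"
    unfolding commensurator_eq neretin_carrier_update by simp
  then show ?thesis by (simp add: localization_def localization_topology)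
qed

end

theorem theorem18:
  fixes \<Gamma> :: "('v, 'e, 'c :: finite) colored_graph"
    and F P :: "('c \<Rightarrow> 'c) set"
    and d p :: nat
  assumes "CARD('c) = d" and "d \<ge> 3"
    and "regular_tree \<Gamma> d"
    and "legal_coloring \<Gamma>"
    and "prime p"
    and "subgroup F Sym"
    and "sylow_subgroup p (perm_group F) P"
    and "perm_orbits F = perm_orbits P"
    and "\<And>\<omega>. normalizer (perm_group (point_stabilizer (orbit_sym F) \<omega>)) (point_stabilizer P \<omega>)
              = point_stabilizer P \<omega>"
  defines "S \<equiv> class_of_automorphism \<Gamma> ` base_stabilizer \<Gamma> (universal_group \<Gamma> P)"
  shows "local_sylow_subgroup p (neretin_group \<Gamma> F) (neretin_topology \<Gamma> F) S \<and>
         localization (neretin_group \<Gamma> F) (neretin_topology \<Gamma> F) S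
           = (neretin_group \<Gamma> P, neretin_topology \<Gamma> P)"
proof -
  interpret neretin_localization \<Gamma> F P p
    by (intro neretin_localization.intro neretin_localization_axioms.intro local_sylow_tree.intro
        local_sylow_tree_axioms.intro colored_tree.intro) (use assms in simp_all)
  show ?thesis
    unfolding S_def germ_image_ball_fixator using local_sylow localization_eq by blast
qed

end
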